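(* For $a\in\mathcal P:=(\mathbb C\setminus\mathbb R)\cup(0,1)$, the logarithmic monodromy of the closed leaf $S^1\times\{0\}$ in $\mathcal F^a$ is $2\pi\mathrm i(1-a)/a$, and that of the closed leaf $\{0\}\times S^1$ is $2\pi\mathrm i\,a/(1-a)$.
   Context: $S^3\subset\mathbb C^2$ is the unit sphere with its standard orientation (as boundary of the unit ball). $\mathcal F^a$ is the oriented and cooriented $1$-dimensional foliation of $S^3$ tangent to the common kernel of the real and imaginary parts $\omega_1^a,\omega_2^a$ of the restriction to $TS^3$ of $\omega^a=az_1\,\mathrm dz_2-(1-a)z_2\,\mathrm dz_1$; the coorientation is given by $\omega_1^a\wedge\omega_2^a$, and the leaves are oriented so that leaf orientation together with coorientation gives the standard orientation of $S^3$. The form $\omega^a$ (up to multiplication by nowhere zero complex functions) defines a transverse holomorphic structure, i.e. it makes the normal bundle $\nu$ of the foliation (the quotient of $TS^3$ by the tangent line field) a complex line bundle on which the flow along the leaves acts complex linearly. The Hopf circles $S^1\times\{0\}$ and $\{0\}\times S^1$ are closed leaves. Logarithmic monodromy of an oriented closed leaf $\gamma$ of such a foliation of $S^3$: a Seifert surface of the knot $\gamma$ gives (up to homotopy) a nowhere zero section $Z$ of $\nu|_\gamma$ (a vector field along $\gamma$ tangent to the Seifert surface and nowhere tangent to $\gamma$), and hence a complex trivialisation of $\nu|_\gamma$. Use it to identify a neighbourhood of $\gamma$ with a neighbourhood of $S^1\times\{0\}$ in $S^1\times\mathbb C$, where $\gamma$ is identified with $S^1\times\{0\}$ respecting orientations,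 $Z$ with the constant section $1$, and the transverse complex structure with that of $\mathbb C$. For $t\in[0,2\pi]$ let $\varphi_t\colon(\mathbb C,0)\to(\mathbb C,0)$ be the germ of a holomorphic map such that the leaf through $(1,z)$, followed in the positive direction, meets $\{\mathrm e^{\mathrm it}\}\times\mathbb C$ in $(\mathrm e^{\mathrm it},\varphi_t(z))$. (Equivalently, $\varphi_t'(0)\in\mathbb C^*$ is the linear holonomy of $\nu$ along $\gamma$ from time $0$ to time $t$, expressed in the trivialisation $Z$.) Choose $\log\varphi_t'(0)$ continuously in $t$ with $\log\varphi_0'(0)=0$. The logarithmic monodromy of $\gamma$ is $\log\varphi_{2\pi}'(0)$; it is independent of the choices. *)

theory Defs
  imports "HOL-Analysis.Analysis"
begin

text \<open>
  The ambient space is \<open>complex \<times> complex\<close> with its Euclidean norm, so that \<open>S3\<close> below is the unit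
  sphere of C^2.  Objects on \<open>S3\<close> (forms, functions, charts) are represented by objects on open
  subsets of C^2; only their restrictions to \<open>S3\<close> and to its tangent spaces matter.
\<close>

type_synonym C2 = "complex \<times> complex"

primrec Ck_on :: "nat \<Rightarrow> 'a::real_normed_vector set \<Rightarrow> ('a \<Rightarrow> 'b::real_normed_vector) \<Rightarrow> bool" where
  "Ck_on 0 S f \<longleftrightarrow> continuous_on S f"
| "Ck_on (Suc k) S f \<longleftrightarrow>
     (\<forall>x\<in>S. f differentiable at x) \<and> (\<forall>v. Ck_on k S (\<lambda>x. frechet_derivative f (at x) v))"

text \<open>Only used for open sets \<open>S\<close> of a finite-dimensional space, where it is the usual notion.\<close>

definition smooth_on :: "'a::real_normed_vector set \<Rightarrow> ('a \<Rightarrow> 'b::real_normed_vector) \<Rightarrow> bool" where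
  "smooth_on S f \<longleftrightarrow> (\<forall>k. Ck_on k S f)"

abbreviation D :: "('a::real_normed_vector \<Rightarrow> 'b::real_normed_vector) \<Rightarrow> 'a \<Rightarrow> 'a \<Rightarrow> 'b" where
  "D f p \<equiv> frechet_derivative f (at p)"


subsection \<open>The sphere and the foliation of a complex 1-form\<close>

definition S3 :: "C2 set" where
  "S3 = sphere 0 1"

definition tangent_S3 :: "C2 \<Rightarrow> C2 set" where
  "tangent_S3 p = {v. inner p v = 0}"

definition real_coords :: "C2 \<Rightarrow> real ^ 4" where
  "real_coords p = vector [Re (fst p), Im (fst p), Re (snd p), Im (snd p)]"

text \<open>
  The standard orientation of \<open>S3\<close> as the boundary of the unit ball (outward normal first): a basis
  of the tangent space at \<open>p\<close> is positive iff, preceded by \<open>p\<close>, it is a positive basis of C^2.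
\<close>

definition positive_frame_S3 :: "C2 \<Rightarrow> C2 \<Rightarrow> C2 \<Rightarrow> C2 \<Rightarrow> bool" where
  "positive_frame_S3 p v u w \<longleftrightarrow> v \<in> tangent_S3 p \<and> u \<in> tangent_S3 p \<and> w \<in> tangent_S3 p \<and>
     det (vector [real_coords p, real_coords v, real_coords u, real_coords w] :: real ^ 4 ^ 4) > 0"

definition coorientation_form :: "(C2 \<Rightarrow> C2 \<Rightarrow> complex) \<Rightarrow> C2 \<Rightarrow> C2 \<Rightarrow> C2 \<Rightarrow> real" where
  "coorientation_form \<omega> p u w = Re (\<omega> p u) * Im (\<omega> p w) - Re (\<omega> p w) * Im (\<omega> p u)"

text \<open>
  \<open>v\<close> is a positively oriented nonzero tangent vector at \<open>p\<close> of the foliation of \<open>S3\<close> defined by \<open>\<omega>\<close>: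
  it spans the kernel of \<open>\<omega>\<close> and, followed by a pair \<open>(u, w)\<close> which is positive for the
  coorientation \<open>Re \<omega> \<and> Im \<omega>\<close>, gives the orientation of \<open>S3\<close>.  As \<open>\<omega> p v = 0\<close>, this does not
  depend on the pair.
\<close>

definition positive_leaf_vector :: "(C2 \<Rightarrow> C2 \<Rightarrow> complex) \<Rightarrow> C2 \<Rightarrow> C2 \<Rightarrow> bool" where
  "positive_leaf_vector \<omega> p v \<longleftrightarrow> p \<in> S3 \<and> v \<in> tangent_S3 p \<and> \<omega> p v = 0 \<and>
     (\<exists>u w. coorientation_form \<omega> p u w > 0 \<and> positive_frame_S3 p v u w)"

definition omega :: "complex \<Rightarrow> C2 \<Rightarrow> C2 \<Rightarrow> complex" where
  "omega a p v = a * fst p * snd v - (1 - a) * snd p * fst v"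

definition closed_leaf_param :: "(C2 \<Rightarrow> C2 \<Rightarrow> complex) \<Rightarrow> C2 set \<Rightarrow> (real \<Rightarrow> C2) \<Rightarrow> bool" where
  "closed_leaf_param \<omega> K \<gamma> \<longleftrightarrow>
     smooth_on UNIV \<gamma> \<and> (\<forall>t. \<gamma> (t + 2 * pi) = \<gamma> t) \<and> inj_on \<gamma> {0..<2 * pi} \<and> range \<gamma> = K \<and>
     (\<forall>t. positive_leaf_vector \<omega> (\<gamma> t) (vector_derivative \<gamma> (at t)))"


subsection \<open>Seifert surfaces and the framing they induce\<close>

text \<open>
  The tangent space at \<open>p\<close> of a submanifold \<open>M\<close>, possibly with boundary, as the common kernel of the
  differentials of all functions vanishing on \<open>M\<close> near \<open>p\<close>.  At a boundary point it is the full
  tangent plane, not a half plane.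
\<close>

definition tangent_space :: "C2 set \<Rightarrow> C2 \<Rightarrow> C2 set" where
  "tangent_space M p = {v. \<forall>W (h :: C2 \<Rightarrow> real).
     open W \<and> p \<in> W \<and> smooth_on W h \<and> (\<forall>q\<in>M \<inter> W. h q = 0) \<longrightarrow> D h p v = 0}"

text \<open>
  A compact connected oriented surface smoothly embedded in \<open>S3\<close> with boundary \<open>K\<close>.  Near an interior
  point it is the regular zero set in \<open>S3\<close> of a function \<open>h\<close>, near a boundary point it is cut out by
  \<open>h = 0\<close>, \<open>k \<ge> 0\<close> with independent \<open>h\<close> and \<open>k\<close>.  Since \<open>S3\<close> is oriented, an orientation of the
  surface is the same as a continuous normal field \<open>n\<close> in \<open>S3\<close>.
\<close>

definition seifert_surface :: "C2 set \<Rightarrow> C2 set \<Rightarrow> bool" where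
  "seifert_surface K \<Sigma> \<longleftrightarrow>
     \<Sigma> \<subseteq> S3 \<and> compact \<Sigma> \<and> connected \<Sigma> \<and> K \<subseteq> \<Sigma> \<and>
     (\<forall>p\<in>\<Sigma> - K. \<exists>W (h :: C2 \<Rightarrow> real). open W \<and> p \<in> W \<and> smooth_on W h \<and>
        \<Sigma> \<inter> W = {q \<in> S3 \<inter> W. h q = 0} \<and>
        (\<exists>v\<in>tangent_S3 p. D h p v \<noteq> 0)) \<and>
     (\<forall>p\<in>K. \<exists>W (h :: C2 \<Rightarrow> real) (k :: C2 \<Rightarrow> real).
        open W \<and> p \<in> W \<and> smooth_on W h \<and> smooth_on W k \<and>
        \<Sigma> \<inter> W = {q \<in> S3 \<inter> W. h q = 0 \<and> k q \<ge> 0} \<and>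
        K \<inter> W = {q \<in> S3 \<inter> W. h q = 0 \<and> k q = 0} \<and>
        (\<forall>x y. \<exists>v\<in>tangent_S3 p. D h p v = x \<and> D k p v = y)) \<and>
     (\<exists>n. continuous_on \<Sigma> n \<and>
        (\<forall>p\<in>\<Sigma>. n p \<noteq> 0 \<and> n p \<in> tangent_S3 p \<and> (\<forall>v\<in>tangent_space \<Sigma> p. inner (n p) v = 0)))"

definition seifert_section :: "(real \<Rightarrow> C2) \<Rightarrow> C2 set \<Rightarrow> (real \<Rightarrow> C2) \<Rightarrow> bool" where
  "seifert_section \<gamma> \<Sigma> Z \<longleftrightarrow>
     smooth_on UNIV Z \<and> (\<forall>t. Z (t + 2 * pi) = Z t) \<and>
     (\<forall>t. Z t \<in> tangent_space \<Sigma> (\<gamma> t) \<and> Z t \<notin> span {vector_derivative \<gamma> (at t)})"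


subsection \<open>Holonomy and logarithmic monodromy\<close>

text \<open>
  A diffeomorphism \<open>\<Psi>\<close> from the neighbourhood \<open>W \<inter> S3\<close> of the closed leaf \<open>\<gamma>\<close> onto a neighbourhood of
  \<open>S^1 \<times> {0}\<close> in \<open>S^1 \<times> complex\<close>.  It takes \<open>\<gamma> t\<close> to \<open>(exp (\<i> t), 0)\<close>; it takes the class of \<open>Z t\<close>
  modulo the tangent line of the leaf to the class of \<open>(0, 1)\<close>; and on each slice
  \<open>{exp (\<i> t)} \<times> complex\<close> the transverse complex structure, which is the one for which \<open>\<omega>\<close> is complex
  linear, becomes the standard one.
\<close>

definition adapted_chart ::
  "(C2 \<Rightarrow> C2 \<Rightarrow> complex) \<Rightarrow> (real \<Rightarrow> C2) \<Rightarrow> (real \<Rightarrow> C2) \<Rightarrow> C2 set \<Rightarrow> (C2 \<Rightarrow> complex \<times> complex) \<Rightarrow> bool"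
where
  "adapted_chart \<omega> \<gamma> Z W \<Psi> \<longleftrightarrow>
     open W \<and> range \<gamma> \<subseteq> W \<and> smooth_on W \<Psi> \<and>
     inj_on \<Psi> (W \<inter> S3) \<and>
     (\<forall>p\<in>W \<inter> S3. \<forall>v\<in>tangent_S3 p. D \<Psi> p v = 0 \<longrightarrow> v = 0) \<and>
     openin (top_of_set (sphere 0 1 \<times> UNIV)) (\<Psi> ` (W \<inter> S3)) \<and>
     (\<forall>t. \<Psi> (\<gamma> t) = (cis t, 0)) \<and>
     (\<forall>t. snd (D \<Psi> (\<gamma> t) (Z t)) = 1) \<and>
     (\<forall>p\<in>W \<inter> S3. \<exists>c. c \<noteq> 0 \<and>
        (\<forall>v\<in>tangent_S3 p. fst (D \<Psi> p v) = 0 \<longrightarrow> snd (D \<Psi> p v) = c * \<omega> p v))"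

text \<open>
  The germs \<open>\<phi> t\<close>: the leaf through the point with coordinates \<open>(1, z)\<close>, followed in the positive
  direction inside \<open>W\<close>, is the curve \<open>c\<close> with coordinates \<open>(exp (\<i> t), \<phi> t z)\<close>.
\<close>

definition leaf_holonomy ::
  "(C2 \<Rightarrow> C2 \<Rightarrow> complex) \<Rightarrow> C2 set \<Rightarrow> (C2 \<Rightarrow> complex \<times> complex) \<Rightarrow> (real \<Rightarrow> complex \<Rightarrow> complex) \<Rightarrow> bool"
where
  "leaf_holonomy \<omega> W \<Psi> \<phi> \<longleftrightarrow>
     (\<exists>r>0. (\<forall>t\<in>{0..2 * pi}. \<phi> t holomorphic_on ball 0 r) \<and>
       (\<forall>z\<in>ball 0 r. \<phi> 0 z = z \<and>
         (\<exists>c c'. \<forall>t\<in>{0..2 * pi}.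
            c t \<in> W \<inter> S3 \<and> \<Psi> (c t) = (cis t, \<phi> t z) \<and>
            (c has_vector_derivative c' t) (at t within {0..2 * pi}) \<and>
            positive_leaf_vector \<omega> (c t) (c' t))))"

text \<open>
  The value \<open>\<mu>\<close> of \<open>log (\<phi>\<^bsub>2\<pi>\<^esub>'(0))\<close> that results from some choice of parametrisation, Seifert
  surface, section, chart, and holonomy germs; \<open>L\<close> is the continuous branch of the logarithm.
\<close>

definition log_monodromy_value :: "(C2 \<Rightarrow> C2 \<Rightarrow> complex) \<Rightarrow> C2 set \<Rightarrow> complex \<Rightarrow> bool" where
  "log_monodromy_value \<omega> K \<mu> \<longleftrightarrow>
     (\<exists>\<gamma> \<Sigma> Z W \<Psi> \<phi> L.
        closed_leaf_param \<omega> K \<gamma> \<and> seifert_surface K \<Sigma> \<and> seifert_section \<gamma> \<Sigma> Z \<and>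
        adapted_chart \<omega> \<gamma> Z W \<Psi> \<and> leaf_holonomy \<omega> W \<Psi> \<phi> \<and>
        continuous_on {0..2 * pi} L \<and> L 0 = 0 \<and>
        (\<forall>t\<in>{0..2 * pi}. (\<phi> t has_field_derivative exp (L t)) (at 0)) \<and>
        \<mu> = L (2 * pi))"

text \<open>
  \<open>K\<close> is a closed leaf with well-defined logarithmic monodromy \<open>\<mu>\<close>: the choices above can be made,
  and all of them give \<open>\<mu>\<close>.
\<close>

definition has_log_monodromy :: "(C2 \<Rightarrow> C2 \<Rightarrow> complex) \<Rightarrow> C2 set \<Rightarrow> complex \<Rightarrow> bool" where
  "has_log_monodromy \<omega> K \<mu> \<longleftrightarrow> (\<forall>\<nu>. log_monodromy_value \<omega> K \<nu> \<longleftrightarrow> \<nu> = \<mu>)"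

end

theory Submission
  imports Defs
begin

text \<open>
  Put \<open>\<kappa> = (1 - a) / a\<close>.  On the leaves \<open>a z1 dz2 = (1 - a) z2 dz1\<close>, that is, \<open>d log z2 = \<kappa> d log z1\<close>.  Along the
  circle \<open>S\<^sup>1 \<times> {0}\<close> the function \<open>z2\<close> is a complex coordinate on the normal bundle, so in this coordinate
  the linear holonomy after the angle \<open>\<theta>\<close> is multiplication by \<open>exp (\<i> \<kappa> \<theta>)\<close>.  A section \<open>Z\<close> defines another
  trivialisation, in which the holonomy from time \<open>0\<close> to \<open>t\<close> is \<open>exp (\<i> \<kappa> \<theta> t)\<close> multiplied by the quotient
  of the \<open>z2\<close>-components of \<open>Z 0\<close> and \<open>Z t\<close>.  After one turn, its logarithm is \<open>2 \<pi> \<i> \<kappa>\<close> minus \<open>2 \<pi> \<i>\<close> times the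
  winding number of the \<open>z2\<close>-component of \<open>Z\<close> around zero.  The theorem for the first circle is thus a
  combination of the following facts.

  The winding number is zero if \<open>Z\<close> is tangent to a Seifert surface (\<open>winding_zero\<close>).  This is the fact that all
  Seifert surfaces induce the same framing, and it is proved for an arbitrary surface by making Alexander
  duality explicit.  An oriented surface \<open>\<Sigma>\<close> has a function \<open>s\<close> that vanishes on it and changes sign across it
  (\<open>seifert_defining_function\<close>).  From \<open>s\<close> one obtains a map \<open>F\<close> from the complement of the circle to \<open>\<complex> - {0}\<close>
  such that \<open>\<Sigma>\<close> is the preimage of the positive real axis (\<open>seifert_circle_function\<close>).  The
  complement of the circle is an open disk times a circle, so \<open>F\<close> has a logarithm on its universal cover.
  A small meridian crosses \<open>\<Sigma>\<close> once (\<open>meridian_crosses_once\<close>), so \<open>F\<close> has degree one or minus one on it.  Pushing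
  the circle off \<open>\<Sigma>\<close> in the direction of \<open>- Z\<close> or \<open>Z\<close>, whichever points outwards, gives a loop that avoids
  \<open>\<Sigma>\<close> (\<open>outward_push_misses_surface\<close>), so \<open>F\<close> has degree zero on it.  The second degree is, up to sign, the
  winding number in question.

  The linear holonomy is as described, in every adapted chart and for every choice of
  leaf curves (\<open>holonomy_derivative\<close>).  For this, the ordinary differential equation of the leaves is solved
  explicitly near the circle, and a continuity argument shows that leaves starting near the circle stay
  near it for one turn.

  The choices in the definition of the logarithmic monodromy can be made (\<open>model_monodromy\<close>): the Seifert surface
  is the flat half disk where \<open>z2\<close> is real and nonnegative, and the chart is \<open>(z1 / |z1|, z2 |z1| powr (- \<kappa>))\<close>, in which the
  holonomy is exactly multiplication by \<open>exp (\<i> \<kappa> t)\<close>.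

  The interchange of the two coordinates of \<open>\<complex>\<^sup>2\<close> preserves the orientation, takes one circle to the other, and
  replaces \<open>a\<close> by \<open>1 - a\<close> (\<open>has_log_monodromy_swap\<close>).  This gives the theorem for the second circle.
\<close>

section \<open>Differentiability\<close>

lemma Ck_on_has_derivative:
  assumes "Ck_on (Suc k) S f" "x \<in> S"
  shows "(f has_derivative D f x) (at x)"
  using assms by (auto simp: frechet_derivative_works)

text \<open>
  The congruence premise is the statement of the lemma \<open>Ck_on_cong\<close> one order lower; stating it as a
  premise lets the induction that proves that lemma use this rule.
\<close>

lemma Ck_onI:
  fixes f :: "'a::real_normed_vector \<Rightarrow> 'b::real_normed_vector"
  assumes "\<And>x. x \<in> S \<Longrightarrow> (f has_derivative f' x) (at x)"
    and "\<And>v. Ck_on k S (\<lambda>x. f' x v)"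
    and cong: "\<And>g h :: 'a \<Rightarrow> 'b. Ck_on k S g \<Longrightarrow> (\<And>x. x \<in> S \<Longrightarrow> g x = h x) \<Longrightarrow> Ck_on k S h"
  shows "Ck_on (Suc k) S f"
proof -
  have eq: "D f x = f' x" if "x \<in> S" for x
    using assms(1)[OF that] frechet_derivative_at by metis
  have "Ck_on k S (\<lambda>x. D f x v)" for v
    by (rule cong[OF assms(2)]) (simp add: eq)
  then show ?thesis
    using assms(1) by (auto simp: differentiable_def)
qed

lemma Ck_on_cong:
  assumes "open S" "Ck_on k S f" "\<And>x. x \<in> S \<Longrightarrow> f x = g x"
  shows "Ck_on k S g"
  using assms(2,3)
proof (induction k arbitrary: f g)
  case 0
  then show ?case by (simp cong: continuous_on_cong)
next
  case (Suc k)
  show ?case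
  proof (rule Ck_onI[where f' = "D f"])
    show "(g has_derivative D f x) (at x)" if "x \<in> S" for x
      using Ck_on_has_derivative[OF Suc.prems(1) that] assms(1) that Suc.prems(2)
      by (rule has_derivative_transform_within_open)
    show "Ck_on k S (\<lambda>x. D f x v)" for v using Suc.prems(1) by simp
  qed (rule Suc.IH)
qed

lemma Ck_on_SucI:
  assumes "open S" "\<And>x. x \<in> S \<Longrightarrow> (f has_derivative f' x) (at x)"
    and "\<And>v. Ck_on k S (\<lambda>x. f' x v)"
  shows "Ck_on (Suc k) S f"
  using assms(2,3) Ck_on_cong[OF assms(1)] by (rule Ck_onI)

lemma Ck_on_decr: "Ck_on (Suc k) S f \<Longrightarrow> Ck_on k S f"
proof (induction k arbitrary: f)
  case 0
  then show ?case
    using Ck_on_has_derivative[OF 0]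
    by (auto intro!: continuous_at_imp_continuous_on has_derivative_continuous)
next
  case (Suc k)
  show ?case
    using Suc.prems Suc.IH by (auto simp del: Ck_on.simps(1))
qed

lemma Ck_on_subset: "Ck_on k S f \<Longrightarrow> T \<subseteq> S \<Longrightarrow> Ck_on k T f"
  by (induction k arbitrary: f) (auto intro: continuous_on_subset)

lemma Ck_on_const: "open S \<Longrightarrow> Ck_on k S (\<lambda>x. c)"
  by (induction k arbitrary: c) (auto intro!: Ck_on_SucI[where f' = "\<lambda>_ _. 0"] simp del: Ck_on.simps(2))

lemma Ck_on_linear:
  assumes "open S" "bounded_linear f"
  shows "Ck_on k S f"
proof (cases k)
  case 0
  then show ?thesis using assms by (simp add: linear_continuous_on)
next
  case (Suc j)
  show ?thesis unfolding Suc
    by (rule Ck_on_SucI[where f' = "\<lambda>_. f"])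
      (use assms Ck_on_const in \<open>auto intro: bounded_linear_imp_has_derivative\<close>)
qed

lemma Ck_on_add:
  assumes "open S" "Ck_on k S f" "Ck_on k S g"
  shows "Ck_on k S (\<lambda>x. f x + g x)"
  using assms(2,3)
proof (induction k arbitrary: f g)
  case 0
  then show ?case by (auto intro: continuous_intros)
next
  case (Suc k)
  show ?case
    by (rule Ck_on_SucI[where f' = "\<lambda>x v. D f x v + D g x v"])
      (use Suc Ck_on_has_derivative assms(1) in \<open>auto intro!: has_derivative_add simp: frechet_derivative_works\<close>)
qed

lemma Ck_on_bilinear:
  assumes "bounded_bilinear B" "open S" "Ck_on k S f" "Ck_on k S g"
  shows "Ck_on k S (\<lambda>x. B (f x) (g x))"
  using assms(3,4)
proof (induction k arbitrary: f g)
  case 0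
  then show ?case using bounded_bilinear.continuous_on[OF assms(1)] by auto
next
  case (Suc k)
  show ?case
  proof (rule Ck_on_SucI[OF assms(2), where f' = "\<lambda>x v. B (f x) (D g x v) + B (D f x v) (g x)"])
    show "((\<lambda>x. B (f x) (g x)) has_derivative (\<lambda>v. B (f x) (D g x v) + B (D f x v) (g x))) (at x)"
      if "x \<in> S" for x
      using bounded_bilinear.FDERIV[OF assms(1) Ck_on_has_derivative[OF Suc.prems(1) that]
          Ck_on_has_derivative[OF Suc.prems(2) that]] .
    show "Ck_on k S (\<lambda>x. B (f x) (D g x v) + B (D f x v) (g x))" for v
      using Suc.prems Ck_on_decr[OF Suc.prems(1)] Ck_on_decr[OF Suc.prems(2)]
      by (intro Ck_on_add assms(2) Suc.IH) auto
  qed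
qed

lemmas Ck_on_mult = Ck_on_bilinear[OF bounded_bilinear_mult]

lemma Ck_on_linear_compose:
  assumes "bounded_linear L" "open S" "Ck_on k S f"
  shows "Ck_on k S (\<lambda>x. L (f x))"
  using assms(3)
proof (induction k arbitrary: f)
  case 0
  then show ?case using bounded_linear.continuous_on[OF assms(1)] by auto
next
  case (Suc k)
  show ?case
  proof (rule Ck_on_SucI[OF assms(2), where f' = "\<lambda>x v. L (D f x v)"])
    show "((\<lambda>x. L (f x)) has_derivative (\<lambda>v. L (D f x v))) (at x)" if "x \<in> S" for x
      using bounded_linear.has_derivative[OF assms(1) Ck_on_has_derivative[OF Suc.prems that]] .
  qed (use Suc in auto)
qed

lemma Ck_on_compose_linear:
  assumes "bounded_linear L" "open T" "L ` T \<subseteq> S" "Ck_on k S f"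
  shows "Ck_on k T (\<lambda>x. f (L x))"
  using assms(4)
proof (induction k arbitrary: f)
  case 0
  then show ?case
    using assms continuous_on_compose2[of S f T L] linear_continuous_on[of L] by auto
next
  case (Suc k)
  show ?case
  proof (rule Ck_on_SucI[OF assms(2), where f' = "\<lambda>x v. D f (L x) (L v)"])
    show "((\<lambda>x. f (L x)) has_derivative (\<lambda>v. D f (L x) (L v))) (at x)" if "x \<in> T" for x
      using has_derivative_compose[OF bounded_linear_imp_has_derivative[OF assms(1)]
          Ck_on_has_derivative[OF Suc.prems], of x] that assms(3) by auto
    show "Ck_on k T (\<lambda>x. D f (L x) (L v))" for v
      using Suc.IH[of "\<lambda>y. D f y (L v)"] Suc.prems by auto
  qed
qed

lemma Ck_on_Pair:
  assumes "open S" "Ck_on k S f" "Ck_on k S g"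
  shows "Ck_on k S (\<lambda>x. (f x, g x))"
proof -
  have "Ck_on k S (\<lambda>x. (f x, 0) + (0, g x))"
    by (intro Ck_on_add assms Ck_on_linear_compose[of "\<lambda>y. (y, 0)"] Ck_on_linear_compose[of "\<lambda>y. (0, y)"]
        bounded_linear_Pair bounded_linear_ident bounded_linear_zero)
  then show ?thesis by simp
qed

lemma Ck_on_exp:
  fixes f :: "'a::real_normed_vector \<Rightarrow> complex"
  assumes "open S" "Ck_on k S f"
  shows "Ck_on k S (\<lambda>x. exp (f x))"
  using assms(2)
proof (induction k)
  case 0
  then show ?case by (auto intro: continuous_intros)
next
  case (Suc k)
  show ?case
  proof (rule Ck_on_SucI[OF assms(1), where f' = "\<lambda>x v. exp (f x) * D f x v"])
    show "((\<lambda>x. exp (f x)) has_derivative (\<lambda>v. exp (f x) * D f x v)) (at x)" if "x \<in> S" for x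
      using has_derivative_compose[OF Ck_on_has_derivative[OF Suc.prems that],
        of exp "(*) (exp (f x))"] DERIV_exp[of "f x"] by (simp add: has_field_derivative_def)
    show "Ck_on k S (\<lambda>x. exp (f x) * D f x v)" for v
      using Suc.IH Suc.prems Ck_on_decr[OF Suc.prems] by (intro Ck_on_mult assms(1)) auto
  qed
qed

lemma smooth_onD:
  assumes "smooth_on W f" "x \<in> W"
  shows "(f has_derivative D f x) (at x)" "continuous_on W (\<lambda>x. D f x v)"
  using assms Ck_on_has_derivative[of 0 W f x] unfolding smooth_on_def
  by (auto dest!: spec[of _ "Suc 0"])

lemma smooth_on_continuous: "smooth_on W f \<Longrightarrow> continuous_on W f"
  unfolding smooth_on_def using Ck_on.simps(1) by blast

lemma smooth_on_subset: "smooth_on W f \<Longrightarrow> V \<subseteq> W \<Longrightarrow> smooth_on V f"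
  unfolding smooth_on_def using Ck_on_subset by blast

lemma smooth_on_linear: "open S \<Longrightarrow> bounded_linear f \<Longrightarrow> smooth_on S f"
  unfolding smooth_on_def using Ck_on_linear by blast

text \<open>
  Strict differentiability: unlike in the Frechet derivative, both points vary.  The estimate
  therefore controls increments of \<open>f\<close> along all short segments near \<open>q\<close>, and it survives
  multiplication by a Lipschitz bump function when \<open>f q = 0\<close>.
\<close>

definition strict_deriv ::
  "('a::real_normed_vector \<Rightarrow> 'b::real_normed_vector) \<Rightarrow> ('a \<Rightarrow> 'b) \<Rightarrow> 'a \<Rightarrow> bool" where
  "strict_deriv f f' q \<longleftrightarrow> bounded_linear f' \<and>
     (\<forall>\<eta>>0. \<exists>r>0. \<forall>x\<in>ball q r. \<forall>y\<in>ball q r. norm (f x - f y - f' (x - y)) \<le> \<eta> * norm (x - y))"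

lemma strict_derivD:
  assumes "strict_deriv f f' q" "\<eta> > 0"
  obtains r where "r > 0"
    "\<And>x y. x \<in> ball q r \<Longrightarrow> y \<in> ball q r \<Longrightarrow> norm (f x - f y - f' (x - y)) \<le> \<eta> * norm (x - y)"
  using assms unfolding strict_deriv_def by blast

lemma strict_deriv_linear: "strict_deriv f f' q \<Longrightarrow> bounded_linear f'"
  by (simp add: strict_deriv_def)

text \<open>
  The mean value inequality for \<open>f - f' q\<close> on a ball on which \<open>f'\<close> differs little from \<open>f' q\<close>.
\<close>

lemma strict_deriv_C1:
  fixes f :: "'a::euclidean_space \<Rightarrow> 'b::real_normed_vector"
  assumes W: "open W" "q \<in> W" and der: "\<And>x. x \<in> W \<Longrightarrow> (f has_derivative f' x) (at x)"
    and cont: "\<And>v. continuous_on W (\<lambda>x. f' x v)"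
  shows "strict_deriv f (f' q) q"
  unfolding strict_deriv_def
proof (intro conjI allI impI)
  show bl: "bounded_linear (f' q)" using der[OF W(2)] by (rule has_derivative_bounded_linear)
  fix \<eta> :: real assume \<eta>: "\<eta> > 0"
  define c where "c = \<eta> / real (card (Basis :: 'a set))"
  have cpos: "c > 0" using \<eta> by (simp add: c_def card_gt_0_iff)
  have "\<forall>\<^sub>F x in at q. \<forall>b\<in>Basis. dist (f' x b) (f' q b) < c"
  proof (rule eventually_ball_finite)
    show "\<forall>b\<in>Basis. \<forall>\<^sub>F x in at q. dist (f' x b) (f' q b) < c"
      using cont W cpos by (metis continuous_on_eq_continuous_at isCont_def tendstoD)
  qed simp
  moreover have "\<forall>\<^sub>F x in at q. x \<in> W" using W by (rule eventually_at_in_open')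
  ultimately have "\<forall>\<^sub>F x in at q. x \<in> W \<and> (\<forall>b\<in>Basis. dist (f' x b) (f' q b) < c)"
    by eventually_elim auto
  then obtain r where r: "r > 0" "\<And>x. x \<noteq> q \<Longrightarrow> dist x q < r \<Longrightarrow> x \<in> W \<and> (\<forall>b\<in>Basis. dist (f' x b) (f' q b) < c)"
    unfolding eventually_at by (metis UNIV_I)
  have r': "x \<in> W" "b \<in> Basis \<Longrightarrow> norm (f' x b - f' q b) \<le> c" if "x \<in> ball q r" for x b
  proof -
    have "x = q \<or> x \<in> W \<and> (\<forall>b\<in>Basis. dist (f' x b) (f' q b) < c)"
      using r(2)[of x] that by (auto simp: dist_commute)
    then show "x \<in> W" "b \<in> Basis \<Longrightarrow> norm (f' x b - f' q b) \<le> c"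
      using W(2) cpos by (auto simp: dist_norm less_imp_le)
  qed
  have on: "onorm (\<lambda>v. f' x v - f' q v) \<le> \<eta>" if x: "x \<in> ball q r" for x
  proof (rule onorm_le)
    fix v :: 'a
    have lin: "bounded_linear (\<lambda>v. f' x v - f' q v)"
      using bl der[OF r'(1)[OF x]] by (intro bounded_linear_sub) (auto dest: has_derivative_bounded_linear)
    have "f' x v - f' q v = (\<Sum>b\<in>Basis. (v \<bullet> b) *\<^sub>R (f' x b - f' q b))"
      using linear_sum[OF bounded_linear.linear[OF lin], of "\<lambda>b. (v \<bullet> b) *\<^sub>R b" Basis]
        linear_scale[OF bounded_linear.linear[OF lin]]
      by (simp add: euclidean_representation)
    also have "norm \<dots> \<le> (\<Sum>b\<in>(Basis::'a set). c * norm v)"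
    proof (rule sum_norm_le)
      fix b :: 'a assume b: "b \<in> Basis"
      have "\<bar>v \<bullet> b\<bar> * norm (f' x b - f' q b) \<le> norm v * c"
        using r'(2)[OF x b] Basis_le_norm[OF b, of v] by (intro mult_mono) auto
      then show "norm ((v \<bullet> b) *\<^sub>R (f' x b - f' q b)) \<le> c * norm v" by (simp add: mult.commute)
    qed
    also have "\<dots> = \<eta> * norm v" by (simp add: c_def)
    finally show "norm (f' x v - f' q v) \<le> \<eta> * norm v" .
  qed
  show "\<exists>r>0. \<forall>x\<in>ball q r. \<forall>y\<in>ball q r. norm (f x - f y - f' q (x - y)) \<le> \<eta> * norm (x - y)"
  proof (intro exI[of _ r] conjI ballI r(1))
    fix x y assume xy: "x \<in> ball q r" "y \<in> ball q r"
    have "norm ((f x - f' q x) - (f y - f' q y)) \<le> \<eta> * norm (x - y)"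
    proof (rule differentiable_bound[OF convex_ball _ on xy])
      fix z assume z: "z \<in> ball q r"
      show "((\<lambda>x. f x - f' q x) has_derivative (\<lambda>v. f' z v - f' q v)) (at z within ball q r)"
        using has_derivative_diff[OF der[OF r'(1)[OF z]] bounded_linear_imp_has_derivative[OF bl]]
        by (rule has_derivative_at_withinI)
    qed
    moreover have "(f x - f' q x) - (f y - f' q y) = f x - f y - f' q (x - y)"
      unfolding linear_diff[OF bounded_linear.linear[OF bl]] by (simp add: algebra_simps)
    ultimately show "norm (f x - f y - f' q (x - y)) \<le> \<eta> * norm (x - y)"
      by simp
  qed
qed

lemma smooth_on_strict_deriv:
  fixes f :: "'a::euclidean_space \<Rightarrow> 'b::real_normed_vector"
  assumes "smooth_on W f" "open W" "q \<in> W"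
  shows "strict_deriv f (D f q) q"
  using strict_deriv_C1[OF assms(2,3), of f "D f"] smooth_onD[OF assms(1)] assms(3) by blast

lemma strict_deriv_lipschitz:
  assumes "strict_deriv f f' q"
  obtains r C where "r > 0" "C > 0"
    "\<And>x y. x \<in> ball q r \<Longrightarrow> y \<in> ball q r \<Longrightarrow> norm (f x - f y) \<le> C * norm (x - y)"
proof -
  obtain r where r: "r > 0"
    "\<And>x y. x \<in> ball q r \<Longrightarrow> y \<in> ball q r \<Longrightarrow> norm (f x - f y - f' (x - y)) \<le> 1 * norm (x - y)"
    using strict_derivD[OF assms zero_less_one] by metis
  obtain C where C: "C > 0" "\<And>v. norm (f' v) \<le> norm v * C"
    using bounded_linear.pos_bounded[OF strict_deriv_linear[OF assms]] by auto
  show ?thesis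
  proof (rule that[of r "C + 1"])
    fix x y assume xy: "x \<in> ball q r" "y \<in> ball q r"
    have "norm (f x - f y) \<le> norm (f x - f y - f' (x - y)) + norm (f' (x - y))"
      by norm
    also have "\<dots> \<le> 1 * norm (x - y) + norm (x - y) * C"
      using r(2)[OF xy] C(2) by (rule add_mono)
    finally show "norm (f x - f y) \<le> (C + 1) * norm (x - y)" by (simp add: algebra_simps)
  qed (use r C in auto)
qed

lemma strict_deriv_compose:
  assumes f: "strict_deriv f f' q" and g: "strict_deriv g g' (f q)"
  shows "strict_deriv (\<lambda>x. g (f x)) (\<lambda>v. g' (f' v)) q"
  unfolding strict_deriv_def
proof (intro conjI allI impI)
  show "bounded_linear (\<lambda>v. g' (f' v))"
    using bounded_linear_compose[OF strict_deriv_linear[OF g] strict_deriv_linear[OF f]] .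
  fix \<eta> :: real assume \<eta>: "\<eta> > 0"
  obtain r1 C where r1: "r1 > 0" "C > 0"
    "\<And>x y. x \<in> ball q r1 \<Longrightarrow> y \<in> ball q r1 \<Longrightarrow> norm (f x - f y) \<le> C * norm (x - y)"
    using strict_deriv_lipschitz[OF f] by metis
  obtain G where G: "G > 0" "\<And>v. norm (g' v) \<le> norm v * G"
    using bounded_linear.pos_bounded[OF strict_deriv_linear[OF g]] by auto
  obtain r2 where r2: "r2 > 0" "\<And>x y. x \<in> ball q r2 \<Longrightarrow> y \<in> ball q r2 \<Longrightarrow>
      norm (f x - f y - f' (x - y)) \<le> (\<eta> / (2 * G)) * norm (x - y)"
    using strict_derivD[OF f, of "\<eta> / (2 * G)"] G(1) \<eta> by (metis divide_pos_pos mult_pos_pos zero_less_numeral)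
  obtain r3 where r3: "r3 > 0" "\<And>x y. x \<in> ball (f q) r3 \<Longrightarrow> y \<in> ball (f q) r3 \<Longrightarrow>
      norm (g x - g y - g' (x - y)) \<le> (\<eta> / (2 * C)) * norm (x - y)"
    using strict_derivD[OF g, of "\<eta> / (2 * C)"] r1(2) \<eta> by (metis divide_pos_pos mult_pos_pos zero_less_numeral)
  define r where "r = min r1 (min r2 (r3 / C))"
  show "\<exists>r>0. \<forall>x\<in>ball q r. \<forall>y\<in>ball q r. norm (g (f x) - g (f y) - g' (f' (x - y))) \<le> \<eta> * norm (x - y)"
  proof (intro exI[of _ r] conjI ballI)
    show "r > 0" using r1 r2 r3 by (simp add: r_def)
    fix x y assume xy: "x \<in> ball q r" "y \<in> ball q r"
    have in3: "f z \<in> ball (f q) r3" if "z \<in> ball q r" for z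
    proof -
      have "norm (f q - f z) \<le> C * norm (q - z)"
        using r1(1) that by (intro r1(3)) (auto simp: r_def)
      also have "\<dots> < C * (r3 / C)"
        using that r1(2) by (intro mult_strict_left_mono) (auto simp: r_def dist_norm)
      finally show ?thesis using r1(2) by (simp add: dist_norm)
    qed
    have x12: "x \<in> ball q r1" "y \<in> ball q r1" "x \<in> ball q r2" "y \<in> ball q r2"
      using xy by (auto simp: r_def)
    have "g (f x) - g (f y) - g' (f' (x - y)) =
        (g (f x) - g (f y) - g' (f x - f y)) + g' (f x - f y - f' (x - y))"
      using linear_diff[OF bounded_linear.linear[OF strict_deriv_linear[OF g]]] by simp
    then have "norm (g (f x) - g (f y) - g' (f' (x - y))) \<le>
        norm (g (f x) - g (f y) - g' (f x - f y)) + norm (g' (f x - f y - f' (x - y)))"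
      by (metis norm_triangle_ineq)
    also have "\<dots> \<le> (\<eta> / (2 * C)) * (C * norm (x - y)) + ((\<eta> / (2 * G)) * norm (x - y)) * G"
    proof (rule add_mono)
      have "norm (g (f x) - g (f y) - g' (f x - f y)) \<le> (\<eta> / (2 * C)) * norm (f x - f y)"
        using r3(2)[OF in3[OF xy(1)] in3[OF xy(2)]] .
      also have "\<dots> \<le> (\<eta> / (2 * C)) * (C * norm (x - y))"
        using r1(3)[OF x12(1,2)] \<eta> r1(2) by (intro mult_left_mono) auto
      finally show "norm (g (f x) - g (f y) - g' (f x - f y)) \<le> (\<eta> / (2 * C)) * (C * norm (x - y))" .
      have "norm (g' (f x - f y - f' (x - y))) \<le> norm (f x - f y - f' (x - y)) * G" by (rule G(2))
      also have "\<dots> \<le> ((\<eta> / (2 * G)) * norm (x - y)) * G"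
        using r2(2)[OF x12(3,4)] G(1) by (intro mult_right_mono) auto
      finally show "norm (g' (f x - f y - f' (x - y))) \<le> ((\<eta> / (2 * G)) * norm (x - y)) * G" .
    qed
    also have "\<dots> = \<eta> * norm (x - y)" using G(1) r1(2) by (simp add: field_simps)
    finally show "norm (g (f x) - g (f y) - g' (f' (x - y))) \<le> \<eta> * norm (x - y)" .
  qed
qed

lemma strict_deriv_zero_near:
  assumes "r > 0" "\<And>x. x \<in> ball q r \<Longrightarrow> f x = 0"
  shows "strict_deriv f (\<lambda>_. 0) q"
  unfolding strict_deriv_def using assms by (auto intro!: exI[of _ r])

lemma strict_deriv_add:
  assumes f: "strict_deriv f f' q" and g: "strict_deriv g g' q"
  shows "strict_deriv (\<lambda>x. f x + g x) (\<lambda>v. f' v + g' v) q"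
  unfolding strict_deriv_def
proof (intro conjI allI impI)
  show "bounded_linear (\<lambda>v. f' v + g' v)"
    using bounded_linear_add[OF strict_deriv_linear[OF f] strict_deriv_linear[OF g]] .
  fix \<eta> :: real assume \<eta>: "\<eta> > 0"
  then have h: "\<eta> / 2 > 0" by simp
  obtain r1 where r1: "r1 > 0" "\<And>x y. x \<in> ball q r1 \<Longrightarrow> y \<in> ball q r1 \<Longrightarrow>
      norm (f x - f y - f' (x - y)) \<le> (\<eta> / 2) * norm (x - y)"
    using strict_derivD[OF f h] by metis
  obtain r2 where r2: "r2 > 0" "\<And>x y. x \<in> ball q r2 \<Longrightarrow> y \<in> ball q r2 \<Longrightarrow>
      norm (g x - g y - g' (x - y)) \<le> (\<eta> / 2) * norm (x - y)"
    using strict_derivD[OF g h] by metis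
  have "norm (f x + g x - (f y + g y) - (f' (x - y) + g' (x - y))) \<le> \<eta> * norm (x - y)"
    if "x \<in> ball q (min r1 r2)" "y \<in> ball q (min r1 r2)" for x y
  proof -
    have "f x + g x - (f y + g y) - (f' (x - y) + g' (x - y)) =
      (f x - f y - f' (x - y)) + (g x - g y - g' (x - y))" by (simp add: algebra_simps)
    then have "norm (f x + g x - (f y + g y) - (f' (x - y) + g' (x - y))) \<le>
      norm (f x - f y - f' (x - y)) + norm (g x - g y - g' (x - y))"
      by (metis norm_triangle_ineq)
    also have "\<dots> \<le> (\<eta> / 2) * norm (x - y) + (\<eta> / 2) * norm (x - y)"
      using that by (intro add_mono r1 r2) auto
    finally show ?thesis by simp
  qed
  then show "\<exists>r>0. \<forall>x\<in>ball q r. \<forall>y\<in>ball q r.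
      norm (f x + g x - (f y + g y) - (f' (x - y) + g' (x - y))) \<le> \<eta> * norm (x - y)"
    using r1(1) r2(1) by (intro exI[of _ "min r1 r2"]) auto
qed

lemma strict_deriv_sum:
  assumes "finite I" "\<And>i. i \<in> I \<Longrightarrow> strict_deriv (f i) (f' i) q"
  shows "strict_deriv (\<lambda>x. \<Sum>i\<in>I. f i x) (\<lambda>v. \<Sum>i\<in>I. f' i v) q"
  using assms
proof (induction I rule: finite_induct)
  case empty
  then show ?case using strict_deriv_zero_near[of 1 q "\<lambda>_. 0"] by simp
next
  case (insert i I)
  then show ?case using strict_deriv_add[of "f i" "f' i" q] by simp
qed

text \<open>
  A merely Lipschitz factor suffices: its increments are multiplied by values of \<open>h\<close>, which
  are small because \<open>h\<close> vanishes at the point.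
\<close>

lemma strict_deriv_lipschitz_mult:
  fixes b h :: "'a::real_normed_vector \<Rightarrow> real"
  assumes h: "strict_deriv h h' q" and h0: "h q = 0"
    and b: "\<And>x y. \<bar>b x - b y\<bar> \<le> norm (x - y)"
  shows "strict_deriv (\<lambda>x. b x * h x) (\<lambda>v. b q * h' v) q"
  unfolding strict_deriv_def
proof (intro conjI allI impI)
  show "bounded_linear (\<lambda>v. b q * h' v)"
    using bounded_linear_mult_right[THEN bounded_linear_compose, OF strict_deriv_linear[OF h]] .
  fix \<eta> :: real assume \<eta>: "\<eta> > 0"
  define B where "B = \<bar>b q\<bar> + 1"
  obtain r1 C where r1: "r1 > 0" "C > 0"
    "\<And>x y. x \<in> ball q r1 \<Longrightarrow> y \<in> ball q r1 \<Longrightarrow> norm (h x - h y) \<le> C * norm (x - y)"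
    using strict_deriv_lipschitz[OF h] by metis
  have B: "B > 0" by (simp add: B_def)
  obtain r2 where r2: "r2 > 0" "\<And>x y. x \<in> ball q r2 \<Longrightarrow> y \<in> ball q r2 \<Longrightarrow>
      norm (h x - h y - h' (x - y)) \<le> (\<eta> / (3 * B)) * norm (x - y)"
    using strict_derivD[OF h, of "\<eta> / (3 * B)"] B \<eta> by (metis divide_pos_pos mult_pos_pos zero_less_numeral)
  define r where "r = min r1 (min r2 (\<eta> / (3 * C)))"
  show "\<exists>r>0. \<forall>x\<in>ball q r. \<forall>y\<in>ball q r.
      norm (b x * h x - b y * h y - b q * h' (x - y)) \<le> \<eta> * norm (x - y)"
  proof (intro exI[of _ r] conjI ballI)
    show "r > 0" using r1 r2 \<eta> by (simp add: r_def)
    fix x y assume xy: "x \<in> ball q r" "y \<in> ball q r"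
    have "b x * h x - b y * h y - b q * h' (x - y) =
      b q * (h x - h y - h' (x - y)) + ((b x - b q) * (h x - h y) + (b x - b y) * h y)"
      by (simp add: algebra_simps)
    then have "\<bar>b x * h x - b y * h y - b q * h' (x - y)\<bar> \<le>
      \<bar>b q\<bar> * \<bar>h x - h y - h' (x - y)\<bar> + (\<bar>b x - b q\<bar> * \<bar>h x - h y\<bar> + \<bar>b x - b y\<bar> * \<bar>h y\<bar>)"
      unfolding abs_mult[symmetric] by linarith
    also have "\<dots> \<le> B * ((\<eta> / (3 * B)) * norm (x - y)) +
        ((\<eta> / (3 * C)) * (C * norm (x - y)) + norm (x - y) * (\<eta> / 3))"
    proof (intro add_mono mult_mono)
      show "\<bar>b q\<bar> \<le> B" by (simp add: B_def)
      show "\<bar>h x - h y - h' (x - y)\<bar> \<le> \<eta> / (3 * B) * norm (x - y)"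
        using r2(2)[of x y] xy by (auto simp: r_def)
      show "\<bar>b x - b q\<bar> \<le> \<eta> / (3 * C)"
        using b[of x q] xy by (auto simp: r_def dist_norm norm_minus_commute)
      show "\<bar>h x - h y\<bar> \<le> C * norm (x - y)"
        using r1(3)[of x y] xy by (auto simp: r_def)
      show "\<bar>b x - b y\<bar> \<le> norm (x - y)" by (rule b)
      have "\<bar>h y - h q\<bar> \<le> C * norm (y - q)" using r1(3)[of y q] xy r1(1) by (auto simp: r_def)
      also have "\<dots> \<le> C * (\<eta> / (3 * C))" using xy r1(2)
        by (intro mult_left_mono) (auto simp: r_def dist_norm norm_minus_commute)
      finally show "\<bar>h y\<bar> \<le> \<eta> / 3" using r1(2) h0 by simp
    qed (use B \<eta> r1 in auto)
    also have "\<dots> = \<eta> * norm (x - y)" using B r1(2) by (simp add: field_simps)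
    finally show "norm (b x * h x - b y * h y - b q * h' (x - y)) \<le> \<eta> * norm (x - y)" by simp
  qed
qed

section \<open>Approximating tangent directions on the sphere\<close>

lemma S3_iff: "p \<in> S3 \<longleftrightarrow> norm p = 1"
  by (simp add: S3_def)

text \<open>
  On nonzero vectors \<open>sgn\<close> is the radial projection onto the unit sphere; it is used throughout to turn
  functions near the sphere into functions that are constant along rays.
\<close>

lemma strict_deriv_sgn:
  fixes q :: "'a::euclidean_space"
  assumes "norm q = 1"
  shows "strict_deriv sgn (\<lambda>v. v - (q \<bullet> v) *\<^sub>R q) q"
proof -
  define f' :: "'a \<Rightarrow> 'a \<Rightarrow> 'a"
    where "f' = (\<lambda>x v. inverse (norm x) *\<^sub>R v - (inverse (norm x) * (v \<bullet> sgn x) * inverse (norm x)) *\<^sub>R x)"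
  have "strict_deriv sgn (f' q) q"
  proof (rule strict_deriv_C1[of "- {0}"])
    show "(sgn has_derivative f' x) (at x)" if "x \<in> - {0}" for x :: 'a
    proof -
      have x: "x \<noteq> 0" using that by simp
      have "((\<lambda>x. inverse (norm x)) has_derivative
          (\<lambda>v. - (inverse (norm x) * (v \<bullet> sgn x) * inverse (norm x)))) (at x)"
        using x by (intro Deriv.has_derivative_inverse has_derivative_norm) auto
      from has_derivative_scaleR[OF this has_derivative_ident]
      show ?thesis by (simp add: f'_def sgn_div_norm[abs_def] scaleR_scaleR)
    qed
    show "continuous_on (- {0}) (\<lambda>x. f' x v)" for v
      unfolding f'_def sgn_div_norm by (intro continuous_intros) auto
  qed (use assms in auto)
  moreover have "f' q = (\<lambda>v. v - (q \<bullet> v) *\<^sub>R q)"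
    using assms by (simp add: f'_def sgn_div_norm inner_commute)
  ultimately show ?thesis by simp
qed

lemma continuous_sgn:
  fixes q :: "'a::euclidean_space"
  assumes "norm q = 1" "open W" "q \<in> W"
  obtains r where "0 < r" "r < 1" "\<And>x. x \<in> ball q r \<Longrightarrow> x \<noteq> 0 \<and> sgn x \<in> W"
proof -
  have "isCont (sgn :: 'a \<Rightarrow> 'a) q" using assms(1) by (intro continuous_intros) auto
  then have "(sgn \<longlongrightarrow> q) (at q)"
    using assms(1) by (simp add: isCont_def sgn_div_norm)
  then have "\<forall>\<^sub>F x in at q. sgn x \<in> W"
    using assms(2,3) topological_tendstoD by blast
  then obtain d where d: "d > 0" "\<And>x. x \<noteq> q \<Longrightarrow> dist x q < d \<Longrightarrow> sgn x \<in> W"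
    unfolding eventually_at by auto
  show ?thesis
  proof (rule that[of "min d (1/2)"])
    fix x assume x: "x \<in> ball q (min d (1/2))"
    then have "x \<noteq> 0" using assms(1) by auto
    moreover have "sgn x \<in> W"
      using d(2)[of x] x assms(1,3) by (cases "x = q") (auto simp: dist_commute sgn_div_norm)
    ultimately show "x \<noteq> 0 \<and> sgn x \<in> W" by simp
  qed (use d in auto)
qed

text \<open>
  The Bouligand cone of directions in which \<open>M\<close> can be approached.  At a boundary point of a surface
  it contains only the inward half of the tangent plane, whereas \<open>tangent_space\<close> is the whole plane;
  this is how inward and outward sections of a framing are told apart.
\<close>

definition contingent :: "'a::real_normed_vector set \<Rightarrow> 'a \<Rightarrow> 'a \<Rightarrow> bool" where
  "contingent M q v \<longleftrightarrow>
     (\<forall>\<eta>>0. \<forall>\<delta>>0. \<exists>\<epsilon>. 0 < \<epsilon> \<and> \<epsilon> < \<delta> \<and> (\<exists>x\<in>M. norm (x - q - \<epsilon> *\<^sub>R v) \<le> \<eta> * \<epsilon>))"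

text \<open>
  Along points \<open>x = q + \<epsilon> v + o(\<epsilon>)\<close> of \<open>M\<close> one has \<open>0 \<le> k x = \<epsilon> k' v + o(\<epsilon>)\<close>.
\<close>

lemma contingent_deriv_nonneg:
  fixes k :: "'a::real_normed_vector \<Rightarrow> real"
  assumes con: "contingent M q v" and k: "strict_deriv k k' q"
    and W: "open W" "q \<in> W" and nonneg: "\<And>x. x \<in> M \<inter> W \<Longrightarrow> k x \<ge> 0" and k0: "k q = 0"
  shows "k' v \<ge> 0"
proof (rule ccontr)
  assume "\<not> k' v \<ge> 0"
  define a where "a = - k' v"
  have a: "a > 0" using \<open>\<not> k' v \<ge> 0\<close> by (simp add: a_def)
  obtain C where C: "C > 0" "\<And>u. norm (k' u) \<le> norm u * C"
    using bounded_linear.pos_bounded[OF strict_deriv_linear[OF k]] by auto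
  define V where "V = norm v + 1"
  have vpos: "V > 0" unfolding V_def by (smt (verit) norm_ge_zero)
  define e where "e = a / (4 * V)"
  have e: "e > 0" using a vpos by (simp add: e_def)
  define \<eta> where "\<eta> = min 1 (a / (4 * C))"
  have \<eta>: "\<eta> > 0" "\<eta> \<le> 1" "\<eta> * C \<le> a / 4" using a C(1) by (auto simp: \<eta>_def min_def field_simps)
  obtain r where r: "r > 0" "\<And>x y. x \<in> ball q r \<Longrightarrow> y \<in> ball q r \<Longrightarrow>
      norm (k x - k y - k' (x - y)) \<le> e * norm (x - y)"
    using strict_derivD[OF k e] by metis
  obtain r' where r': "r' > 0" "ball q r' \<subseteq> W" using W openE by metis
  define \<delta> where "\<delta> = min r r' / V"
  have \<delta>: "\<delta> > 0" using r r' vpos by (simp add: \<delta>_def)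
  obtain \<epsilon> x where \<epsilon>: "0 < \<epsilon>" "\<epsilon> < \<delta>" "x \<in> M" "norm (x - q - \<epsilon> *\<^sub>R v) \<le> \<eta> * \<epsilon>"
    using con \<eta>(1) \<delta> unfolding contingent_def by metis
  have nx: "norm (x - q) \<le> \<epsilon> * V"
  proof -
    have "norm (x - q) \<le> norm (x - q - \<epsilon> *\<^sub>R v) + norm (\<epsilon> *\<^sub>R v)"
      using norm_triangle_sub[of "x - q" "\<epsilon> *\<^sub>R v"] by simp
    also have "\<dots> \<le> 1 * \<epsilon> + \<epsilon> * norm v"
      using \<epsilon> \<eta> by (intro add_mono order_trans[OF \<epsilon>(4)] mult_right_mono) auto
    finally show ?thesis by (simp add: V_def algebra_simps)
  qed
  also have "\<dots> < min r r'" using \<epsilon>(2) vpos by (simp add: \<delta>_def field_simps)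
  finally have "dist q x < min r r'" by (simp add: dist_norm norm_minus_commute)
  then have xr: "x \<in> ball q r" "x \<in> W" using r' by auto
  have "k x - k' (x - q) \<le> e * norm (x - q)"
    using r(2)[OF xr(1), of q] r(1) k0 by auto
  also have "\<dots> \<le> e * (\<epsilon> * V)" using nx e by (intro mult_left_mono) auto
  also have "\<dots> = \<epsilon> * (a / 4)" using vpos by (simp add: e_def)
  finally have 1: "k x - k' (x - q) \<le> \<epsilon> * (a / 4)" .
  have "k' (x - q - \<epsilon> *\<^sub>R v) \<le> norm (x - q - \<epsilon> *\<^sub>R v) * C" using C(2)[of "x - q - \<epsilon> *\<^sub>R v"] by simp
  also have "\<dots> \<le> (\<eta> * \<epsilon>) * C" using \<epsilon>(4) C(1) by (intro mult_right_mono) auto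
  also have "\<dots> \<le> \<epsilon> * (a / 4)" using \<eta>(3) \<epsilon>(1) by (simp add: mult.assoc mult.left_commute)
  finally have 2: "k' (x - q - \<epsilon> *\<^sub>R v) \<le> \<epsilon> * (a / 4)" .
  have 3: "k' (x - q - \<epsilon> *\<^sub>R v) = k' (x - q) + \<epsilon> * a"
    using linear_diff[OF bounded_linear.linear[OF strict_deriv_linear[OF k]], of "x - q" "\<epsilon> *\<^sub>R v"]
      linear_scale[OF bounded_linear.linear[OF strict_deriv_linear[OF k]], of \<epsilon> v] by (simp add: a_def)
  have "k x \<le> \<epsilon> * (a / 4) + \<epsilon> * (a / 4) - \<epsilon> * a" using 1 2 3 by linarith
  also have "\<dots> < 0" using \<epsilon>(1) a by (simp add: field_simps)
  finally show False using nonneg[of x] \<epsilon>(3) xr(2) by simp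
qed

lemma strict_deriv_uminus:
  assumes "strict_deriv f f' q"
  shows "strict_deriv (\<lambda>x. - f x) (\<lambda>v. - f' v) q"
  unfolding strict_deriv_def
proof (intro conjI allI impI)
  show "bounded_linear (\<lambda>v. - f' v)" using strict_deriv_linear[OF assms] by (rule bounded_linear_minus)
  fix \<eta> :: real assume "\<eta> > 0"
  then obtain r where r: "r > 0" "\<And>x y. x \<in> ball q r \<Longrightarrow> y \<in> ball q r \<Longrightarrow>
      norm (f x - f y - f' (x - y)) \<le> \<eta> * norm (x - y)"
    using strict_derivD[OF assms] by metis
  have eq: "- f x - - f y - - f' (x - y) = - (f x - f y - f' (x - y))" for x y by simp
  show "\<exists>r>0. \<forall>x\<in>ball q r. \<forall>y\<in>ball q r.
      norm (- f x - - f y - - f' (x - y)) \<le> \<eta> * norm (x - y)"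
    unfolding eq norm_minus_cancel using r by blast
qed

lemma contingent_deriv_zero:
  fixes h :: "'a::real_normed_vector \<Rightarrow> real"
  assumes "contingent M q v" "strict_deriv h h' q" "open W" "q \<in> W"
    and zero: "\<And>x. x \<in> M \<inter> W \<Longrightarrow> h x = 0" and "h q = 0"
  shows "h' v = 0"
  using contingent_deriv_nonneg[OF assms(1,2,3,4)] assms(6) zero
    contingent_deriv_nonneg[OF assms(1) strict_deriv_uminus[OF assms(2)] assms(3,4)]
  by fastforce

lemma contingent_tangent_space:
  assumes "contingent M q v" "q \<in> M"
  shows "v \<in> tangent_space M q"
  unfolding tangent_space_def
proof (intro CollectI allI impI)
  fix W and h :: "C2 \<Rightarrow> real"
  assume *: "open W \<and> q \<in> W \<and> smooth_on W h \<and> (\<forall>q\<in>M \<inter> W. h q = 0)"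
  then show "D h q v = 0"
    using contingent_deriv_zero[OF assms(1) smooth_on_strict_deriv[of W h q], of W] assms(2) by auto
qed

lemma contingent_mono: "contingent M q v \<Longrightarrow> M \<subseteq> N \<Longrightarrow> contingent N q v"
  unfolding contingent_def by (meson subsetD)

lemma contingent_curve:
  fixes c :: "real \<Rightarrow> 'a::real_normed_vector"
  assumes c: "(c has_vector_derivative v) (at 0)" and "\<delta>0 > 0" "\<And>t. 0 < t \<Longrightarrow> t < \<delta>0 \<Longrightarrow> c t \<in> M"
  shows "contingent M (c 0) v"
  unfolding contingent_def
proof (intro allI impI)
  fix \<eta> \<delta> :: real assume pos: "\<eta> > 0" "\<delta> > 0"
  obtain d where d: "d > 0" "\<And>t. norm (t - 0) < d \<Longrightarrow> norm (c t - c 0 - (t - 0) *\<^sub>R v) \<le> \<eta> * norm (t - 0)"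
    using c pos unfolding has_vector_derivative_def has_derivative_at_alt by meson
  define \<epsilon> where "\<epsilon> = min (min d \<delta>) \<delta>0 / 2"
  have \<epsilon>: "0 < \<epsilon>" "\<epsilon> < d" "\<epsilon> < \<delta>" "\<epsilon> < \<delta>0" using d(1) pos assms(2) by (auto simp: \<epsilon>_def)
  show "\<exists>\<epsilon>. 0 < \<epsilon> \<and> \<epsilon> < \<delta> \<and> (\<exists>x\<in>M. norm (x - c 0 - \<epsilon> *\<^sub>R v) \<le> \<eta> * \<epsilon>)"
    using \<epsilon> assms(3)[of \<epsilon>] d(2)[of \<epsilon>] by (intro exI[of _ \<epsilon>]) auto
qed

text \<open>
  A substitute for the implicit function theorem.  Take \<open>w0\<close> tangent to the sphere with \<open>h' w0 = 1\<close>.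
  Projected radially to the sphere, the points \<open>q + \<epsilon> (v + \<sigma> w0)\<close> have \<open>h\<close>-value \<open>\<epsilon> \<sigma> + o(\<epsilon>)\<close>, so by
  the intermediate value theorem \<open>h\<close> vanishes for some small \<open>\<sigma>\<close>.
\<close>

lemma level_set_approx:
  fixes h :: "C2 \<Rightarrow> real"
  assumes q: "q \<in> S3" and h: "strict_deriv h h' q" and W: "open W" "q \<in> W" "continuous_on W h"
    and h0: "h q = 0" and v: "v \<in> tangent_S3 q" "h' v = 0" and w: "w \<in> tangent_S3 q" "h' w \<noteq> 0"
    and \<eta>: "\<eta> > 0"
  shows "\<exists>\<epsilon>0>0. \<forall>\<epsilon>. 0 < \<epsilon> \<and> \<epsilon> < \<epsilon>0 \<longrightarrow> (\<exists>x\<in>S3 \<inter> W. h x = 0 \<and> norm (x - q - \<epsilon> *\<^sub>R v) \<le> \<eta> * \<epsilon>)"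
proof -
  have nq: "norm q = 1" using q by (simp add: S3_iff)
  have sq: "sgn q = q" using nq by (simp add: sgn_div_norm)
  have lin: "linear h'" using strict_deriv_linear[OF h] by (rule bounded_linear.linear)
  define w0 where "w0 = w /\<^sub>R h' w"
  have w0: "q \<bullet> w0 = 0" "h' w0 = 1"
    using w linear_scale[OF lin] by (auto simp: w0_def tangent_S3_def)
  have qv: "q \<bullet> v = 0" using v by (simp add: tangent_S3_def)
  define \<sigma>1 where "\<sigma>1 = \<eta> / (2 * (norm w0 + 1))"
  have wpos: "norm w0 + 1 > 0" by (smt (verit) norm_ge_zero)
  have \<sigma>1: "\<sigma>1 > 0" "\<sigma>1 * norm w0 \<le> \<eta> / 2"
    using \<eta> wpos by (auto simp: \<sigma>1_def field_simps)
  define M where "M = norm v + \<sigma>1 * norm w0 + 1"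
  have M: "M > 0" using \<sigma>1 by (smt (verit) M_def norm_ge_zero mult_nonneg_nonneg)
  define ht where "ht = (\<lambda>x. h (sgn x))"
  have ht: "strict_deriv ht (\<lambda>u. h' (u - (q \<bullet> u) *\<^sub>R q)) q"
    unfolding ht_def using strict_deriv_compose[OF strict_deriv_sgn[OF nq]] h sq by simp
  have pos: "\<sigma>1 / (2 * M) > 0" "\<eta> / (2 * M) > 0" using \<sigma>1 \<eta> M by auto
  obtain r1 where r1: "r1 > 0" "\<And>x y. x \<in> ball q r1 \<Longrightarrow> y \<in> ball q r1 \<Longrightarrow>
      norm (ht x - ht y - h' ((x - y) - (q \<bullet> (x - y)) *\<^sub>R q)) \<le> (\<sigma>1 / (2 * M)) * norm (x - y)"
    using strict_derivD[OF ht pos(1)] by metis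
  obtain r2 where r2: "r2 > 0" "\<And>x y. x \<in> ball q r2 \<Longrightarrow> y \<in> ball q r2 \<Longrightarrow>
      norm (sgn x - sgn y - ((x - y) - (q \<bullet> (x - y)) *\<^sub>R q)) \<le> (\<eta> / (2 * M)) * norm (x - y)"
    using strict_derivD[OF strict_deriv_sgn[OF nq] pos(2)] by metis
  obtain r3 where r3: "0 < r3" "r3 < 1" "\<And>x. x \<in> ball q r3 \<Longrightarrow> x \<noteq> 0 \<and> sgn x \<in> W"
    using continuous_sgn[OF nq W(1,2)] by metis
  define r where "r = min r1 (min r2 r3)"
  define \<epsilon>0 where "\<epsilon>0 = r / M"
  show ?thesis
  proof (intro exI[of _ \<epsilon>0] conjI allI impI)
    show "\<epsilon>0 > 0" using r1 r2 r3 M by (simp add: \<epsilon>0_def r_def)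
    fix \<epsilon> assume "0 < \<epsilon> \<and> \<epsilon> < \<epsilon>0"
    then have \<epsilon>: "0 < \<epsilon>" "\<epsilon> * M < r" using M by (auto simp: \<epsilon>0_def field_simps)
    define y where "y = (\<lambda>\<sigma>. q + \<epsilon> *\<^sub>R (v + \<sigma> *\<^sub>R w0))"
    have qy: "q \<bullet> (y \<sigma> - q) = 0" for \<sigma> using qv w0 by (simp add: y_def inner_add_right)
    have ny: "norm (y \<sigma> - q) \<le> \<epsilon> * M" if "\<bar>\<sigma>\<bar> \<le> \<sigma>1" for \<sigma>
    proof -
      have "norm (v + \<sigma> *\<^sub>R w0) \<le> norm v + \<bar>\<sigma>\<bar> * norm w0" by (metis norm_scaleR norm_triangle_ineq)
      also have "\<dots> \<le> M" using that mult_right_mono[OF that norm_ge_zero[of w0]] by (simp add: M_def)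
      finally show ?thesis using \<epsilon>(1) by (simp add: y_def)
    qed
    have yb: "y \<sigma> \<in> ball q r" if "\<bar>\<sigma>\<bar> \<le> \<sigma>1" for \<sigma>
      using ny[OF that] \<epsilon>(2) by (simp add: dist_norm norm_minus_commute)
    have q_in: "q \<in> ball q r1" "q \<in> ball q r2" using r1 r2 by auto
    have hq: "ht q = 0" by (simp add: ht_def sq h0)
    have h'y: "h' (y \<sigma> - q) = \<epsilon> * \<sigma>" for \<sigma>
      using v(2) w0(2) by (simp add: y_def linear_scale[OF lin] linear_add[OF lin])
    have est: "\<bar>ht (y \<sigma>) - \<epsilon> * \<sigma>\<bar> \<le> \<epsilon> * (\<sigma>1 / 2)" if "\<bar>\<sigma>\<bar> \<le> \<sigma>1" for \<sigma>
    proof -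
      have "\<bar>ht (y \<sigma>) - \<epsilon> * \<sigma>\<bar> \<le> (\<sigma>1 / (2 * M)) * norm (y \<sigma> - q)"
        using r1(2)[of "y \<sigma>" q] yb[OF that] q_in qy[of \<sigma>] hq h'y[of \<sigma>] by (auto simp: r_def)
      also have "\<dots> \<le> (\<sigma>1 / (2 * M)) * (\<epsilon> * M)" using ny[OF that] pos by (intro mult_left_mono) auto
      also have "\<dots> = \<epsilon> * (\<sigma>1 / 2)" using M by simp
      finally show ?thesis .
    qed
    have cont: "continuous_on {-\<sigma>1..\<sigma>1} (\<lambda>\<sigma>. ht (y \<sigma>))"
      unfolding ht_def
    proof (rule continuous_on_compose2[OF W(3)])
      show "continuous_on {-\<sigma>1..\<sigma>1} (\<lambda>\<sigma>. sgn (y \<sigma>))"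
      proof (rule continuous_on_sgn)
        show "continuous_on {-\<sigma>1..\<sigma>1} y" unfolding y_def by (intro continuous_intros)
        show "\<forall>x\<in>{-\<sigma>1..\<sigma>1}. y x \<noteq> 0"
        proof
          fix x assume "x \<in> {-\<sigma>1..\<sigma>1}"
          then have "y x \<in> ball q r" by (intro yb) auto
          then show "y x \<noteq> 0" using r3(3)[of "y x"] by (auto simp: r_def)
        qed
      qed
      show "(\<lambda>\<sigma>. sgn (y \<sigma>)) ` {-\<sigma>1..\<sigma>1} \<subseteq> W"
      proof (rule image_subsetI)
        fix x assume "x \<in> {-\<sigma>1..\<sigma>1}"
        then have "y x \<in> ball q r" by (intro yb) auto
        then show "sgn (y x) \<in> W" using r3(3)[of "y x"] by (auto simp: r_def)
      qed
    qed
    have ends: "ht (y (-\<sigma>1)) \<le> 0" "0 \<le> ht (y \<sigma>1)"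
    proof -
      have P: "\<epsilon> * \<sigma>1 > 0" using \<epsilon> \<sigma>1 by simp
      have neg: "A \<le> 0" if "P > 0" "\<bar>A + P\<bar> \<le> P / 2" for A P :: real
        using that by linarith
      have pos: "0 \<le> A" if "P > 0" "\<bar>A - P\<bar> \<le> P / 2" for A P :: real
        using that by linarith
      show "ht (y (-\<sigma>1)) \<le> 0"
        using est[of "-\<sigma>1"] \<sigma>1(1) by (intro neg[OF P]) simp
      show "0 \<le> ht (y \<sigma>1)"
        using est[of \<sigma>1] \<sigma>1(1) by (intro pos[OF P]) simp
    qed
    obtain \<sigma> where \<sigma>: "-\<sigma>1 \<le> \<sigma>" "\<sigma> \<le> \<sigma>1" "ht (y \<sigma>) = 0"
      using IVT'[OF ends _ cont] \<sigma>1(1) by auto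
    then have \<sigma>': "\<bar>\<sigma>\<bar> \<le> \<sigma>1" by simp
    define x where "x = sgn (y \<sigma>)"
    have yr: "y \<sigma> \<in> ball q r3" "y \<sigma> \<in> ball q r2" using yb[OF \<sigma>'] by (auto simp: r_def)
    have "x \<in> S3 \<inter> W" using r3(3)[OF yr(1)] by (simp add: x_def S3_iff norm_sgn)
    moreover have "h x = 0" using \<sigma>(3) by (simp add: ht_def x_def)
    moreover have "norm (x - q - \<epsilon> *\<^sub>R v) \<le> \<eta> * \<epsilon>"
    proof -
      have "x - q - \<epsilon> *\<^sub>R v = (sgn (y \<sigma>) - sgn q - ((y \<sigma> - q) - (q \<bullet> (y \<sigma> - q)) *\<^sub>R q)) + (\<epsilon> * \<sigma>) *\<^sub>R w0"
        using qy[of \<sigma>] sq by (simp add: x_def y_def algebra_simps)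
      also have "norm \<dots> \<le> norm (sgn (y \<sigma>) - sgn q - ((y \<sigma> - q) - (q \<bullet> (y \<sigma> - q)) *\<^sub>R q)) + norm ((\<epsilon> * \<sigma>) *\<^sub>R w0)"
        by (rule norm_triangle_ineq)
      also have "\<dots> \<le> (\<eta> / (2 * M)) * (\<epsilon> * M) + \<epsilon> * (\<eta> / 2)"
      proof (rule add_mono)
        show "norm (sgn (y \<sigma>) - sgn q - ((y \<sigma> - q) - (q \<bullet> (y \<sigma> - q)) *\<^sub>R q)) \<le> (\<eta> / (2 * M)) * (\<epsilon> * M)"
          using order_trans[OF r2(2)[OF yr(2) q_in(2)] mult_left_mono[OF ny[OF \<sigma>']]] pos by simp
        have "\<bar>\<sigma>\<bar> * norm w0 \<le> \<eta> / 2"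
          using mult_right_mono[OF \<sigma>' norm_ge_zero[of w0]] \<sigma>1(2) by linarith
        then show "norm ((\<epsilon> * \<sigma>) *\<^sub>R w0) \<le> \<epsilon> * (\<eta> / 2)"
          using \<epsilon>(1) by (simp add: abs_mult mult.assoc)
      qed
      also have "\<dots> = \<eta> * \<epsilon>" using M by simp
      finally show ?thesis .
    qed
    ultimately show "\<exists>x\<in>S3 \<inter> W. h x = 0 \<and> norm (x - q - \<epsilon> *\<^sub>R v) \<le> \<eta> * \<epsilon>" by blast
  qed
qed

section \<open>Seifert surfaces and their defining functions\<close>

text \<open>
  One of the test functions in the definition of \<open>tangent_space\<close> is the squared norm minus one.
\<close>

lemma tangent_space_subset_tangent_S3:
  assumes "M \<subseteq> S3" "p \<in> M"
  shows "tangent_space M p \<subseteq> tangent_S3 p"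
proof
  fix v assume v: "v \<in> tangent_space M p"
  define h where "h = (\<lambda>x::C2. x \<bullet> x + (- 1))"
  have sm: "smooth_on UNIV h"
    unfolding smooth_on_def h_def
    by (intro allI Ck_on_add Ck_on_bilinear[OF bounded_bilinear_inner] Ck_on_linear Ck_on_const
        bounded_linear_ident open_UNIV)
  have "\<forall>q\<in>M \<inter> UNIV. h q = 0"
    using assms(1) by (auto simp: h_def S3_iff dot_square_norm)
  then have "D h p v = 0" using v sm unfolding tangent_space_def by blast
  moreover have "(h has_derivative (\<lambda>v. p \<bullet> v + v \<bullet> p)) (at p)"
    unfolding h_def by (auto intro!: derivative_eq_intros)
  then have "D h p = (\<lambda>v. p \<bullet> v + v \<bullet> p)" by (simp add: frechet_derivative_at[symmetric])
  ultimately show "v \<in> tangent_S3 p" by (simp add: tangent_S3_def inner_commute)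
qed

lemma tangent_spaceD:
  fixes h :: "C2 \<Rightarrow> real"
  assumes "v \<in> tangent_space M p" "open W" "p \<in> W" "smooth_on W h" "\<And>q. q \<in> M \<inter> W \<Longrightarrow> h q = 0"
  shows "D h p v = 0"
  using assms unfolding tangent_space_def by blast

lemma tangent_space_diff:
  assumes "v \<in> tangent_space M p" "w \<in> tangent_space M p"
  shows "v - c *\<^sub>R w \<in> tangent_space M p"
  unfolding tangent_space_def
proof (intro CollectI allI impI)
  fix W and h :: "C2 \<Rightarrow> real"
  assume *: "open W \<and> p \<in> W \<and> smooth_on W h \<and> (\<forall>q\<in>M \<inter> W. h q = 0)"
  then have "D h p v = 0" "D h p w = 0" using assms unfolding tangent_space_def by blast+
  moreover have "linear (D h p)"
    using smooth_onD(1)[of W h p] * by (intro bounded_linear.linear has_derivative_bounded_linear) auto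
  ultimately show "D h p (v - c *\<^sub>R w) = 0" by (simp add: linear_diff linear_scale)
qed

lemma tangent_space_linear:
  assumes "open W" "q \<in> W" "smooth_on W (h :: C2 \<Rightarrow> real)"
  shows "linear (D h q)" "strict_deriv h (D h q) q"
  using smooth_on_strict_deriv[OF assms(3,1,2)] strict_deriv_linear bounded_linear.linear by blast+

lemma contingentD:
  assumes "contingent M q v" "\<eta> > 0" "\<delta> > 0"
  obtains \<epsilon> x where "0 < \<epsilon>" "\<epsilon> < \<delta>" "x \<in> M" "norm (x - q - \<epsilon> *\<^sub>R v) \<le> \<eta> * \<epsilon>"
  using assms unfolding contingent_def by blast

lemma contingent_level_set:
  fixes h :: "C2 \<Rightarrow> real"
  assumes q: "q \<in> S3" and W: "open W" "q \<in> W" "smooth_on W h" and h0: "h q = 0"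
    and v: "v \<in> tangent_S3 q" "D h q v = 0" and w: "w \<in> tangent_S3 q" "D h q w \<noteq> 0"
  shows "contingent {x \<in> S3 \<inter> W. h x = 0} q v"
  unfolding contingent_def
proof (intro allI impI)
  fix \<eta> \<delta> :: real assume pos: "\<eta> > 0" "\<delta> > 0"
  obtain \<epsilon>0 where \<epsilon>0: "\<epsilon>0 > 0"
    "\<forall>\<epsilon>. 0 < \<epsilon> \<and> \<epsilon> < \<epsilon>0 \<longrightarrow> (\<exists>x\<in>S3 \<inter> W. h x = 0 \<and> norm (x - q - \<epsilon> *\<^sub>R v) \<le> \<eta> * \<epsilon>)"
    using level_set_approx[OF q tangent_space_linear(2)[OF W] W(1,2) smooth_on_continuous[OF W(3)] h0 v w pos(1)]
    by blast
  define \<epsilon> where "\<epsilon> = min \<epsilon>0 \<delta> / 2"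
  have \<epsilon>: "0 < \<epsilon>" "\<epsilon> < \<epsilon>0" "\<epsilon> < \<delta>" using pos \<epsilon>0(1) by (auto simp: \<epsilon>_def)
  then obtain x where "x \<in> S3 \<inter> W" "h x = 0" "norm (x - q - \<epsilon> *\<^sub>R v) \<le> \<eta> * \<epsilon>"
    using \<epsilon>0(2) by blast
  then show "\<exists>\<epsilon>. 0 < \<epsilon> \<and> \<epsilon> < \<delta> \<and> (\<exists>x\<in>{x \<in> S3 \<inter> W. h x = 0}. norm (x - q - \<epsilon> *\<^sub>R v) \<le> \<eta> * \<epsilon>)"
    using \<epsilon> by blast
qed

text \<open>
  If \<open>v\<close> were not approached from \<open>k \<ge> 0\<close>, then it would be approached from \<open>k < 0\<close> inside the level
  set of \<open>h\<close>, which forces \<open>D k q v \<le> 0\<close>.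
\<close>

lemma contingent_half_level_set:
  fixes h k :: "C2 \<Rightarrow> real"
  assumes q: "q \<in> S3" and W: "open W" "q \<in> W" "smooth_on W h" "smooth_on W k"
    and h0: "h q = 0" "k q = 0"
    and v: "v \<in> tangent_S3 q" "D h q v = 0" "D k q v > 0" and w: "w \<in> tangent_S3 q" "D h q w \<noteq> 0"
  shows "contingent {x \<in> S3 \<inter> W. h x = 0 \<and> k x \<ge> 0} q v" (is "contingent ?M q v")
proof (rule ccontr)
  assume "\<not> contingent ?M q v"
  then obtain \<eta>0 \<delta>0 where neg: "\<eta>0 > 0" "\<delta>0 > 0"
    "\<And>\<epsilon> x. 0 < \<epsilon> \<Longrightarrow> \<epsilon> < \<delta>0 \<Longrightarrow> x \<in> ?M \<Longrightarrow> \<not> norm (x - q - \<epsilon> *\<^sub>R v) \<le> \<eta>0 * \<epsilon>"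
    unfolding contingent_def by blast
  have "contingent {x \<in> S3 \<inter> W. h x = 0 \<and> k x < 0} q v"
    unfolding contingent_def
  proof (intro allI impI)
    fix \<eta> \<delta> :: real assume pos: "\<eta> > 0" "\<delta> > 0"
    obtain \<epsilon> x where \<epsilon>: "0 < \<epsilon>" "\<epsilon> < min \<delta> \<delta>0" "x \<in> {x \<in> S3 \<inter> W. h x = 0}"
      "norm (x - q - \<epsilon> *\<^sub>R v) \<le> min \<eta> \<eta>0 * \<epsilon>"
      using contingentD[OF contingent_level_set[OF q W(1-3) h0(1) v(1,2) w], of "min \<eta> \<eta>0" "min \<delta> \<delta>0"]
        pos neg(1,2) by auto
    have "norm (x - q - \<epsilon> *\<^sub>R v) \<le> \<eta> * \<epsilon>" "norm (x - q - \<epsilon> *\<^sub>R v) \<le> \<eta>0 * \<epsilon>"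
      using order_trans[OF \<epsilon>(4) mult_right_mono[of _ _ \<epsilon>]] \<epsilon>(1) by auto
    moreover from this have "x \<notin> ?M" using neg(3)[of \<epsilon> x] \<epsilon>(1,2) by auto
    ultimately show "\<exists>\<epsilon>. 0 < \<epsilon> \<and> \<epsilon> < \<delta> \<and>
        (\<exists>x\<in>{x \<in> S3 \<inter> W. h x = 0 \<and> k x < 0}. norm (x - q - \<epsilon> *\<^sub>R v) \<le> \<eta> * \<epsilon>)"
      using \<epsilon> by (intro exI[of _ \<epsilon>] conjI bexI[of _ x]) auto
  qed
  from contingent_deriv_nonneg[OF this strict_deriv_uminus[OF tangent_space_linear(2)[OF W(1,2,4)]] W(1,2)]
  have "- D k q v \<ge> 0" using h0(2) by (simp add: less_imp_le)
  with v(3) show False by simp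
qed

text \<open>
  The condition that \<open>seifert_surface\<close> imposes at a boundary point.
\<close>

definition boundary_chart ::
  "C2 set \<Rightarrow> C2 set \<Rightarrow> C2 \<Rightarrow> C2 set \<Rightarrow> (C2 \<Rightarrow> real) \<Rightarrow> (C2 \<Rightarrow> real) \<Rightarrow> bool" where
  "boundary_chart K \<Sigma> p W h k \<longleftrightarrow> open W \<and> p \<in> W \<and> smooth_on W h \<and> smooth_on W k \<and>
     \<Sigma> \<inter> W = {q \<in> S3 \<inter> W. h q = 0 \<and> k q \<ge> 0} \<and>
     K \<inter> W = {q \<in> S3 \<inter> W. h q = 0 \<and> k q = 0} \<and>
     (\<forall>x y. \<exists>v\<in>tangent_S3 p. D h p v = x \<and> D k p v = y)"

lemma boundary_chart_exists:
  assumes "seifert_surface K \<Sigma>" "p \<in> K"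
  obtains W h k where "boundary_chart K \<Sigma> p W h k"
  using assms unfolding seifert_surface_def boundary_chart_def by blast

lemma boundary_chart_contingent:
  assumes c: "boundary_chart K \<Sigma> p W h k" and p: "p \<in> K"
    and v: "v \<in> tangent_S3 p" "D h p v = 0" "D k p v > 0"
  shows "contingent \<Sigma> p v"
proof -
  have p': "p \<in> S3" "h p = 0" "k p = 0" using c p unfolding boundary_chart_def by blast+
  obtain w where w: "w \<in> tangent_S3 p" "D h p w = 1" using c unfolding boundary_chart_def by blast
  have "contingent {x \<in> S3 \<inter> W. h x = 0 \<and> k x \<ge> 0} p v"
    using c w v p' unfolding boundary_chart_def by (intro contingent_half_level_set[where w = w]) auto
  then show ?thesis
    using c unfolding boundary_chart_def by (elim contingent_mono) blast
qed

text \<open>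
  Adding a large multiple of a tangent vector \<open>u\<close> with \<open>D k p u = 1\<close> makes \<open>v\<close> point inwards; inward
  vectors are limits of secants of the surface, and \<open>tangent_space\<close> is closed under differences.
\<close>

lemma boundary_chart_tangent:
  assumes c: "boundary_chart K \<Sigma> p W h k" and p: "p \<in> K" "p \<in> \<Sigma>"
    and v: "v \<in> tangent_S3 p" "D h p v = 0"
  shows "v \<in> tangent_space \<Sigma> p"
proof -
  have W: "open W" "p \<in> W" "smooth_on W h" "smooth_on W k" using c unfolding boundary_chart_def by auto
  obtain u where u: "u \<in> tangent_S3 p" "D h p u = 0" "D k p u = 1"
    using c unfolding boundary_chart_def by blast
  define b where "b = 1 + \<bar>D k p v\<bar>"
  have "v + b *\<^sub>R u \<in> tangent_S3 p" using u(1) v(1) by (simp add: tangent_S3_def inner_add_right)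
  moreover have "D h p (v + b *\<^sub>R u) = 0" "D k p (v + b *\<^sub>R u) > 0"
    using u v by (auto simp: b_def linear_add[OF tangent_space_linear(1)[OF W(1,2,3)]]
        linear_scale[OF tangent_space_linear(1)[OF W(1,2,3)]]
        linear_add[OF tangent_space_linear(1)[OF W(1,2,4)]]
        linear_scale[OF tangent_space_linear(1)[OF W(1,2,4)]])
  ultimately have "v + b *\<^sub>R u \<in> tangent_space \<Sigma> p"
    using boundary_chart_contingent[OF c p(1)] contingent_tangent_space[OF _ p(2)] by blast
  moreover have "u \<in> tangent_space \<Sigma> p"
    using boundary_chart_contingent[OF c p(1) u(1,2)] contingent_tangent_space[OF _ p(2)] u(3) by simp
  ultimately have "(v + b *\<^sub>R u) - b *\<^sub>R u \<in> tangent_space \<Sigma> p" by (rule tangent_space_diff)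
  then show ?thesis by simp
qed

text \<open>
  The properties shared by interior and boundary charts.  The important one is that the kernel of
  \<open>D h q\<close> in the tangent space of the sphere consists of tangent vectors of the surface.
\<close>

lemma seifert_chart:
  assumes S: "seifert_surface K \<Sigma>" and q: "q \<in> \<Sigma>"
  obtains W h where "open W" "q \<in> W" "smooth_on W (h :: C2 \<Rightarrow> real)" "\<forall>x\<in>\<Sigma> \<inter> W. h x = 0"
    "\<forall>v\<in>tangent_S3 q. D h q v = 0 \<longrightarrow> v \<in> tangent_space \<Sigma> q"
    "q \<notin> K \<Longrightarrow> \<Sigma> \<inter> W = {x \<in> S3 \<inter> W. h x = 0}"
proof (cases "q \<in> K")
  case True
  obtain W h k where c: "boundary_chart K \<Sigma> q W h k" using boundary_chart_exists[OF S True] .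
  have c': "open W" "q \<in> W" "smooth_on W h" "\<Sigma> \<inter> W = {q \<in> S3 \<inter> W. h q = 0 \<and> k q \<ge> 0}"
    using c unfolding boundary_chart_def by simp_all
  show ?thesis
  proof (rule that[OF c'(1-3)])
    show "\<forall>x\<in>\<Sigma> \<inter> W. h x = 0" unfolding c'(4) by simp
    show "\<forall>v\<in>tangent_S3 q. D h q v = 0 \<longrightarrow> v \<in> tangent_space \<Sigma> q"
      using boundary_chart_tangent[OF c True q] by simp
  qed (use True in simp)
next
  case False
  obtain W and h :: "C2 \<Rightarrow> real" where c: "open W" "q \<in> W" "smooth_on W h"
    "\<Sigma> \<inter> W = {q \<in> S3 \<inter> W. h q = 0}" "\<exists>v\<in>tangent_S3 q. D h q v \<noteq> 0"
  proof -
    have "\<forall>p\<in>\<Sigma> - K. \<exists>W (h :: C2 \<Rightarrow> real). open W \<and> p \<in> W \<and> smooth_on W h \<and>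
        \<Sigma> \<inter> W = {q \<in> S3 \<inter> W. h q = 0} \<and> (\<exists>v\<in>tangent_S3 p. D h p v \<noteq> 0)"
      using S unfolding seifert_surface_def by simp
    then show thesis using that q False by blast
  qed
  have "v \<in> tangent_space \<Sigma> q" if v: "v \<in> tangent_S3 q" "D h q v = 0" for v
  proof -
    have q': "q \<in> S3" "h q = 0" using c(2,4) q by blast+
    have "contingent {x \<in> S3 \<inter> W. h x = 0} q v"
      using c(5) contingent_level_set[OF q'(1) c(1,2,3) q'(2) v] by blast
    then have "contingent \<Sigma> q v" using c(4) contingent_mono by blast
    then show ?thesis using contingent_tangent_space q by blast
  qed
  then show ?thesis using c(4) by (intro that[OF c(1-3)]) auto
qed

text \<open>
  The third property turns orthogonality of \<open>n p\<close> to the surface into transversality: a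
  functional whose kernel is tangent to the surface cannot vanish on \<open>n p\<close>, as otherwise \<open>n p\<close> would be
  orthogonal to itself.
\<close>

lemma seifert_normal:
  assumes "seifert_surface K \<Sigma>"
  obtains n where "continuous_on \<Sigma> n" "\<forall>p\<in>\<Sigma>. n p \<in> tangent_S3 p"
    "\<forall>p\<in>\<Sigma>. \<forall>h. (\<forall>v\<in>tangent_S3 p. h v = 0 \<longrightarrow> v \<in> tangent_space \<Sigma> p) \<longrightarrow> h (n p) \<noteq> (0::real)"
proof -
  obtain n where n: "continuous_on \<Sigma> n"
    "\<forall>p\<in>\<Sigma>. n p \<noteq> 0 \<and> n p \<in> tangent_S3 p \<and> (\<forall>v\<in>tangent_space \<Sigma> p. inner (n p) v = 0)"
    using assms unfolding seifert_surface_def by blast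
  show ?thesis
  proof (rule that[OF n(1)])
    show "\<forall>p\<in>\<Sigma>. \<forall>h. (\<forall>v\<in>tangent_S3 p. h v = 0 \<longrightarrow> v \<in> tangent_space \<Sigma> p) \<longrightarrow> h (n p) \<noteq> (0::real)"
    proof (intro ballI allI impI notI)
      fix p and h :: "C2 \<Rightarrow> real"
      assume p: "p \<in> \<Sigma>" "\<forall>v\<in>tangent_S3 p. h v = 0 \<longrightarrow> v \<in> tangent_space \<Sigma> p" "h (n p) = 0"
      then have "inner (n p) (n p) = 0" using n(2) by blast
      then show False using n(2) p(1) by simp
    qed
  qed (use n(2) in blast)
qed

lemma bump_lipschitz: "\<bar>max 0 (r - norm (x - i)) - max 0 (r - norm (y - i))\<bar> \<le> norm (x - y)"
proof -
  have "\<bar>norm (x - i) - norm (y - i)\<bar> \<le> norm (x - i - (y - i))" by (rule norm_triangle_ineq3)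
  then show ?thesis by (auto simp: max_def)
qed

text \<open>
  A local defining function whose sign is fixed by the normal field: it increases in the direction of
  \<open>n\<close> at all nearby points of the surface.
\<close>

lemma seifert_positive_chart:
  assumes S: "seifert_surface K \<Sigma>" and q: "q \<in> \<Sigma>"
    and n: "continuous_on \<Sigma> n" "\<forall>p\<in>\<Sigma>. n p \<in> tangent_S3 p"
    "\<forall>p\<in>\<Sigma>. \<forall>h. (\<forall>v\<in>tangent_S3 p. h v = 0 \<longrightarrow> v \<in> tangent_space \<Sigma> p) \<longrightarrow> h (n p) \<noteq> (0::real)"
  obtains r W h where "r > 0" "open W" "cball q r \<subseteq> W" "smooth_on W (h :: C2 \<Rightarrow> real)" "\<forall>x\<in>\<Sigma> \<inter> W. h x = 0"
    "\<And>x. x \<in> \<Sigma> \<inter> ball q r \<Longrightarrow> D h x (n x) > 0"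
proof -
  obtain W and h :: "C2 \<Rightarrow> real" where c: "open W" "q \<in> W" "smooth_on W h" "\<forall>x\<in>\<Sigma> \<inter> W. h x = 0"
    "\<forall>v\<in>tangent_S3 q. D h q v = 0 \<longrightarrow> v \<in> tangent_space \<Sigma> q"
    by (rule seifert_chart[OF S q]) (rule that, assumption+)
  have "D h q (n q) \<noteq> 0" using n(3) q c(5) by blast
  define \<sigma> where "\<sigma> = sgn (D h q (n q))"
  define g where "g = (\<lambda>x. \<sigma> * h x)"
  have \<sigma>: "\<sigma> * D h q (n q) > 0" using \<open>D h q (n q) \<noteq> 0\<close> by (auto simp: \<sigma>_def sgn_if mult_neg_neg)
  have g: "smooth_on W g" using c(3) unfolding g_def smooth_on_def
    using Ck_on_linear_compose[OF bounded_linear_mult_right c(1)] by blast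
  have Dg: "D g x v = \<sigma> * D h x v" if "x \<in> W" for x v
  proof -
    have "(g has_derivative (\<lambda>v. \<sigma> * D h x v)) (at x)"
      unfolding g_def by (intro has_derivative_mult_right smooth_onD(1)[OF c(3) that])
    then show ?thesis by (simp add: frechet_derivative_at[symmetric])
  qed
  have lin: "linear (D g x)" if "x \<in> W" for x using tangent_space_linear(1)[OF c(1) that g] .
  have Dgn: "D g x (n x) = (\<Sum>b\<in>Basis. (n x \<bullet> b) * D g x b)" if "x \<in> W" for x
    using linear_sum[OF lin[OF that], of "\<lambda>b. (n x \<bullet> b) *\<^sub>R b" Basis] linear_scale[OF lin[OF that]]
    by (simp add: euclidean_representation)
  have "continuous_on (\<Sigma> \<inter> W) (\<lambda>x. \<Sum>b\<in>Basis. (n x \<bullet> b) * D g x b)"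
    by (intro continuous_intros continuous_on_subset[OF n(1)] continuous_on_subset[OF smooth_onD(2)[OF g c(2)]]) auto
  then have "continuous_on (\<Sigma> \<inter> W) (\<lambda>x. D g x (n x))"
    by (rule continuous_on_eq) (simp add: Dgn)
  then have "\<forall>e>0. \<exists>d>0. \<forall>x\<in>\<Sigma> \<inter> W. dist x q < d \<longrightarrow> dist (D g x (n x)) (D g q (n q)) < e"
    unfolding continuous_on_iff using q c(2) by blast
  moreover have "D g q (n q) > 0" using \<sigma> Dg[OF c(2)] by simp
  ultimately obtain d where d: "d > 0"
    "\<And>x. x \<in> \<Sigma> \<inter> W \<Longrightarrow> dist x q < d \<Longrightarrow> dist (D g x (n x)) (D g q (n q)) < D g q (n q)"
    by blast
  obtain r0 where r0: "r0 > 0" "cball q r0 \<subseteq> W" using c(1,2) open_contains_cball by blast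
  show ?thesis
  proof (rule that[of "min r0 d" W g])
    show "cball q (min r0 d) \<subseteq> W" using r0 by auto
    show "\<forall>x\<in>\<Sigma> \<inter> W. g x = 0" using c(4) by (simp add: g_def)
    show "D g x (n x) > 0" if x: "x \<in> \<Sigma> \<inter> ball q (min r0 d)" for x
    proof -
      have "x \<in> cball q r0" using x by auto
      then have "x \<in> \<Sigma> \<inter> W" "dist x q < d" using x r0(2) by (auto simp: dist_commute)
      then show ?thesis using d(2)[of x] by (auto simp: dist_real_def)
    qed
  qed (use r0 d g c in auto)
qed

text \<open>
  This is where orientability enters.  Local defining functions that increase along the normal field
  can be added up with nonnegative bump functions as weights: on the surface all of them vanish, and
  their derivatives along \<open>n\<close> have the same sign, so that the sum is again regular there.  Compactness
  makes the sum finite.  Away from the surface \<open>s\<close> may have further zeros.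
\<close>

lemma seifert_defining_function:
  assumes S: "seifert_surface K \<Sigma>"
  obtains s :: "C2 \<Rightarrow> real" where "continuous_on UNIV s" "\<And>x. x \<in> \<Sigma> \<Longrightarrow> s x = 0"
    "\<And>x. x \<in> \<Sigma> \<Longrightarrow> \<exists>s'. strict_deriv s s' x \<and> (\<exists>v\<in>tangent_S3 x. s' v \<noteq> 0) \<and> (\<forall>v\<in>tangent_space \<Sigma> x. s' v = 0)"
proof -
  obtain n where n: "continuous_on \<Sigma> n" "\<forall>p\<in>\<Sigma>. n p \<in> tangent_S3 p"
    "\<forall>p\<in>\<Sigma>. \<forall>h. (\<forall>v\<in>tangent_S3 p. h v = 0 \<longrightarrow> v \<in> tangent_space \<Sigma> p) \<longrightarrow> h (n p) \<noteq> (0::real)"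
    by (rule seifert_normal[OF S]) (rule that, assumption+)
  let ?P = "\<lambda>q r W h. r > 0 \<and> open W \<and> cball q r \<subseteq> W \<and> smooth_on W (h :: C2 \<Rightarrow> real) \<and>
    (\<forall>x\<in>\<Sigma> \<inter> W. h x = 0) \<and> (\<forall>x\<in>\<Sigma> \<inter> ball q r. D h x (n x) > 0)"
  have ex: "\<forall>q\<in>\<Sigma>. \<exists>r W h. ?P q r W h"
  proof
    fix q assume q: "q \<in> \<Sigma>"
    show "\<exists>r W h. ?P q r W h"
      by (rule seifert_positive_chart[OF S q n]) blast+
  qed
  obtain r where r: "\<forall>q\<in>\<Sigma>. \<exists>W h. ?P q (r q) W h" using bchoice[OF ex] ..
  obtain W where W: "\<forall>q\<in>\<Sigma>. \<exists>h. ?P q (r q) (W q) h" using bchoice[OF r] ..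
  obtain h where h: "\<forall>q\<in>\<Sigma>. ?P q (r q) (W q) (h q)" using bchoice[OF W] ..
  have c: "\<And>q. q \<in> \<Sigma> \<Longrightarrow> r q > 0" "\<And>q. q \<in> \<Sigma> \<Longrightarrow> open (W q)"
    "\<And>q. q \<in> \<Sigma> \<Longrightarrow> cball q (r q) \<subseteq> W q" "\<And>q. q \<in> \<Sigma> \<Longrightarrow> smooth_on (W q) (h q)"
    "\<And>q x. q \<in> \<Sigma> \<Longrightarrow> x \<in> \<Sigma> \<inter> W q \<Longrightarrow> h q x = 0"
    "\<And>q x. q \<in> \<Sigma> \<Longrightarrow> x \<in> \<Sigma> \<inter> ball q (r q) \<Longrightarrow> D (h q) x (n x) > 0"
    using h by blast+
  have comp: "compact \<Sigma>" using S unfolding seifert_surface_def by blast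
  have cover: "\<Sigma> \<subseteq> (\<Union>q\<in>\<Sigma>. ball q (r q))"
  proof
    fix x assume "x \<in> \<Sigma>"
    then have "x \<in> ball x (r x)" using c(1) by simp
    then show "x \<in> (\<Union>q\<in>\<Sigma>. ball q (r q))" using \<open>x \<in> \<Sigma>\<close> by blast
  qed
  obtain I where I: "I \<subseteq> \<Sigma>" "finite I" "\<Sigma> \<subseteq> (\<Union>q\<in>I. ball q (r q))"
    by (rule compactE_image[OF comp _ cover]) (simp, rule that)
  define b where "b = (\<lambda>i x :: C2. max 0 (r i - norm (x - i)))"
  define s where "s = (\<lambda>x. \<Sum>i\<in>I. b i x * h i x)"
  have b0: "b i x = 0" if "x \<notin> ball i (r i)" for i x
    using that by (simp add: b_def dist_norm norm_minus_commute)
  have bpos: "b i x > 0" if "x \<in> ball i (r i)" for i x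
    using that by (simp add: b_def dist_norm norm_minus_commute)
  have bnn: "b i x \<ge> 0" for i x by (simp add: b_def)
  have contb: "continuous_on A (b i)" for A i unfolding b_def by (intro continuous_intros)
  have cont: "continuous_on UNIV (\<lambda>x. b i x * h i x)" if "i \<in> I" for i
  proof -
    have i: "i \<in> \<Sigma>" using I that by blast
    have "continuous_on (W i \<union> - cball i (r i)) (\<lambda>x. b i x * h i x)"
    proof (rule continuous_on_open_Un)
      show "continuous_on (W i) (\<lambda>x. b i x * h i x)"
        by (intro continuous_intros contb smooth_on_continuous c(4) i)
      have "continuous_on (- cball i (r i)) (\<lambda>x. 0::real)" by simp
      then show "continuous_on (- cball i (r i)) (\<lambda>x. b i x * h i x)"
        by (rule continuous_on_eq) (auto simp: b0)
    qed (use c(2)[OF i] in auto)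
    moreover have "W i \<union> - cball i (r i) = UNIV" using c(3)[OF i] by blast
    ultimately show ?thesis by simp
  qed
  \<comment> \<open>Outside \<open>W i\<close> the function \<open>h i\<close> is arbitrary, but there the bump vanishes nearby.\<close>
  have der: "strict_deriv (\<lambda>x. b i x * h i x) (\<lambda>v. b i x * D (h i) x v) x"
    if i: "i \<in> I" and x: "x \<in> \<Sigma>" for i x
  proof (cases "x \<in> W i")
    case True
    have i': "i \<in> \<Sigma>" using I i by blast
    have "\<bar>b i y - b i z\<bar> \<le> norm (y - z)" for y z unfolding b_def by (rule bump_lipschitz)
    moreover have "h i x = 0" using c(5)[OF i'] x True by blast
    ultimately show ?thesis
      using tangent_space_linear(2)[OF c(2)[OF i'] True c(4)[OF i']] by (intro strict_deriv_lipschitz_mult)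
  next
    case False
    then have "x \<in> - cball i (r i)" using c(3) I i by blast
    then obtain e where e: "e > 0" "ball x e \<subseteq> - cball i (r i)" using openE open_Compl closed_cball by metis
    have "b i y = 0" if "y \<in> ball x e" for y using e that b0[of y i] ball_subset_cball by blast
    then show ?thesis using e(1) strict_deriv_zero_near[of e x "\<lambda>x. b i x * h i x"] by simp
  qed
  show ?thesis
  proof (rule that[of s])
    show "continuous_on UNIV s" unfolding s_def by (intro continuous_on_sum cont)
    show "s x = 0" if "x \<in> \<Sigma>" for x
      unfolding s_def
    proof (rule sum.neutral, rule ballI)
      fix i assume i: "i \<in> I"
      show "b i x * h i x = 0"
      proof (cases "x \<in> ball i (r i)")
        case True
        then have "x \<in> W i" using c(3) I i ball_subset_cball by blast
        then have "h i x = 0" using c(5)[of i x] that I i by blast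
        then show ?thesis by simp
      qed (simp add: b0)
    qed
    fix x assume x: "x \<in> \<Sigma>"
    define s' where "s' = (\<lambda>v. \<Sum>i\<in>I. b i x * D (h i) x v)"
    have "strict_deriv s s' x" unfolding s_def s'_def using I(2) der x by (intro strict_deriv_sum) auto
    moreover have "s' v = 0" if v: "v \<in> tangent_space \<Sigma> x" for v
      unfolding s'_def
    proof (rule sum.neutral, rule ballI)
      fix i assume i: "i \<in> I"
      show "b i x * D (h i) x v = 0"
      proof (cases "x \<in> ball i (r i)")
        case True
        then have "x \<in> W i" using c(3) I i ball_subset_cball by blast
        then have "D (h i) x v = 0"
          using c(2,4,5)[of i] I i by (intro tangent_spaceD[OF v, of "W i"]) blast+
        then show ?thesis by simp
      qed (simp add: b0)
    qed
    moreover have "s' (n x) > 0"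
    proof -
      obtain j where j: "j \<in> I" "x \<in> ball j (r j)" using I(3) x by blast
      have nn: "b i x * D (h i) x (n x) \<ge> 0" if i: "i \<in> I" for i
      proof (cases "x \<in> ball i (r i)")
        case True
        then have "D (h i) x (n x) > 0" using c(6)[of i x] I(1) i x by blast
        then show ?thesis using bnn[of i x] by simp
      qed (simp add: b0)
      show ?thesis unfolding s'_def
      proof (rule sum_pos2[OF I(2) j(1)])
        have "D (h j) x (n x) > 0" using c(6)[of j x] j I(1) x by blast
        then show "0 < b j x * D (h j) x (n x)" using bpos[OF j(2)] by simp
      qed (use nn in auto)
    qed
    ultimately show "\<exists>s'. strict_deriv s s' x \<and> (\<exists>v\<in>tangent_S3 x. s' v \<noteq> 0) \<and> (\<forall>v\<in>tangent_space \<Sigma> x. s' v = 0)"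
      using n(2) x by (intro exI[of _ s'] conjI bexI[of _ "n x"]) auto
  qed
qed

text \<open>
  Near \<open>q\<close> both \<open>h\<close> and \<open>s\<close>, extended constantly along rays, are strictly monotone along segments in
  a direction \<open>u\<close> that is transversal to both.  The segment through a zero \<open>p\<close> of \<open>s\<close> contains a zero of
  \<open>h\<close>, hence a point of \<open>M\<close> up to scaling; there \<open>s\<close> vanishes too, so it must be \<open>p\<close> itself.
\<close>

lemma zero_set_near_regular_point:
  fixes h s :: "C2 \<Rightarrow> real"
  assumes q: "q \<in> S3" and W: "open W" "q \<in> W" "continuous_on W h" and h: "strict_deriv h h' q" and h0: "h q = 0"
    and M: "{x \<in> S3 \<inter> W. h x = 0} \<subseteq> M"
    and s: "strict_deriv s s' q" and s0: "\<And>x. x \<in> M \<Longrightarrow> s x = 0"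
    and w: "w \<in> tangent_S3 q" "h' w \<noteq> 0" "s' w \<noteq> 0"
  shows "\<exists>r>0. \<forall>p\<in>S3 \<inter> ball q r. s p = 0 \<longrightarrow> p \<in> M"
proof -
  have nq: "norm q = 1" using q by (simp add: S3_iff)
  have sq: "sgn q = q" using nq by (simp add: sgn_div_norm)
  have lin: "linear h'" "linear s'" using strict_deriv_linear[OF h] strict_deriv_linear[OF s] bounded_linear.linear by blast+
  define u where "u = (if h' w > 0 then w else - w)"
  have u: "q \<bullet> u = 0" "h' u > 0" "s' u \<noteq> 0"
    using w linear_neg[OF lin(1)] linear_neg[OF lin(2)] by (auto simp: u_def tangent_S3_def)
  have nu: "norm u > 0" using u(2) linear_0[OF lin(1)] by (cases "u = 0") auto
  define ht where "ht = (\<lambda>x. h (sgn x))"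
  define st where "st = (\<lambda>x. s (sgn x))"
  have ht: "strict_deriv ht (\<lambda>u. h' (u - (q \<bullet> u) *\<^sub>R q)) q"
    unfolding ht_def using strict_deriv_compose[OF strict_deriv_sgn[OF nq]] h sq by simp
  have st: "strict_deriv st (\<lambda>u. s' (u - (q \<bullet> u) *\<^sub>R q)) q"
    unfolding st_def using strict_deriv_compose[OF strict_deriv_sgn[OF nq]] s sq by simp
  define B where "B = h' u"
  define A where "A = \<bar>s' u\<bar>"
  have AB: "B > 0" "A > 0" using u by (auto simp: A_def B_def)
  obtain r1 where r1: "r1 > 0" "\<And>x y. x \<in> ball q r1 \<Longrightarrow> y \<in> ball q r1 \<Longrightarrow>
      norm (ht x - ht y - h' ((x - y) - (q \<bullet> (x - y)) *\<^sub>R q)) \<le> (B / (2 * norm u)) * norm (x - y)"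
    using strict_derivD[OF ht, of "B / (2 * norm u)"] AB nu by (metis divide_pos_pos mult_pos_pos zero_less_numeral)
  obtain r2 where r2: "r2 > 0" "\<And>x y. x \<in> ball q r2 \<Longrightarrow> y \<in> ball q r2 \<Longrightarrow>
      norm (st x - st y - s' ((x - y) - (q \<bullet> (x - y)) *\<^sub>R q)) \<le> (A / (2 * norm u)) * norm (x - y)"
    using strict_derivD[OF st, of "A / (2 * norm u)"] AB nu by (metis divide_pos_pos mult_pos_pos zero_less_numeral)
  obtain r3 where r3: "0 < r3" "r3 < 1" "\<And>x. x \<in> ball q r3 \<Longrightarrow> x \<noteq> 0 \<and> sgn x \<in> W"
    using continuous_sgn[OF nq W(1,2)] by metis
  define r where "r = min r1 (min r2 r3)"
  have r: "r > 0" using r1 r2 r3 by (simp add: r_def)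
  define \<sigma>0 where "\<sigma>0 = r / (2 * norm u)"
  have \<sigma>0: "\<sigma>0 > 0" "\<sigma>0 * norm u = r / 2" using r nu by (auto simp: \<sigma>0_def)
  have conth: "continuous_on (ball q r) ht"
    unfolding ht_def
  proof (rule continuous_on_compose2[OF W(3)])
    show "continuous_on (ball q r) sgn"
      by (intro continuous_on_sgn continuous_on_id) (use r3(3) in \<open>auto simp: r_def\<close>)
    show "sgn ` ball q r \<subseteq> W" by (rule image_subsetI) (use r3(3) in \<open>auto simp: r_def\<close>)
  qed
  have "isCont ht q" using conth r by (simp add: continuous_on_eq_continuous_at)
  then obtain d where d: "d > 0" "\<And>x. dist x q < d \<Longrightarrow> dist (ht x) (ht q) < \<sigma>0 * B / 2"
    unfolding continuous_at_eps_delta using AB \<sigma>0 by (metis divide_pos_pos mult_pos_pos zero_less_numeral)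
  have incr: "\<bar>ht (p + \<sigma> *\<^sub>R u) - ht p - \<sigma> * B\<bar> \<le> \<bar>\<sigma>\<bar> * B / 2"
      "\<bar>st (p + \<sigma> *\<^sub>R u) - st p - \<sigma> * s' u\<bar> \<le> \<bar>\<sigma>\<bar> * A / 2"
    if "p \<in> ball q r" "p + \<sigma> *\<^sub>R u \<in> ball q r" for p \<sigma>
    using r1(2)[of "p + \<sigma> *\<^sub>R u" p] r2(2)[of "p + \<sigma> *\<^sub>R u" p] that u(1) nu
    by (auto simp: r_def B_def linear_scale[OF lin(1)] linear_scale[OF lin(2)] mult.commute)
  show ?thesis
  proof (intro exI[of _ "min (r/2) d"] conjI ballI impI)
    show "min (r/2) d > 0" using r d by simp
    fix p assume p: "p \<in> S3 \<inter> ball q (min (r/2) d)" and sp: "s p = 0"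
    have pu: "p + \<sigma> *\<^sub>R u \<in> ball q r" if "\<bar>\<sigma>\<bar> \<le> \<sigma>0" for \<sigma>
    proof -
      have "dist q (p + \<sigma> *\<^sub>R u) \<le> dist q p + \<bar>\<sigma>\<bar> * norm u"
        using norm_triangle_ineq4[of "q - p" "\<sigma> *\<^sub>R u"] by (simp add: dist_norm algebra_simps)
      also have "\<dots> < r / 2 + r / 2"
        using p mult_right_mono[OF that norm_ge_zero[of u]] \<sigma>0(2) by auto
      finally show ?thesis by simp
    qed
    have p0: "p \<in> ball q r" using pu[of 0] \<sigma>0 by simp
    have small: "\<bar>ht p\<bar> < \<sigma>0 * B / 2"
      using d(2)[of p] p by (auto simp: ht_def sq h0 dist_real_def dist_commute)
    have lo: "ht (p + (-\<sigma>0) *\<^sub>R u) \<le> 0"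
    proof -
      have "X \<le> 0" if "\<bar>X - Y - - P\<bar> \<le> P / 2" "\<bar>Y\<bar> < P / 2" for X Y P :: real using that by linarith
      from this[of _ "ht p" "\<sigma>0 * B"] show ?thesis
        using incr(1)[OF p0 pu[of "-\<sigma>0"]] small \<sigma>0(1) by simp
    qed
    have hi: "0 \<le> ht (p + \<sigma>0 *\<^sub>R u)"
    proof -
      have "0 \<le> X" if "\<bar>X - Y - P\<bar> \<le> P / 2" "\<bar>Y\<bar> < P / 2" for X Y P :: real using that by linarith
      from this[of _ "ht p" "\<sigma>0 * B"] show ?thesis
        using incr(1)[OF p0 pu[of "\<sigma>0"]] small \<sigma>0(1) by simp
    qed
    have "continuous_on {-\<sigma>0..\<sigma>0} (\<lambda>\<sigma>. ht (p + \<sigma> *\<^sub>R u))"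
      by (rule continuous_on_compose2[OF conth]) (use pu in \<open>auto intro!: continuous_intros simp: abs_le_iff\<close>)
    then obtain \<sigma> where \<sigma>: "-\<sigma>0 \<le> \<sigma>" "\<sigma> \<le> \<sigma>0" "ht (p + \<sigma> *\<^sub>R u) = 0"
      using IVT'[of "\<lambda>\<sigma>. ht (p + \<sigma> *\<^sub>R u)" "-\<sigma>0" 0 \<sigma>0] lo hi \<sigma>0(1) by auto
    have in_r: "p + \<sigma> *\<^sub>R u \<in> ball q r" using \<sigma> by (intro pu) auto
    then have "sgn (p + \<sigma> *\<^sub>R u) \<in> S3 \<inter> W"
      using r3(3)[of "p + \<sigma> *\<^sub>R u"] by (auto simp: S3_iff norm_sgn r_def)
    then have xM: "sgn (p + \<sigma> *\<^sub>R u) \<in> M" using \<sigma>(3) M by (auto simp: ht_def)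
    have sgnp: "sgn p = p" using p by (simp add: S3_iff sgn_div_norm)
    have "\<bar>\<sigma> * s' u\<bar> \<le> \<bar>\<sigma>\<bar> * A / 2"
      using incr(2)[OF p0 in_r] s0[OF xM] sp sgnp by (simp add: st_def)
    then have "\<bar>\<sigma>\<bar> * A \<le> 0" by (simp add: abs_mult A_def)
    then have "\<sigma> = 0" using AB(2) by (simp add: mult_le_0_iff)
    then show "p \<in> M" using xM sgnp by simp
  qed
qed

lemma seifert_zero_set_near_interior:
  assumes S: "seifert_surface K \<Sigma>" and q: "q \<in> \<Sigma>" "q \<notin> K"
    and s: "strict_deriv s s' q" "\<exists>v\<in>tangent_S3 q. s' v \<noteq> 0" "\<forall>v\<in>tangent_space \<Sigma> q. s' v = (0::real)"
    and s0: "\<And>x. x \<in> \<Sigma> \<Longrightarrow> s x = 0"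
  shows "\<exists>r>0. \<forall>p\<in>S3 \<inter> ball q r. s p = 0 \<longrightarrow> p \<in> \<Sigma>"
proof -
  obtain W and h :: "C2 \<Rightarrow> real" where c: "open W" "q \<in> W" "smooth_on W h" "\<forall>x\<in>\<Sigma> \<inter> W. h x = 0"
    "\<forall>v\<in>tangent_S3 q. D h q v = 0 \<longrightarrow> v \<in> tangent_space \<Sigma> q"
    "\<Sigma> \<inter> W = {x \<in> S3 \<inter> W. h x = 0}"
    by (rule seifert_chart[OF S q(1)]) (rule that, assumption+, simp add: q(2))
  obtain w where w: "w \<in> tangent_S3 q" "s' w \<noteq> 0" using s(2) by blast
  have hw: "D h q w \<noteq> 0" using w c(5) s(3) by blast
  have q': "q \<in> {x \<in> S3 \<inter> W. h x = 0}" using c(2,6) q(1) by blast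
  have sub: "{x \<in> S3 \<inter> W. h x = 0} \<subseteq> \<Sigma>" using c(6) by blast
  show ?thesis
    using q' by (intro zero_set_near_regular_point[OF _ c(1,2) smooth_on_continuous[OF c(3)]
        tangent_space_linear(2)[OF c(1,2,3)] _ sub s(1) s0 w(1) hw w(2)]) simp_all
qed

section \<open>Sections along the boundary circle\<close>

lemma orthogonal_on_circle:
  fixes u x :: complex
  assumes "norm u = 1" "u \<bullet> x = 0"
  shows "x = (\<i> * u) * of_real (Im (cnj u * x))"
proof -
  have "Re (cnj u * x) = 0" using assms(2) by (simp add: inner_complex_def)
  then have "cnj u * x = \<i> * of_real (Im (cnj u * x))" by (simp add: complex_eq_iff)
  moreover have "u * (cnj u * x) = x"
    using assms(1) by (simp add: mult.assoc[symmetric] complex_norm_square[symmetric])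
  ultimately show ?thesis by (metis mult.assoc mult.commute)
qed

abbreviation hopf_circle :: "C2 set" where
  "hopf_circle \<equiv> sphere 0 1 \<times> {0}"

lemma has_vector_derivative_cis: "(cis has_vector_derivative \<i> * cis t) (at t)"
proof -
  have "((\<lambda>z. exp (\<i> * z)) has_field_derivative \<i> * cis t) (at (complex_of_real t))"
    by (auto intro!: derivative_eq_intros simp: cis_conv_exp)
  then have "((\<lambda>t. exp (\<i> * complex_of_real t)) has_vector_derivative \<i> * cis t) (at t)"
    by (rule has_vector_derivative_real_field)
  then show ?thesis by (simp add: cis_conv_exp[abs_def])
qed

lemma contingent_hopf_circle:
  assumes "norm u = 1"
  shows "contingent hopf_circle (u, 0) (\<i> * u, 0)"
proof -
  define c where "c = (\<lambda>t::real. (cis t * u, 0 :: complex))"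
  have "((\<lambda>t. cis t * u) has_vector_derivative \<i> * u) (at 0)"
    using has_vector_derivative_mult_left[OF has_vector_derivative_cis[of 0], of u] by simp
  then have "(c has_vector_derivative (\<i> * u, 0)) (at 0)"
    unfolding c_def by (intro has_vector_derivative_Pair has_vector_derivative_const)
  from contingent_curve[OF this, of 1 hopf_circle] show ?thesis
    using assms by (simp add: c_def norm_mult)
qed

text \<open>
  Since \<open>f\<close> vanishes on the circle, its derivative does not see the component of \<open>v\<close> along the circle.
\<close>

lemma hopf_circle_derivative:
  fixes f :: "C2 \<Rightarrow> real"
  assumes W: "open W" "(u, 0) \<in> W" "smooth_on W f" and u: "norm u = 1"
    and f0: "\<And>x. x \<in> hopf_circle \<inter> W \<Longrightarrow> f x = 0" and v: "v \<in> tangent_S3 (u, 0)"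
  shows "D f (u, 0) v = D f (u, 0) (0, snd v)"
proof -
  have lin: "linear (D f (u, 0))" by (rule tangent_space_linear(1)[OF W])
  define r where "r = Im (cnj u * fst v)"
  have "u \<bullet> fst v = 0" using v by (simp add: tangent_S3_def inner_prod_def)
  then have fv: "fst v = (\<i> * u) * of_real r" unfolding r_def using orthogonal_on_circle u by blast
  have "v = r *\<^sub>R (\<i> * u, 0) + (0, snd v)"
    by (rule prod_eqI) (simp_all add: fv scaleR_conv_of_real mult.commute)
  then have "D f (u, 0) v = r * D f (u, 0) (\<i> * u, 0) + D f (u, 0) (0, snd v)"
    by (metis linear_add[OF lin] linear_scale[OF lin] real_scaleR_def)
  moreover have "f (u, 0) = 0" using u W(2) by (intro f0) simp
  then have "D f (u, 0) (\<i> * u, 0) = 0"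
    using contingent_deriv_zero[OF contingent_hopf_circle[OF u] tangent_space_linear(2)[OF W] W(1,2) f0] by blast
  ultimately show ?thesis by simp
qed

text \<open>
  The third part says that \<open>(D h, D k)\<close> restricts to an isomorphism from the normal plane \<open>{0} \<times> \<complex>\<close>
  onto the real plane: it is onto by the definition of a chart, and both have dimension two.
\<close>

lemma boundary_chart_hopf:
  assumes c: "boundary_chart hopf_circle \<Sigma> (u, 0) W h k" and u: "norm u = 1"
  shows "\<And>v. v \<in> tangent_S3 (u, 0) \<Longrightarrow> D h (u, 0) v = D h (u, 0) (0, snd v)"
    and "\<And>v. v \<in> tangent_S3 (u, 0) \<Longrightarrow> D k (u, 0) v = D k (u, 0) (0, snd v)"
    and "\<And>w. D h (u, 0) (0, w) = 0 \<Longrightarrow> D k (u, 0) (0, w) = 0 \<Longrightarrow> w = 0"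
proof -
  have W: "open W" "(u, 0) \<in> W" "smooth_on W h" "smooth_on W k"
    and K: "hopf_circle \<inter> W = {q \<in> S3 \<inter> W. h q = 0 \<and> k q = 0}"
    and surj: "\<And>x y. \<exists>v\<in>tangent_S3 (u, 0). D h (u, 0) v = x \<and> D k (u, 0) v = y"
    using c unfolding boundary_chart_def by simp_all
  show h: "D h (u, 0) v = D h (u, 0) (0, snd v)" if "v \<in> tangent_S3 (u, 0)" for v
    by (rule hopf_circle_derivative[OF W(1,2,3) u _ that]) (use K in blast)
  show k: "D k (u, 0) v = D k (u, 0) (0, snd v)" if "v \<in> tangent_S3 (u, 0)" for v
    by (rule hopf_circle_derivative[OF W(1,2,4) u _ that]) (use K in blast)
  define f where "f = (\<lambda>w. Complex (D h (u, 0) (0, w)) (D k (u, 0) (0, w)))"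
  have linh: "linear (D h (u, 0))" and link: "linear (D k (u, 0))"
    using tangent_space_linear(1) W by blast+
  have pair: "(0::complex, x + y) = (0, x) + (0, y)" "(0::complex, r *\<^sub>R x) = r *\<^sub>R (0, x)"
    for x y :: complex and r by simp_all
  have "linear f"
    unfolding f_def by (rule linearI)
      (simp_all only: pair linear_add[OF linh] linear_add[OF link] linear_scale[OF linh] linear_scale[OF link],
       simp_all add: complex_eq_iff)
  moreover have "surj f"
    unfolding surj_def
  proof
    fix z
    obtain v where v: "v \<in> tangent_S3 (u, 0)" "D h (u, 0) v = Re z" "D k (u, 0) v = Im z" using surj by blast
    then have "f (snd v) = z" using h[OF v(1)] k[OF v(1)] by (simp add: f_def)
    then show "\<exists>x. z = f x" by blast
  qed
  ultimately have "inj f" using linear_surjective_imp_injective by blast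
  then show "w = 0" if "D h (u, 0) (0, w) = 0" "D k (u, 0) (0, w) = 0" for w
    using that \<open>linear f\<close> by (simp add: linear_injective_0 f_def Complex_eq_0)
qed

text \<open>
  First-order expansion in coordinates \<open>(u, w) \<mapsto> (sqrt(1 - |w|\<^sup>2) u, w)\<close> of the sphere near the circle.  The
  base point \<open>(u, 0)\<close> varies over a neighbourhood of \<open>(u0, 0)\<close>; the displacement of the first component
  is of second order in \<open>w\<close>.
\<close>

lemma polar_taylor:
  fixes f :: "C2 \<Rightarrow> real"
  assumes f: "strict_deriv f f' (u0, 0)" and \<eta>: "\<eta> > 0"
  obtains r where "0 < r" "r < 1"
    "\<And>u w. norm u = 1 \<Longrightarrow> dist u u0 < r \<Longrightarrow> norm w < r \<Longrightarrow>
      \<bar>f (of_real (sqrt (1 - (norm w)\<^sup>2)) * u, w) - f (u, 0) - f' (0, w)\<bar> \<le> \<eta> * norm w"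
proof -
  obtain C where C: "C > 0" "\<And>v. norm (f' v) \<le> norm v * C"
    using bounded_linear.pos_bounded[OF strict_deriv_linear[OF f]] by auto
  have lin: "linear f'" using strict_deriv_linear[OF f] bounded_linear.linear by blast
  have "\<eta> / 4 > 0" using \<eta> by simp
  then obtain r where r: "r > 0" "\<And>x y. x \<in> ball (u0, 0) r \<Longrightarrow> y \<in> ball (u0, 0) r \<Longrightarrow>
      norm (f x - f y - f' (x - y)) \<le> \<eta> / 4 * norm (x - y)"
    using strict_derivD[OF f] by metis
  define d where "d = min (1/2) (min (r / 3) (\<eta> / (2 * C)))"
  have d: "d > 0" "d \<le> 1/2" "d \<le> r/3" "d \<le> \<eta> / (2 * C)" using r(1) \<eta> C(1) by (auto simp: d_def)
  show ?thesis
  proof (rule that[of d])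
    fix u w :: complex assume uw: "norm u = 1" "dist u u0 < d" "norm w < d"
    define a where "a = sqrt (1 - (norm w)\<^sup>2)"
    have w1: "norm w \<le> 1" using uw(3) d(2) by simp
    then have nw2: "(norm w)\<^sup>2 \<le> 1" by (simp add: abs_square_le_1)
    have "(norm w)\<^sup>2 \<le> norm w" using w1 by (simp add: power2_eq_square mult_left_le)
    have a: "0 \<le> a" "a \<le> 1" "a\<^sup>2 = 1 - (norm w)\<^sup>2" using nw2 by (auto simp: a_def)
    have "1 - a \<le> (1 - a) * (1 + a)" using a(1,2) by (simp add: mult_le_cancel_left1)
    also have "\<dots> = (norm w)\<^sup>2" using a(3) by (simp add: algebra_simps power2_eq_square)
    finally have a1: "\<bar>a - 1\<bar> \<le> (norm w)\<^sup>2" using a(2) by simp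
    let ?x = "(of_real a * u, w)" and ?y = "(u, 0 :: complex)"
    have xy: "?x - ?y = (of_real (a - 1) * u, w)" by (simp add: algebra_simps)
    have nfst: "norm (of_real (a - 1) * u) \<le> (norm w)\<^sup>2" using a1 uw(1) by (simp only: norm_mult norm_of_real mult_1_right)
    have nxy: "norm (?x - ?y) \<le> 2 * norm w"
      unfolding xy using norm_Pair_le[of "of_real (a - 1) * u" w] nfst \<open>(norm w)\<^sup>2 \<le> norm w\<close> by linarith
    have dy: "dist ?y (u0, 0) = dist u u0" by (simp add: dist_Pair_Pair)
    have "dist ?x (u0, 0) \<le> dist ?x ?y + dist ?y (u0, 0)" by (rule dist_triangle)
    also have "\<dots> < r" using nxy uw d(3) dy by (simp only: dist_norm[of ?x ?y])
    finally have xr: "?x \<in> ball (u0, 0) r" by (simp add: dist_commute)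
    have yr: "?y \<in> ball (u0, 0) r" using dy uw(2) d(3) r(1) by (simp add: dist_commute)
    have split: "(of_real (a - 1) * u, w) = (of_real (a - 1) * u, 0) + (0, w)" by simp
    have "f' (?x - ?y) = f' (of_real (a - 1) * u, 0) + f' (0, w)"
      unfolding xy by (subst split) (rule linear_add[OF lin])
    moreover have "\<bar>f ?x - f ?y - f' (?x - ?y)\<bar> \<le> \<eta> / 4 * (2 * norm w)"
      using order_trans[OF r(2)[OF xr yr] mult_left_mono[OF nxy, of "\<eta> / 4"]] \<eta> by simp
    moreover have "\<bar>f' (of_real (a - 1) * u, 0)\<bar> \<le> \<eta> / 2 * norm w"
    proof -
      have "\<bar>f' (v, 0)\<bar> \<le> norm v * C" for v :: complex using C(2)[of "(v, 0)"] by simp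
      then have "\<bar>f' (of_real (a - 1) * u, 0)\<bar> \<le> norm (of_real (a - 1) * u) * C" .
      also have "\<dots> \<le> (norm w)\<^sup>2 * C"
        by (rule mult_right_mono[OF nfst]) (use C(1) in simp)
      finally have "\<bar>f' (of_real (a - 1) * u, 0)\<bar> \<le> (norm w)\<^sup>2 * C" .
      also have "(norm w)\<^sup>2 * C = (norm w * C) * norm w" by (simp add: power2_eq_square)
      also have "\<dots> \<le> \<eta> / 2 * norm w"
      proof (rule mult_right_mono)
        have "norm w * C \<le> \<eta> / (2 * C) * C"
          using uw(3) d(4) C(1) by (intro mult_right_mono) auto
        then show "norm w * C \<le> \<eta> / 2" using C(1) by simp
      qed simp
      finally show ?thesis .
    qed
    ultimately show "\<bar>f (of_real (sqrt (1 - (norm w)\<^sup>2)) * u, w) - f (u, 0) - f' (0, w)\<bar> \<le> \<eta> * norm w"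
      unfolding a_def[symmetric] by linarith
  qed (use d in auto)
qed

lemma polar_in_open:
  fixes W :: "C2 set"
  assumes "open W" "(u0, 0) \<in> W"
  obtains r where "0 < r" "r < 1"
    "\<And>u w. norm u = 1 \<Longrightarrow> dist u u0 < r \<Longrightarrow> norm w < r \<Longrightarrow> (of_real (sqrt (1 - (norm w)\<^sup>2)) * u, w) \<in> W"
proof -
  define E where "E = (\<lambda>p :: C2. (of_real (sqrt (1 - (norm (snd p))\<^sup>2)) * fst p, snd p))"
  have "continuous_on UNIV E" unfolding E_def by (intro continuous_intros)
  then have "open (E -` W)" using assms(1) open_vimage by blast
  moreover have "(u0, 0) \<in> E -` W" using assms(2) by (simp add: E_def)
  ultimately obtain e where e: "e > 0" "ball (u0, 0) e \<subseteq> E -` W" using openE by blast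
  show ?thesis
  proof (rule that[of "min (e/2) (1/2)"])
    fix u w :: complex assume uw: "norm u = 1" "dist u u0 < min (e/2) (1/2)" "norm w < min (e/2) (1/2)"
    have "dist (u, w) (u0, 0) \<le> dist u u0 + dist w 0"
      unfolding dist_Pair_Pair by (rule sqrt_sum_squares_le_sum) auto
    also have "\<dots> < e" using uw by simp
    finally have "(u, w) \<in> ball (u0, 0) e" by (simp add: dist_commute)
    then show "(of_real (sqrt (1 - (norm w)\<^sup>2)) * u, w) \<in> W" using e(2) by (auto simp: E_def)
  qed (use e in auto)
qed

lemma polar_in_S3:
  fixes u w :: complex
  assumes "norm u = 1" "norm w \<le> 1"
  shows "(of_real (sqrt (1 - (norm w)\<^sup>2)) * u, w) \<in> S3"
proof -
  have "(norm w)\<^sup>2 \<le> 1" using assms(2) by (simp add: abs_square_le_1)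
  then show ?thesis using assms(1) by (simp add: S3_iff norm_Pair norm_mult power_mult_distrib)
qed

text \<open>
  Used with \<open>S\<close> the time interval, to choose one \<open>\<epsilon>\<close> for a whole loop.
\<close>

lemma locally_uniform_imp_uniform:
  fixes P :: "'a::metric_space \<Rightarrow> real \<Rightarrow> bool"
  assumes "compact S"
    and loc: "\<And>x. x \<in> S \<Longrightarrow> \<exists>d>0. \<forall>y\<in>S \<inter> ball x d. \<forall>\<epsilon>. 0 < \<epsilon> \<and> \<epsilon> < d \<longrightarrow> P y \<epsilon>"
  shows "\<exists>d>0. \<forall>y\<in>S. \<forall>\<epsilon>. 0 < \<epsilon> \<and> \<epsilon> < d \<longrightarrow> P y \<epsilon>"
proof -
  have "\<forall>x\<in>S. \<exists>d. d > 0 \<and> (\<forall>y\<in>S \<inter> ball x d. \<forall>\<epsilon>. 0 < \<epsilon> \<and> \<epsilon> < d \<longrightarrow> P y \<epsilon>)" using loc by blast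
  from bchoice[OF this] obtain d where
    d: "\<forall>x\<in>S. d x > 0 \<and> (\<forall>y\<in>S \<inter> ball x (d x). \<forall>\<epsilon>. 0 < \<epsilon> \<and> \<epsilon> < d x \<longrightarrow> P y \<epsilon>)" ..
  have cover: "S \<subseteq> (\<Union>x\<in>S. ball x (d x))" using d by force
  obtain I where I: "I \<subseteq> S" "finite I" "S \<subseteq> (\<Union>x\<in>I. ball x (d x))"
    by (rule compactE_image[OF assms(1) _ cover]) (simp, rule that)
  define e where "e = Min (insert 1 (d ` I))"
  have "e > 0" using I d by (auto simp: e_def)
  moreover have "P y \<epsilon>" if y: "y \<in> S" and \<epsilon>: "0 < \<epsilon>" "\<epsilon> < e" for y \<epsilon>
  proof -
    obtain x where x: "x \<in> I" "y \<in> ball x (d x)" using I(3) y by blast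
    have "e \<le> d x" using I(2) x(1) by (simp add: e_def)
    then show ?thesis using d x I(1) y \<epsilon> by fastforce
  qed
  ultimately show ?thesis by blast
qed

text \<open>
  A Seifert surface of the circle together with a section, over a curve in the circle, of the kind that
  defines the framing.
\<close>

locale framed_hopf_surface =
  fixes \<Sigma> :: "C2 set" and \<gamma> :: "real \<Rightarrow> complex" and Z :: "real \<Rightarrow> C2"
  assumes seifert: "seifert_surface hopf_circle \<Sigma>"
    and cont_\<gamma>: "continuous_on {0..2 * pi} \<gamma>" and norm_\<gamma>: "\<And>t. norm (\<gamma> t) = 1"
    and cont_Z: "continuous_on {0..2 * pi} Z"
    and tangent_Z: "\<And>t. t \<in> {0..2 * pi} \<Longrightarrow> Z t \<in> tangent_space \<Sigma> (\<gamma> t, 0)"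
    and Z_nonzero: "\<And>t. t \<in> {0..2 * pi} \<Longrightarrow> snd (Z t) \<noteq> 0"
begin

lemma surface_S3: "\<Sigma> \<subseteq> S3" and circle_surface: "hopf_circle \<subseteq> \<Sigma>"
  and compact_surface: "compact \<Sigma>"
  using seifert unfolding seifert_surface_def by simp_all

lemma \<gamma>_in: "(\<gamma> t, 0) \<in> hopf_circle" "(\<gamma> t, 0) \<in> \<Sigma>"
  using norm_\<gamma>[of t] circle_surface by auto

lemma Z_tangent_S3: "t \<in> {0..2 * pi} \<Longrightarrow> Z t \<in> tangent_S3 (\<gamma> t, 0)"
  using tangent_space_subset_tangent_S3[OF surface_S3 \<gamma>_in(2)] tangent_Z by blast

lemma chart_Z:
  assumes c: "boundary_chart hopf_circle \<Sigma> (\<gamma> t, 0) W h k" and t: "t \<in> {0..2 * pi}"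
  shows "D h (\<gamma> t, 0) (Z t) = 0" "D k (\<gamma> t, 0) (Z t) \<noteq> 0"
    "D h (\<gamma> t, 0) (0, snd (Z t)) = 0" "D k (\<gamma> t, 0) (Z t) = D k (\<gamma> t, 0) (0, snd (Z t))"
proof -
  have W: "open W" "(\<gamma> t, 0) \<in> W" "smooth_on W h" "\<Sigma> \<inter> W = {q \<in> S3 \<inter> W. h q = 0 \<and> k q \<ge> 0}"
    using c unfolding boundary_chart_def by simp_all
  show 1: "D h (\<gamma> t, 0) (Z t) = 0"
    by (rule tangent_spaceD[OF tangent_Z[OF t] W(1,2,3)]) (use W(4) in blast)
  show 2: "D h (\<gamma> t, 0) (0, snd (Z t)) = 0"
    using boundary_chart_hopf(1)[OF c norm_\<gamma> Z_tangent_S3[OF t]] 1 by simp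
  show 3: "D k (\<gamma> t, 0) (Z t) = D k (\<gamma> t, 0) (0, snd (Z t))"
    by (rule boundary_chart_hopf(2)[OF c norm_\<gamma> Z_tangent_S3[OF t]])
  show "D k (\<gamma> t, 0) (Z t) \<noteq> 0"
    using boundary_chart_hopf(3)[OF c norm_\<gamma> 2] 3 Z_nonzero[OF t] by auto
qed

lemma chart_nonneg:
  assumes c: "boundary_chart hopf_circle \<Sigma> p W h k" and q: "q \<in> hopf_circle \<inter> W" and v: "contingent \<Sigma> q v"
  shows "D k q v \<ge> 0"
proof -
  have W: "open W" "smooth_on W k" "\<Sigma> \<inter> W = {q \<in> S3 \<inter> W. h q = 0 \<and> k q \<ge> 0}"
      "hopf_circle \<inter> W = {q \<in> S3 \<inter> W. h q = 0 \<and> k q = 0}"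
    using c unfolding boundary_chart_def by simp_all
  have "q \<in> W" "k q = 0" using q W(4) by blast+
  show ?thesis
    by (rule contingent_deriv_nonneg[OF v tangent_space_linear(2)[OF W(1) \<open>q \<in> W\<close> W(2)] W(1) \<open>q \<in> W\<close> _ \<open>k q = 0\<close>])
      (use W(3) in blast)
qed

text \<open>
  By the chart at \<open>\<gamma> t\<close>: \<open>D k\<close> does not vanish on \<open>Z t\<close>, and its sign decides.
\<close>

lemma inward_or_outward:
  assumes t: "t \<in> {0..2 * pi}"
  shows "contingent \<Sigma> (\<gamma> t, 0) (Z t) \<or> contingent \<Sigma> (\<gamma> t, 0) (- Z t)"
proof -
  obtain W h k where c: "boundary_chart hopf_circle \<Sigma> (\<gamma> t, 0) W h k"
    using boundary_chart_exists[OF seifert \<gamma>_in(1)] .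
  then have W: "open W" "(\<gamma> t, 0) \<in> W" "smooth_on W h" "smooth_on W k"
    unfolding boundary_chart_def by simp_all
  have neg: "D h (\<gamma> t, 0) (- Z t) = 0" "D k (\<gamma> t, 0) (- Z t) = - D k (\<gamma> t, 0) (Z t)"
    "- Z t \<in> tangent_S3 (\<gamma> t, 0)"
    using chart_Z(1)[OF c t] linear_neg[OF tangent_space_linear(1)[OF W(1,2,3)]]
      linear_neg[OF tangent_space_linear(1)[OF W(1,2,4)]] Z_tangent_S3[OF t]
    by (simp_all add: tangent_S3_def)
  show ?thesis
  proof (cases "D k (\<gamma> t, 0) (Z t) > 0")
    case True
    then show ?thesis
      using boundary_chart_contingent[OF c \<gamma>_in(1) Z_tangent_S3[OF t] chart_Z(1)[OF c t]] by blast
  next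
    case False
    then have "D k (\<gamma> t, 0) (- Z t) > 0" using chart_Z(2)[OF c t] neg(2) by simp
    then show ?thesis using boundary_chart_contingent[OF c \<gamma>_in(1) neg(3,1)] by blast
  qed
qed

text \<open>
  In the chart at \<open>\<gamma> t0\<close> the sign of \<open>D k (Z t)\<close> is constant for \<open>t\<close> near \<open>t0\<close>.  The independence
  condition of this chart is only known at \<open>\<gamma> t0\<close>, but \<open>k \<ge> 0\<close> on the surface suffices to exclude one of
  the two alternatives for \<open>Z t\<close>.
\<close>

lemma inward_locally_constant:
  assumes t0: "t0 \<in> {0..2 * pi}"
  shows "\<exists>d>0. \<forall>t\<in>{0..2 * pi} \<inter> ball t0 d.
    contingent \<Sigma> (\<gamma> t, 0) (Z t) = contingent \<Sigma> (\<gamma> t0, 0) (Z t0)"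
proof -
  obtain W h k where c: "boundary_chart hopf_circle \<Sigma> (\<gamma> t0, 0) W h k"
    using boundary_chart_exists[OF seifert \<gamma>_in(1)] .
  then have W: "open W" "(\<gamma> t0, 0) \<in> W" "smooth_on W k" unfolding boundary_chart_def by simp_all
  define A where "A = {t \<in> {0..2 * pi}. (\<gamma> t, 0) \<in> W}"
  have cont\<gamma>0: "continuous_on {0..2 * pi} (\<lambda>t. (\<gamma> t, 0::complex))" by (intro continuous_intros cont_\<gamma>)
  have lin: "linear (D k q)" if "q \<in> W" for q using tangent_space_linear(1)[OF W(1) that W(3)] .
  have Dk: "D k q v = (\<Sum>b\<in>Basis. (v \<bullet> b) * D k q b)" if "q \<in> W" for q v
    using linear_sum[OF lin[OF that], of "\<lambda>b. (v \<bullet> b) *\<^sub>R b" Basis] linear_scale[OF lin[OF that]]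
    by (simp add: euclidean_representation)
  have "continuous_on A (\<lambda>t. \<Sum>b\<in>Basis. (Z t \<bullet> b) * D k (\<gamma> t, 0) b)"
  proof (intro continuous_intros)
    show "continuous_on A Z" by (rule continuous_on_subset[OF cont_Z]) (auto simp: A_def)
    show "continuous_on A (\<lambda>t. D k (\<gamma> t, 0) b)" for b
      by (rule continuous_on_compose2[OF smooth_onD(2)[OF W(3,2)] continuous_on_subset[OF cont\<gamma>0]])
        (auto simp: A_def)
  qed
  then have contA: "continuous_on A (\<lambda>t. D k (\<gamma> t, 0) (Z t))"
    by (rule continuous_on_eq) (simp add: Dk A_def)
  have t0A: "t0 \<in> A" using t0 W(2) by (simp add: A_def)
  have "\<bar>D k (\<gamma> t0, 0) (Z t0)\<bar> > 0" using chart_Z(2)[OF c t0] by simp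
  then obtain d1 where d1: "d1 > 0" "\<And>t. t \<in> A \<Longrightarrow> dist t t0 < d1 \<Longrightarrow>
      dist (D k (\<gamma> t, 0) (Z t)) (D k (\<gamma> t0, 0) (Z t0)) < \<bar>D k (\<gamma> t0, 0) (Z t0)\<bar>"
    using contA t0A unfolding continuous_on_iff by blast
  have "openin (top_of_set {0..2 * pi}) ({0..2 * pi} \<inter> (\<lambda>t. (\<gamma> t, 0)) -` W)"
    by (rule continuous_openin_preimage_gen[OF cont\<gamma>0 W(1)])
  moreover have "t0 \<in> {0..2 * pi} \<inter> (\<lambda>t. (\<gamma> t, 0)) -` W" using t0 W(2) by simp
  ultimately obtain d2 where d2: "d2 > 0" "ball t0 d2 \<inter> {0..2 * pi} \<subseteq> {0..2 * pi} \<inter> (\<lambda>t. (\<gamma> t, 0)) -` W"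
    unfolding openin_contains_ball by blast
  show ?thesis
  proof (intro exI[of _ "min d1 d2"] conjI ballI)
    fix t assume t: "t \<in> {0..2 * pi} \<inter> ball t0 (min d1 d2)"
    then have tI: "t \<in> {0..2 * pi}" "t \<in> ball t0 d2" by auto
    then have tW: "(\<gamma> t, 0) \<in> W" using d2(2) by blast
    then have tA: "t \<in> A" using tI by (simp add: A_def)
    have close: "dist (D k (\<gamma> t, 0) (Z t)) (D k (\<gamma> t0, 0) (Z t0)) < \<bar>D k (\<gamma> t0, 0) (Z t0)\<bar>"
      using t by (intro d1(2)[OF tA]) (auto simp: dist_commute)
    have qs: "(\<gamma> t, 0) \<in> hopf_circle \<inter> W" "(\<gamma> t0, 0) \<in> hopf_circle \<inter> W" using \<gamma>_in(1) tW W(2) by blast+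
    show "contingent \<Sigma> (\<gamma> t, 0) (Z t) = contingent \<Sigma> (\<gamma> t0, 0) (Z t0)"
    proof (cases "D k (\<gamma> t0, 0) (Z t0) > 0")
      case True
      then have pos: "D k (\<gamma> t, 0) (Z t) > 0" using close by (auto simp: dist_real_def)
      have "\<not> contingent \<Sigma> (\<gamma> t', 0) (- Z t')" if "D k (\<gamma> t', 0) (Z t') > 0" "(\<gamma> t', 0) \<in> hopf_circle \<inter> W" for t'
      proof
        assume "contingent \<Sigma> (\<gamma> t', 0) (- Z t')"
        then have "0 \<le> D k (\<gamma> t', 0) (- Z t')" by (rule chart_nonneg[OF c that(2)])
        also have "\<dots> = - D k (\<gamma> t', 0) (Z t')" using that(2) by (intro linear_neg lin) blast
        finally show False using that(1) by simp
      qed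
      then have "\<not> contingent \<Sigma> (\<gamma> t, 0) (- Z t)" "\<not> contingent \<Sigma> (\<gamma> t0, 0) (- Z t0)"
        using pos True qs by blast+
      then show ?thesis using inward_or_outward[OF tI(1)] inward_or_outward[OF t0] by blast
    next
      case False
      then have "D k (\<gamma> t0, 0) (Z t0) < 0" using chart_Z(2)[OF c t0] by simp
      then have "D k (\<gamma> t, 0) (Z t) < 0" using close by (auto simp: dist_real_def)
      then have "\<not> contingent \<Sigma> (\<gamma> t, 0) (Z t)" "\<not> contingent \<Sigma> (\<gamma> t0, 0) (Z t0)"
        using chart_nonneg[OF c qs(1), of "Z t"] chart_nonneg[OF c qs(2), of "Z t0"]
          \<open>D k (\<gamma> t0, 0) (Z t0) < 0\<close> by (auto simp del: split_paired_All)
      then show ?thesis by simp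
    qed
  qed (use d1 d2 in auto)
qed

lemma inward_constant:
  "(\<forall>t\<in>{0..2 * pi}. contingent \<Sigma> (\<gamma> t, 0) (Z t)) \<or> (\<forall>t\<in>{0..2 * pi}. contingent \<Sigma> (\<gamma> t, 0) (- Z t))"
proof -
  have "(\<lambda>t. contingent \<Sigma> (\<gamma> t, 0) (Z t)) constant_on {0..2 * pi}"
  proof (rule locally_constant_imp_constant)
    fix a assume a: "a \<in> {0..2 * pi}"
    obtain d where d: "d > 0" "\<forall>t\<in>{0..2 * pi} \<inter> ball a d.
        contingent \<Sigma> (\<gamma> t, 0) (Z t) = contingent \<Sigma> (\<gamma> a, 0) (Z a)"
      using inward_locally_constant[OF a] by blast
    show "\<exists>T. openin (top_of_set {0..2 * pi}) T \<and> a \<in> T \<and>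
        (\<forall>x\<in>T. contingent \<Sigma> (\<gamma> x, 0) (Z x) = contingent \<Sigma> (\<gamma> a, 0) (Z a))"
    proof (intro exI[of _ "{0..2 * pi} \<inter> ball a d"] conjI)
      show "a \<in> {0..2 * pi} \<inter> ball a d" using a centre_in_ball[of a d] d(1) by blast
    qed (use d(2) in \<open>blast intro: openin_open_Int open_ball\<close>)+
  qed simp
  then obtain b where b: "\<forall>t\<in>{0..2 * pi}. contingent \<Sigma> (\<gamma> t, 0) (Z t) = b"
    unfolding constant_on_def by blast
  show ?thesis
  proof (cases b)
    case True
    then show ?thesis using b by simp
  next
    case False
    have "contingent \<Sigma> (\<gamma> t, 0) (- Z t)" if "t \<in> {0..2 * pi}" for t
      using inward_or_outward[OF that] b False that by simp
    then show ?thesis by simp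
  qed
qed

end

section \<open>The surface near its boundary\<close>

text \<open>
  Two continuous logarithms of the same function differ by an element of the discrete set
  \<open>2 \<pi> \<i> \<int>\<close>, which is constant by connectedness.
\<close>

lemma log_unique:
  fixes f g :: "'a::topological_space \<Rightarrow> complex"
  assumes "connected S" "continuous_on S f" "continuous_on S g" "\<And>x. x \<in> S \<Longrightarrow> exp (f x) = exp (g x)"
    and xy: "x \<in> S" "y \<in> S"
  shows "f x - f y = g x - g y"
proof -
  have multiple: "\<exists>n::int. f x - g x = of_int n * (2 * pi * \<i>)" if x: "x \<in> S" for x
  proof -
    obtain n :: int where "f x = g x + (of_int (2 * n) * pi) * \<i>"
      using assms(4)[OF x] unfolding exp_eq by blast
    then show ?thesis by (intro exI[of _ n]) simp
  qed
  have "(\<lambda>x. f x - g x) constant_on S"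
  proof (rule continuous_discrete_range_constant[OF assms(1)])
    show "continuous_on S (\<lambda>x. f x - g x)" by (intro continuous_intros assms)
    fix x assume x: "x \<in> S"
    show "\<exists>e>0. \<forall>y. y \<in> S \<and> f y - g y \<noteq> f x - g x \<longrightarrow> e \<le> cmod ((f y - g y) - (f x - g x))"
    proof (intro exI[of _ "2 * pi"] conjI allI impI)
      fix y assume y: "y \<in> S \<and> f y - g y \<noteq> f x - g x"
      obtain n m :: int where n: "f x - g x = of_int n * (2 * pi * \<i>)" and m: "f y - g y = of_int m * (2 * pi * \<i>)"
        using multiple x y by blast
      have "(f y - g y) - (f x - g x) = of_int (m - n) * (2 * pi * \<i>)" by (simp add: n m algebra_simps)
      then have "cmod ((f y - g y) - (f x - g x)) = \<bar>of_int (m - n)\<bar> * (2 * pi)"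
        by (simp only: norm_mult norm_of_int) (simp add: norm_mult)
      moreover have "1 \<le> \<bar>m - n\<bar>" using y n m by auto
      then have "1 \<le> \<bar>real_of_int (m - n)\<bar>" by (metis of_int_1_le_iff of_int_abs)
      ultimately show "2 * pi \<le> cmod ((f y - g y) - (f x - g x))" by simp
    qed simp
  qed
  then obtain c where "\<forall>x\<in>S. f x - g x = c" unfolding constant_on_def by blast
  then have "f x - g x = f y - g y" using xy by simp
  then show ?thesis by algebra
qed

lemma real_linear_polar:
  fixes f :: "complex \<Rightarrow> real"
  assumes "linear f"
  shows "f (e * cis x) = cos x * f e + sin x * f (\<i> * e)"
proof -
  have "e * cis x = cos x *\<^sub>R e + sin x *\<^sub>R (\<i> * e)" by (simp add: complex_eq_iff algebra_simps)
  then show ?thesis by (simp only: linear_add[OF assms] linear_scale[OF assms] real_scaleR_def)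
qed

lemma real_linear_nonzero:
  fixes f :: "complex \<Rightarrow> real"
  assumes f: "linear f" and "e \<noteq> 0" "f e = 0" "f w \<noteq> 0"
  shows "f (\<i> * e) \<noteq> 0"
proof
  assume 0: "f (\<i> * e) = 0"
  have "w = (w / e) * e" using assms(2) by simp
  also have "\<dots> = Re (w / e) *\<^sub>R e + Im (w / e) *\<^sub>R (\<i> * e)"
    by (subst complex_eq[of "w / e"]) (simp add: scaleR_conv_of_real algebra_simps)
  finally have "f w = Re (w / e) * f e + Im (w / e) * f (\<i> * e)"
    by (metis linear_add[OF f] linear_scale[OF f] real_scaleR_def)
  then show False using assms(3,4) 0 by simp
qed

lemma linear_snd_part:
  fixes f :: "C2 \<Rightarrow> real"
  assumes "linear f"
  shows "linear (\<lambda>w. f (0, w))"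
proof (rule linearI)
  fix x y :: complex and r :: real
  have "(0::complex, x + y) = (0, x) + (0, y)" "(0::complex, r *\<^sub>R x) = r *\<^sub>R (0, x)" by simp_all
  then show "f (0, x + y) = f (0, x) + f (0, y)" "f (0, r *\<^sub>R x) = r *\<^sub>R f (0, x)"
    by (simp_all only: linear_add[OF assms] linear_scale[OF assms])
qed

text \<open>
  With the midpoint \<open>a\<close> and half the difference \<open>b\<close>, the chord has length \<open>2 sin b\<close>, and the sine
  increases by \<open>2 cos a sin b\<close>.
\<close>

lemma sine_difference_bound:
  assumes \<delta>: "\<delta> < pi / 2" and xy: "-\<delta> \<le> x" "x < y" "y \<le> \<delta>"
  shows "cos \<delta> * cmod (cis y - cis x) \<le> sin y - sin x" "0 < cmod (cis y - cis x)"
proof -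
  define a where "a = (y + x) / 2"
  define b where "b = (y - x) / 2"
  have ab: "y = a + b" "x = a - b" by (simp_all add: a_def b_def field_simps)
  have b: "0 < b" "b < pi" using xy \<delta> by (auto simp: b_def)
  have sb: "sin b > 0" using b by (rule sin_gt_zero)
  have abs_a: "\<bar>a\<bar> \<le> \<delta>" using xy by (auto simp: a_def abs_le_iff)
  have "cos \<delta> \<le> cos \<bar>a\<bar>" using abs_a \<delta> by (intro cos_monotone_0_pi_le) auto
  then have ca: "cos \<delta> \<le> cos a" by simp
  have "cis y - cis x = cis a * (2 * \<i> * of_real (sin b))"
    by (simp add: ab complex_eq_iff cos_add cos_diff sin_add sin_diff)
  then have n: "cmod (cis y - cis x) = 2 * sin b" using sb by (simp add: norm_mult)
  have s: "sin y - sin x = cos a * (2 * sin b)" by (simp add: ab sin_add sin_diff)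
  show "cos \<delta> * cmod (cis y - cis x) \<le> sin y - sin x" unfolding n s using ca sb by (intro mult_right_mono) auto
  show "0 < cmod (cis y - cis x)" using n sb by simp
qed

context framed_hopf_surface
begin

text \<open>
  In a boundary chart \<open>k\<close> is negative at a point pushed off the circle in an outward direction, and the
  surface lies in \<open>k \<ge> 0\<close>.
\<close>

lemma outward_push_misses_surface:
  assumes inward: "\<forall>t\<in>{0..2 * pi}. contingent \<Sigma> (\<gamma> t, 0) (Z t)"
  shows "\<exists>d>0. \<forall>t\<in>{0..2 * pi}. \<forall>\<epsilon>. 0 < \<epsilon> \<and> \<epsilon> < d \<longrightarrow> \<epsilon> * norm (snd (Z t)) < 1 \<and>
    (of_real (sqrt (1 - (norm (- \<epsilon> *\<^sub>R snd (Z t)))\<^sup>2)) * \<gamma> t, - \<epsilon> *\<^sub>R snd (Z t)) \<notin> \<Sigma>"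
proof (rule locally_uniform_imp_uniform)
  show "compact {0..2 * pi}" by simp
  fix t0 assume t0: "t0 \<in> {0..2 * pi}"
  obtain W h k where c: "boundary_chart hopf_circle \<Sigma> (\<gamma> t0, 0) W h k"
    using boundary_chart_exists[OF seifert \<gamma>_in(1)] .
  then have W: "open W" "(\<gamma> t0, 0) \<in> W" "smooth_on W k" and \<Sigma>W: "\<Sigma> \<inter> W = {q \<in> S3 \<inter> W. h q = 0 \<and> k q \<ge> 0}"
    and KW: "hopf_circle \<inter> W = {q \<in> S3 \<inter> W. h q = 0 \<and> k q = 0}"
    unfolding boundary_chart_def by simp_all
  define f where "f = (\<lambda>w. D k (\<gamma> t0, 0) (0, w))"
  have f: "linear f" unfolding f_def by (intro linear_snd_part tangent_space_linear(1)[OF W])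
  define A where "A = f (snd (Z t0))"
  have "D k (\<gamma> t0, 0) (Z t0) \<ge> 0" using inward t0 W(2) \<gamma>_in(1) by (intro chart_nonneg[OF c]) blast+
  then have A: "A > 0" using chart_Z(2,4)[OF c t0] by (simp add: A_def f_def)
  have contZ2: "continuous_on {0..2 * pi} (\<lambda>t. snd (Z t))" by (intro continuous_intros cont_Z)
  have "bounded ((\<lambda>t. snd (Z t)) ` {0..2 * pi})"
    by (intro compact_imp_bounded compact_continuous_image contZ2) simp
  then obtain B where B: "B > 0" "\<And>t. t \<in> {0..2 * pi} \<Longrightarrow> norm (snd (Z t)) \<le> B"
    unfolding bounded_pos by blast
  have "A / (4 * B) > 0" using A B by simp
  then obtain r1 where r1: "0 < r1" "r1 < 1" "\<And>u w. norm u = 1 \<Longrightarrow> dist u (\<gamma> t0) < r1 \<Longrightarrow> norm w < r1 \<Longrightarrow>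
      \<bar>k (of_real (sqrt (1 - (norm w)\<^sup>2)) * u, w) - k (u, 0) - D k (\<gamma> t0, 0) (0, w)\<bar> \<le> A / (4 * B) * norm w"
    by (rule polar_taylor[OF tangent_space_linear(2)[OF W]]) (rule that)
  obtain r2 where r2: "0 < r2" "r2 < 1" "\<And>u w. norm u = 1 \<Longrightarrow> dist u (\<gamma> t0) < r2 \<Longrightarrow> norm w < r2 \<Longrightarrow>
      (of_real (sqrt (1 - (norm w)\<^sup>2)) * u, w) \<in> W"
    by (rule polar_in_open[OF W(1,2)]) (rule that)
  define r where "r = min r1 r2"
  have r: "r > 0" "r < 1" using r1 r2 by (auto simp: r_def)
  have "continuous_on {0..2 * pi} (\<lambda>t. f (snd (Z t)))"
    by (rule continuous_on_compose2[OF linear_continuous_on[OF linear_conv_bounded_linear[THEN iffD1, OF f], of UNIV] contZ2]) simp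
  then obtain d1 where d1: "d1 > 0" "\<And>t. t \<in> {0..2 * pi} \<Longrightarrow> dist t t0 < d1 \<Longrightarrow> dist (f (snd (Z t))) A < A / 2"
    using t0 A half_gt_zero[OF A] unfolding continuous_on_iff A_def by blast
  obtain d2 where d2: "d2 > 0" "\<And>t. t \<in> {0..2 * pi} \<Longrightarrow> dist t t0 < d2 \<Longrightarrow> dist (\<gamma> t) (\<gamma> t0) < r"
    using cont_\<gamma> t0 r(1) unfolding continuous_on_iff by blast
  define d where "d = min (min d1 d2) (r / B)"
  have d: "d > 0" using d1 d2 r B by (simp add: d_def)
  show "\<exists>d>0. \<forall>t\<in>{0..2 * pi} \<inter> ball t0 d. \<forall>\<epsilon>. 0 < \<epsilon> \<and> \<epsilon> < d \<longrightarrow> \<epsilon> * norm (snd (Z t)) < 1 \<and>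
    (of_real (sqrt (1 - (norm (- \<epsilon> *\<^sub>R snd (Z t)))\<^sup>2)) * \<gamma> t, - \<epsilon> *\<^sub>R snd (Z t)) \<notin> \<Sigma>"
  proof (intro exI[of _ d] conjI ballI allI impI d)
    fix t \<epsilon> assume t: "t \<in> {0..2 * pi} \<inter> ball t0 d" and \<epsilon>: "0 < \<epsilon> \<and> \<epsilon> < d"
    then have tI: "t \<in> {0..2 * pi}" "dist t t0 < d1" "dist t t0 < d2" by (auto simp: d_def dist_commute)
    define w where "w = - \<epsilon> *\<^sub>R snd (Z t)"
    have nw: "norm w = \<epsilon> * norm (snd (Z t))" using \<epsilon> by (simp add: w_def)
    have "\<epsilon> * norm (snd (Z t)) \<le> \<epsilon> * B" using B(2)[OF tI(1)] \<epsilon> by (intro mult_left_mono) auto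
    also have "\<dots> < (r / B) * B" using \<epsilon> B(1) by (intro mult_strict_right_mono) (auto simp: d_def)
    also have "\<dots> = r" using B(1) by simp
    finally have nwr: "\<epsilon> * norm (snd (Z t)) < r" .
    then show "\<epsilon> * norm (snd (Z t)) < 1" using r(2) by simp
    have near: "dist (\<gamma> t) (\<gamma> t0) < r1" "dist (\<gamma> t) (\<gamma> t0) < r2" "norm w < r1" "norm w < r2"
      using d2(2)[OF tI(1,3)] nwr nw by (auto simp: r_def)
    have "(\<gamma> t, 0) \<in> W" using r2(3)[OF norm_\<gamma> near(2), of 0] r2(1) by simp
    then have k0: "k (\<gamma> t, 0) = 0" using \<gamma>_in(1) KW by blast
    let ?p = "(of_real (sqrt (1 - (norm w)\<^sup>2)) * \<gamma> t, w)"
    have "f w = - \<epsilon> * f (snd (Z t))" by (simp add: w_def linear_scale[OF f] linear_neg[OF f])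
    moreover have "f (snd (Z t)) > A / 2" using d1(2)[OF tI(1,2)] unfolding dist_real_def by linarith
    then have "\<epsilon> * (A / 2) < \<epsilon> * f (snd (Z t))" using \<epsilon> by (intro mult_strict_left_mono) auto
    moreover have "A / (4 * B) * norm w \<le> A / (4 * B) * (\<epsilon> * B)"
      unfolding nw by (rule mult_left_mono[OF \<open>\<epsilon> * norm (snd (Z t)) \<le> \<epsilon> * B\<close>]) (use A B(1) in simp)
    moreover have "A / (4 * B) * (\<epsilon> * B) = \<epsilon> * (A / 4)" using B(1) by simp
    moreover have "\<bar>k ?p - f w\<bar> \<le> A / (4 * B) * norm w"
      using r1(3)[OF norm_\<gamma> near(1,3)] k0 by (simp add: f_def)
    moreover have "\<epsilon> * (A / 4) < \<epsilon> * (A / 2)" using \<epsilon> A by simp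
    ultimately have "k ?p < 0" by linarith
    moreover have "?p \<in> \<Sigma> \<Longrightarrow> k ?p \<ge> 0" using r2(3)[OF norm_\<gamma> near(2,4)] \<Sigma>W by blast
    ultimately have "?p \<notin> \<Sigma>" by force
    then show "(of_real (sqrt (1 - (norm (- \<epsilon> *\<^sub>R snd (Z t)))\<^sup>2)) * \<gamma> t, - \<epsilon> *\<^sub>R snd (Z t)) \<notin> \<Sigma>"
      unfolding w_def .
  qed
qed

text \<open>
  Let \<open>m\<close> run around a small meridian circle, with the angle \<open>x\<close> measured from the direction of the
  framing.  To first order in the radius \<open>\<epsilon>\<close>, the function \<open>h\<close> of a chart is \<open>\<epsilon> sin x\<close> up to a nonzero
  constant, and \<open>k\<close> is positive at \<open>x = 0\<close> and negative at \<open>x = \<pi>\<close>.  So the meridian can meet the surface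
  only near \<open>x = 0\<close>; there \<open>s\<close> is strictly monotone in \<open>x\<close>, hence has a single zero, which lies on the
  surface.
\<close>

lemma meridian_crosses_once:
  fixes s :: "C2 \<Rightarrow> real"
  assumes inward: "contingent \<Sigma> (\<gamma> 0, 0) (Z 0)"
    and s: "strict_deriv s s' (\<gamma> 0, 0)" "\<exists>v\<in>tangent_S3 (\<gamma> 0, 0). s' v \<noteq> 0" "\<forall>v\<in>tangent_space \<Sigma> (\<gamma> 0, 0). s' v = 0"
    and s0: "\<And>x. x \<in> \<Sigma> \<Longrightarrow> s x = 0"
    and e0: "norm e0 = 1" "snd (Z 0) = of_real \<rho> * e0" "\<rho> > 0"
  obtains \<delta> \<epsilon>0 \<sigma> where "0 < \<delta>" "\<delta> < pi / 2" "0 < \<epsilon>0" "\<epsilon>0 < 1" "\<sigma> \<noteq> 0"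
    "\<And>\<epsilon> x m. 0 < \<epsilon> \<Longrightarrow> \<epsilon> < \<epsilon>0 \<Longrightarrow> m = (\<lambda>x. (of_real (sqrt (1 - \<epsilon>\<^sup>2)) * \<gamma> 0, of_real \<epsilon> * (e0 * cis x))) \<Longrightarrow>
       (\<forall>x\<in>{\<delta>..2 * pi - \<delta>}. m x \<notin> \<Sigma>) \<and> (\<forall>x\<in>{-\<delta>..\<delta>}. s (m x) = 0 \<longrightarrow> m x \<in> \<Sigma>) \<and>
       \<sigma> * s (m \<delta>) > 0 \<and> \<sigma> * s (m (-\<delta>)) < (0::real)"
proof -
  have t0: "0 \<in> {0..2 * pi}" by simp
  obtain W h k where c: "boundary_chart hopf_circle \<Sigma> (\<gamma> 0, 0) W h k"
    using boundary_chart_exists[OF seifert \<gamma>_in(1)] .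
  then have W: "open W" "(\<gamma> 0, 0) \<in> W" "smooth_on W h" "smooth_on W k"
    and \<Sigma>W: "\<Sigma> \<inter> W = {q \<in> S3 \<inter> W. h q = 0 \<and> k q \<ge> 0}"
    and KW: "hopf_circle \<inter> W = {q \<in> S3 \<inter> W. h q = 0 \<and> k q = 0}"
    and surj: "\<And>x y. \<exists>v\<in>tangent_S3 (\<gamma> 0, 0). D h (\<gamma> 0, 0) v = x \<and> D k (\<gamma> 0, 0) v = y"
    unfolding boundary_chart_def by simp_all
  have hk0: "h (\<gamma> 0, 0) = 0" "k (\<gamma> 0, 0) = 0" using KW W(2) \<gamma>_in(1) by blast+
  define H where "H = (\<lambda>w. D h (\<gamma> 0, 0) (0, w))"
  define K where "K = (\<lambda>w. D k (\<gamma> 0, 0) (0, w))"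
  define S where "S = (\<lambda>w. s' (0, w))"
  have lin_s': "linear s'" using strict_deriv_linear[OF s(1)] bounded_linear.linear by blast
  have lin: "linear H" "linear K" "linear S"
    unfolding H_def K_def S_def by (intro linear_snd_part tangent_space_linear(1)[OF W(1,2)] W lin_s')+
  have e0': "e0 \<noteq> 0" using e0(1) by auto
  have Ze0: "snd (Z 0) = \<rho> *\<^sub>R e0" using e0(2) by (simp add: scaleR_conv_of_real)
  have He0: "H e0 = 0"
    using chart_Z(3)[OF c t0] linear_scale[OF lin(1), of \<rho> e0] e0(3) by (simp add: H_def Ze0)
  have "D k (\<gamma> 0, 0) (Z 0) \<ge> 0" using inward W(2) \<gamma>_in(1) by (intro chart_nonneg[OF c]) blast+
  then have "K (snd (Z 0)) > 0" using chart_Z(2,4)[OF c t0] by (simp add: K_def)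
  then have Ke0: "K e0 > 0" using e0(3) linear_scale[OF lin(2), of \<rho> e0] by (simp add: Ze0 zero_less_mult_iff)
  have s'v: "s' v = S (snd v)" if v: "v \<in> tangent_S3 (\<gamma> 0, 0)" for v
  proof -
    have "(\<i> * \<gamma> 0, 0) \<in> tangent_space \<Sigma> (\<gamma> 0, 0)"
      using contingent_tangent_space[OF contingent_mono[OF contingent_hopf_circle[OF norm_\<gamma>] circle_surface] \<gamma>_in(2)] .
    then have 0: "s' (\<i> * \<gamma> 0, 0) = 0" using s(3) by blast
    define r where "r = Im (cnj (\<gamma> 0) * fst v)"
    have "\<gamma> 0 \<bullet> fst v = 0" using v by (simp add: tangent_S3_def inner_prod_def)
    then have fv: "fst v = (\<i> * \<gamma> 0) * of_real r" unfolding r_def using orthogonal_on_circle norm_\<gamma> by blast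
    have "v = r *\<^sub>R (\<i> * \<gamma> 0, 0) + (0, snd v)"
      by (rule prod_eqI) (simp_all add: fv scaleR_conv_of_real mult.commute)
    then have "s' v = r * s' (\<i> * \<gamma> 0, 0) + s' (0, snd v)"
      by (metis linear_add[OF lin_s'] linear_scale[OF lin_s'] real_scaleR_def)
    then show ?thesis using 0 by (simp add: S_def)
  qed
  have "S (snd (Z 0)) = 0" using s'v[OF Z_tangent_S3[OF t0]] s(3) tangent_Z[OF t0] by simp
  then have Se0: "S e0 = 0" using e0(3) linear_scale[OF lin(3), of \<rho> e0] by (simp add: Ze0)
  define \<sigma> where "\<sigma> = S (\<i> * e0)"
  define \<theta> where "\<theta> = H (\<i> * e0)"
  define \<kappa> where "\<kappa> = K (\<i> * e0)"
  have \<sigma>: "\<sigma> \<noteq> 0"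
  proof -
    obtain v where "v \<in> tangent_S3 (\<gamma> 0, 0)" "s' v \<noteq> 0" using s(2) by blast
    then have "S (snd v) \<noteq> 0" using s'v by simp
    then show ?thesis unfolding \<sigma>_def by (intro real_linear_nonzero[OF lin(3) e0' Se0])
  qed
  have \<theta>: "\<theta> \<noteq> 0"
  proof -
    obtain v where v: "v \<in> tangent_S3 (\<gamma> 0, 0)" "D h (\<gamma> 0, 0) v = 1" using surj by blast
    then have "H (snd v) \<noteq> 0" using boundary_chart_hopf(1)[OF c norm_\<gamma> v(1)] by (simp add: H_def)
    then show ?thesis unfolding \<theta>_def by (intro real_linear_nonzero[OF lin(1) e0' He0])
  qed
  have pol: "H (e0 * cis x) = sin x * \<theta>" "S (e0 * cis x) = sin x * \<sigma>" "K (e0 * cis x) = cos x * K e0 + sin x * \<kappa>" for x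
    using real_linear_polar[OF lin(1)] real_linear_polar[OF lin(2)] real_linear_polar[OF lin(3)] He0 Se0
    by (simp_all add: \<sigma>_def \<theta>_def \<kappa>_def)
  have "isCont (\<lambda>x. cos x * K e0 + sin x * \<kappa>) 0" by (intro continuous_intros)
  then obtain d where d: "d > 0" "\<And>x. dist x 0 < d \<Longrightarrow> dist (cos x * K e0 + sin x * \<kappa>) (K e0) < K e0 / 2"
    unfolding continuous_at_eps_delta using half_gt_zero[OF Ke0] by fastforce
  define \<delta> where "\<delta> = min (d / 2) (pi / 4)"
  have \<delta>: "0 < \<delta>" "\<delta> < pi / 2" "\<delta> < d" using d(1) pi_gt_zero by (auto simp: \<delta>_def min_def)
  have Kpos: "K (e0 * cis x) > K e0 / 2" if "x \<in> {-\<delta>..\<delta>}" for x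
  proof -
    have "dist x 0 < d" using that \<delta>(3) by (auto simp: dist_real_def)
    then show ?thesis using d(2)[of x] unfolding pol dist_real_def by linarith
  qed
  \<comment> \<open>On the rest of the meridian one of the two conditions that define the surface fails to first order:
    either \<open>h\<close> is not zero, or \<open>k\<close> is negative.\<close>
  define \<psi> where "\<psi> = (\<lambda>x. max \<bar>sin x * \<theta>\<bar> (- (cos x * K e0 + sin x * \<kappa>)))"
  have "compact {\<delta>..2 * pi - \<delta>}" "{\<delta>..2 * pi - \<delta>} \<noteq> {}" using \<delta> pi_gt_zero by auto
  moreover have "continuous_on {\<delta>..2 * pi - \<delta>} \<psi>" unfolding \<psi>_def by (intro continuous_intros)
  ultimately obtain x0 where x0: "x0 \<in> {\<delta>..2 * pi - \<delta>}" "\<And>x. x \<in> {\<delta>..2 * pi - \<delta>} \<Longrightarrow> \<psi> x0 \<le> \<psi> x"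
    using continuous_attains_inf by metis
  have "\<psi> x0 > 0"
  proof (cases "sin x0 = 0")
    case True
    have "0 < x0" "x0 < 2 * pi" using x0(1) \<delta>(1) by auto
    then have "x0 = pi" using True sin_gt_zero[of x0] sin_lt_zero[of x0] by fastforce
    then show ?thesis using Ke0 by (simp add: \<psi>_def)
  next
    case False
    then have "0 < \<bar>sin x0 * \<theta>\<bar>" using \<theta> by simp
    then show ?thesis unfolding \<psi>_def by linarith
  qed
  define c0 where "c0 = \<psi> x0"
  have c0: "c0 > 0" "\<And>x. x \<in> {\<delta>..2 * pi - \<delta>} \<Longrightarrow> c0 \<le> \<bar>H (e0 * cis x)\<bar> \<or> c0 \<le> - K (e0 * cis x)"
    using \<open>\<psi> x0 > 0\<close> x0(2) unfolding c0_def pol \<psi>_def by (auto simp: le_max_iff_disj)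
  have sin\<delta>: "sin \<delta> > 0" "cos \<delta> > 0" using \<delta> by (auto intro!: sin_gt_zero cos_gt_zero)
  define \<eta> where "\<eta> = min (c0 / 2) (min (K e0 / 4) (\<bar>\<theta>\<bar> * sin \<delta> / 2))"
  have \<eta>: "\<eta> > 0" using c0 Ke0 \<theta> sin\<delta> by (auto simp: \<eta>_def)
  obtain r1 where r1: "0 < r1" "r1 < 1" "\<And>u w. norm u = 1 \<Longrightarrow> dist u (\<gamma> 0) < r1 \<Longrightarrow> norm w < r1 \<Longrightarrow>
      \<bar>h (of_real (sqrt (1 - (norm w)\<^sup>2)) * u, w) - h (u, 0) - D h (\<gamma> 0, 0) (0, w)\<bar> \<le> \<eta> * norm w"
    by (rule polar_taylor[OF tangent_space_linear(2)[OF W(1,2,3)] \<eta>]) (rule that)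
  obtain r2 where r2: "0 < r2" "r2 < 1" "\<And>u w. norm u = 1 \<Longrightarrow> dist u (\<gamma> 0) < r2 \<Longrightarrow> norm w < r2 \<Longrightarrow>
      \<bar>k (of_real (sqrt (1 - (norm w)\<^sup>2)) * u, w) - k (u, 0) - D k (\<gamma> 0, 0) (0, w)\<bar> \<le> \<eta> * norm w"
    by (rule polar_taylor[OF tangent_space_linear(2)[OF W(1,2,4)] \<eta>]) (rule that)
  obtain r3 where r3: "0 < r3" "r3 < 1" "\<And>u w. norm u = 1 \<Longrightarrow> dist u (\<gamma> 0) < r3 \<Longrightarrow> norm w < r3 \<Longrightarrow>
      (of_real (sqrt (1 - (norm w)\<^sup>2)) * u, w) \<in> W"
    by (rule polar_in_open[OF W(1,2)]) (rule that)
  have "\<bar>\<sigma>\<bar> * cos \<delta> / 2 > 0" using \<sigma> sin\<delta>(2) by simp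
  then obtain r4 where r4: "r4 > 0" "\<And>x y. x \<in> ball (\<gamma> 0, 0) r4 \<Longrightarrow> y \<in> ball (\<gamma> 0, 0) r4 \<Longrightarrow>
      norm (s x - s y - s' (x - y)) \<le> \<bar>\<sigma>\<bar> * cos \<delta> / 2 * norm (x - y)"
    by (rule strict_derivD[OF s(1)]) (rule that)
  have ball4: "(\<gamma> 0, 0) \<in> ball (\<gamma> 0, 0 :: complex) r4" using r4(1) by simp
  obtain r5 where r5: "0 < r5" "r5 < 1" "\<And>u w :: complex. norm u = 1 \<Longrightarrow> dist u (\<gamma> 0) < r5 \<Longrightarrow> norm w < r5 \<Longrightarrow>
      (of_real (sqrt (1 - (norm w)\<^sup>2)) * u, w) \<in> ball (\<gamma> 0, 0) r4"
    by (rule polar_in_open[OF open_ball ball4]) (rule that)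
  define \<epsilon>0 where "\<epsilon>0 = min (min r1 r2) (min r3 r5)"
  show ?thesis
  proof (rule that[OF \<delta>(1,2) _ _ \<sigma>, of \<epsilon>0])
    show "0 < \<epsilon>0" "\<epsilon>0 < 1" using r1 r2 r3 r5 by (auto simp: \<epsilon>0_def)
    fix \<epsilon> x and m :: "real \<Rightarrow> C2"
    assume \<epsilon>: "0 < \<epsilon>" "\<epsilon> < \<epsilon>0" and m: "m = (\<lambda>x. (of_real (sqrt (1 - \<epsilon>\<^sup>2)) * \<gamma> 0, of_real \<epsilon> * (e0 * cis x)))"
    have \<epsilon>r: "\<epsilon> < r1" "\<epsilon> < r2" "\<epsilon> < r3" "\<epsilon> < r5" using \<epsilon> by (auto simp: \<epsilon>0_def)
    have nw: "norm (of_real \<epsilon> * (e0 * cis x)) = \<epsilon>" for x using \<epsilon> e0(1) by (simp add: norm_mult)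
    have scal: "of_real \<epsilon> * (e0 * cis x) = \<epsilon> *\<^sub>R (e0 * cis x)" for x by (simp add: scaleR_conv_of_real)
    have hm: "\<bar>h (m x) - \<epsilon> * H (e0 * cis x)\<bar> \<le> \<eta> * \<epsilon>" for x
      using r1(3)[OF norm_\<gamma>, of 0 "of_real \<epsilon> * (e0 * cis x)"] r1(1) \<epsilon>r(1) hk0(1) linear_scale[OF lin(1), of \<epsilon> "e0 * cis x"]
      unfolding nw m by (simp add: H_def scal)
    have km: "\<bar>k (m x) - \<epsilon> * K (e0 * cis x)\<bar> \<le> \<eta> * \<epsilon>" for x
      using r2(3)[OF norm_\<gamma>, of 0 "of_real \<epsilon> * (e0 * cis x)"] r2(1) \<epsilon>r(2) hk0(2) linear_scale[OF lin(2), of \<epsilon> "e0 * cis x"]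
      unfolding nw m by (simp add: K_def scal)
    have mW: "m x \<in> W" for x
      using r3(3)[OF norm_\<gamma>, of 0 "of_real \<epsilon> * (e0 * cis x)"] r3(1) \<epsilon>r(3) unfolding nw m by simp
    have mr4: "m x \<in> ball (\<gamma> 0, 0) r4" for x
      using r5(3)[OF norm_\<gamma>, of 0 "of_real \<epsilon> * (e0 * cis x)"] r5(1) \<epsilon>r(4) unfolding nw m by simp
    have mS3: "m x \<in> S3" for x
      using polar_in_S3[OF norm_\<gamma>, of "of_real \<epsilon> * (e0 * cis x)" 0] \<epsilon>r(1) r1(2) unfolding nw m by simp
    have \<eta>\<epsilon>: "\<eta> * \<epsilon> \<le> \<epsilon> * (c0 / 2)" "\<eta> * \<epsilon> \<le> \<epsilon> * (K e0 / 4)" "\<eta> * \<epsilon> \<le> \<epsilon> * (\<bar>\<theta>\<bar> * sin \<delta> / 2)"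
      using \<epsilon>(1) by (auto simp: \<eta>_def mult.commute[of _ \<epsilon>] intro!: mult_left_mono)
    have a: "m x \<notin> \<Sigma>" if x: "x \<in> {\<delta>..2 * pi - \<delta>}" for x
    proof
      assume "m x \<in> \<Sigma>"
      then have hk: "h (m x) = 0" "k (m x) \<ge> 0" using \<Sigma>W mW by blast+
      have cp: "\<epsilon> * c0 > 0" "\<epsilon> * (c0 / 2) = \<epsilon> * c0 / 2" using \<epsilon> c0 by auto
      show False using c0(2)[OF x]
      proof
        assume "c0 \<le> \<bar>H (e0 * cis x)\<bar>"
        then have "\<epsilon> * c0 \<le> \<bar>\<epsilon> * H (e0 * cis x)\<bar>" using \<epsilon>(1) by (simp add: abs_mult)
        then show False using hm[of x] hk(1) \<eta>\<epsilon>(1) cp by linarith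
      next
        assume "c0 \<le> - K (e0 * cis x)"
        then have "\<epsilon> * c0 \<le> \<epsilon> * (- K (e0 * cis x))" using \<epsilon>(1) by (intro mult_left_mono) auto
        then have "\<epsilon> * c0 \<le> - (\<epsilon> * K (e0 * cis x))" by simp
        then show False using km[of x] hk(2) \<eta>\<epsilon>(1) cp by linarith
      qed
    qed
    have kpos: "k (m x) > 0" if x: "x \<in> {-\<delta>..\<delta>}" for x
    proof -
      have "\<epsilon> * (K e0 / 2) < \<epsilon> * K (e0 * cis x)" using Kpos[OF x] \<epsilon>(1) by (intro mult_strict_left_mono)
      moreover have "\<epsilon> * (K e0 / 2) = 2 * (\<epsilon> * (K e0 / 4))" by simp
      moreover have "0 < \<epsilon> * (K e0 / 4)" using \<epsilon>(1) Ke0 by simp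
      ultimately show ?thesis using km[of x] \<eta>\<epsilon>(2) by linarith
    qed
    have in_surface: "m x \<in> \<Sigma>" if "x \<in> {-\<delta>..\<delta>}" "h (m x) = 0" for x
      using \<Sigma>W mW[of x] mS3[of x] kpos[OF that(1)] that(2) less_imp_le by blast
    define \<tau> where "\<tau> = sgn \<theta>"
    have ends: "\<tau> * h (m \<delta>) > 0" "\<tau> * h (m (-\<delta>)) < 0"
    proof -
      have "\<bar>\<tau> * h (m x) - \<epsilon> * (sin x * \<bar>\<theta>\<bar>)\<bar> \<le> \<epsilon> * (\<bar>\<theta>\<bar> * sin \<delta> / 2)" for x
      proof -
        have "\<tau> * h (m x) - \<epsilon> * (sin x * \<bar>\<theta>\<bar>) = \<tau> * (h (m x) - \<epsilon> * H (e0 * cis x))"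
          using \<theta> by (simp add: \<tau>_def pol sgn_if algebra_simps)
        then have "\<bar>\<tau> * h (m x) - \<epsilon> * (sin x * \<bar>\<theta>\<bar>)\<bar> = \<bar>h (m x) - \<epsilon> * H (e0 * cis x)\<bar>"
          using \<theta> by (simp add: \<tau>_def abs_mult abs_sgn_eq)
        then show ?thesis using hm[of x] \<eta>\<epsilon>(3) by linarith
      qed
      from this[of \<delta>] this[of "-\<delta>"]
      have "\<bar>\<tau> * h (m \<delta>) - \<epsilon> * (\<bar>\<theta>\<bar> * sin \<delta>)\<bar> \<le> \<epsilon> * (\<bar>\<theta>\<bar> * sin \<delta>) / 2"
        "\<bar>\<tau> * h (m (-\<delta>)) + \<epsilon> * (\<bar>\<theta>\<bar> * sin \<delta>)\<bar> \<le> \<epsilon> * (\<bar>\<theta>\<bar> * sin \<delta>) / 2"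
        by (simp_all add: mult.commute)
      moreover have "\<epsilon> * (\<bar>\<theta>\<bar> * sin \<delta>) > 0" using \<epsilon>(1) \<theta> sin\<delta> by simp
      ultimately show "\<tau> * h (m \<delta>) > 0" "\<tau> * h (m (-\<delta>)) < 0" by linarith+
    qed
    have "continuous_on {-\<delta>..\<delta>} (\<lambda>x. \<tau> * h (m x))"
    proof (intro continuous_intros)
      show "continuous_on {-\<delta>..\<delta>} (\<lambda>x. h (m x))"
      proof (rule continuous_on_compose2[OF smooth_on_continuous[OF W(3)]])
        show "continuous_on {-\<delta>..\<delta>} m" unfolding m by (intro continuous_intros)
      qed (use mW in blast)
    qed
    then obtain x1 where x1: "-\<delta> \<le> x1" "x1 \<le> \<delta>" "\<tau> * h (m x1) = 0"
      using IVT'[of "\<lambda>x. \<tau> * h (m x)" "-\<delta>" 0 \<delta>] ends \<delta>(1) by auto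
    have hx1: "h (m x1) = 0" using x1(3) \<theta> by (simp add: \<tau>_def sgn_0_0)
    have x1\<delta>: "x1 \<noteq> \<delta>" "x1 \<noteq> -\<delta>" using ends x1(3) by auto
    have mx1: "m x1 \<in> \<Sigma>" using in_surface[of x1] x1 hx1 by simp
    \<comment> \<open>The estimate for \<open>s\<close> between two points of the meridian is the reason for strict differentiability.\<close>
    have mono: "\<sigma> * s (m x) < \<sigma> * s (m y)" if xy: "-\<delta> \<le> x" "x < y" "y \<le> \<delta>" for x y
    proof -
      define g where "g = cmod (cis y - cis x)"
      note sd = sine_difference_bound[OF \<delta>(2) xy, folded g_def]
      have diff: "m y - m x = (0, \<epsilon> *\<^sub>R (e0 * (cis y - cis x)))"
        by (simp add: m scaleR_conv_of_real algebra_simps)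
      have "s' (m y - m x) = S (\<epsilon> *\<^sub>R (e0 * (cis y - cis x)))" unfolding diff S_def ..
      also have "\<dots> = \<epsilon> * S (e0 * cis y - e0 * cis x)"
        unfolding linear_scale[OF lin(3)] by (simp only: right_diff_distrib real_scaleR_def)
      also have "\<dots> = \<epsilon> * ((sin y - sin x) * \<sigma>)" by (simp add: linear_diff[OF lin(3)] pol algebra_simps)
      finally have s'd: "s' (m y - m x) = \<epsilon> * ((sin y - sin x) * \<sigma>)" .
      have nd: "norm (m y - m x) = \<epsilon> * g"
        unfolding diff g_def using \<epsilon>(1) e0(1) by (simp add: norm_mult norm_Pair)
      have "\<bar>s (m y) - s (m x) - \<epsilon> * ((sin y - sin x) * \<sigma>)\<bar> \<le> \<bar>\<sigma>\<bar> * cos \<delta> / 2 * (\<epsilon> * g)"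
        using r4(2)[OF mr4[of y] mr4[of x]] unfolding s'd nd by simp
      then have "\<bar>\<sigma>\<bar> * \<bar>s (m y) - s (m x) - \<epsilon> * ((sin y - sin x) * \<sigma>)\<bar> \<le> \<bar>\<sigma>\<bar> * (\<bar>\<sigma>\<bar> * cos \<delta> / 2 * (\<epsilon> * g))"
        by (intro mult_left_mono) auto
      then have "\<bar>\<sigma> * s (m y) - \<sigma> * s (m x) - \<sigma>\<^sup>2 * \<epsilon> * (sin y - sin x)\<bar> \<le> \<sigma>\<^sup>2 * \<epsilon> * (cos \<delta> * g) / 2"
      proof -
        have "\<bar>\<sigma>\<bar> * (\<bar>\<sigma>\<bar> * cos \<delta> / 2 * (\<epsilon> * g)) = \<bar>\<sigma>\<bar>\<^sup>2 * \<epsilon> * (cos \<delta> * g) / 2"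
          by (simp only: power2_eq_square) (simp add: mult.commute mult.left_commute)
        moreover have "\<sigma> * (s (m y) - s (m x) - \<epsilon> * ((sin y - sin x) * \<sigma>)) =
            \<sigma> * s (m y) - \<sigma> * s (m x) - \<sigma>\<^sup>2 * \<epsilon> * (sin y - sin x)"
          by (simp add: power2_eq_square algebra_simps)
        ultimately show ?thesis
          using \<open>\<bar>\<sigma>\<bar> * \<bar>s (m y) - s (m x) - \<epsilon> * ((sin y - sin x) * \<sigma>)\<bar> \<le> _\<close>
          unfolding abs_mult[symmetric] by (simp only: power2_abs)
      qed
      moreover have "\<sigma>\<^sup>2 * \<epsilon> * (cos \<delta> * g) \<le> \<sigma>\<^sup>2 * \<epsilon> * (sin y - sin x)"
        using sd(1) \<epsilon>(1) by (intro mult_left_mono) auto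
      moreover have "\<sigma>\<^sup>2 * \<epsilon> * (cos \<delta> * g) > 0" using \<sigma> \<epsilon>(1) sin\<delta>(2) sd(2) by simp
      ultimately show ?thesis by linarith
    qed
    have sx1: "s (m x1) = 0" using s0[OF mx1] .
    show "(\<forall>x\<in>{\<delta>..2 * pi - \<delta>}. m x \<notin> \<Sigma>) \<and> (\<forall>x\<in>{-\<delta>..\<delta>}. s (m x) = 0 \<longrightarrow> m x \<in> \<Sigma>) \<and>
       \<sigma> * s (m \<delta>) > 0 \<and> \<sigma> * s (m (-\<delta>)) < 0"
    proof (intro conjI ballI impI)
      show "m x \<in> \<Sigma>" if x: "x \<in> {-\<delta>..\<delta>}" "s (m x) = 0" for x
      proof -
        have "x = x1"
          using mono[of x x1] mono[of x1 x] x x1 sx1 by (cases x x1 rule: linorder_cases) auto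
        then show ?thesis using mx1 by simp
      qed
      show "\<sigma> * s (m \<delta>) > 0" using mono[of x1 \<delta>] x1 x1\<delta> sx1 by simp
      show "\<sigma> * s (m (-\<delta>)) < 0" using mono[of "-\<delta>" x1] x1 x1\<delta> sx1 by simp
    qed (use a in blast)
  qed
qed

end

section \<open>The winding number of a Seifert framing\<close>

context framed_hopf_surface
begin

text \<open>
  The map to \<open>\<complex> - {0}\<close>, defined on the complement of the circle, that is dual to the surface: the surface
  is the preimage of the positive real axis.  The imaginary part is the defining function \<open>s\<close>.  The
  spurious zeros \<open>N\<close> of \<open>s\<close> form a closed subset of the complement, disjoint from the surface, and
  are sent to the negative real axis by comparing distances.  The circle is added to \<open>N\<close> because
  \<open>infdist\<close> from the empty set is zero.
\<close>

lemma seifert_circle_function: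
  fixes s :: "C2 \<Rightarrow> real"
  assumes cont_s: "continuous_on UNIV s" and s0: "\<And>x. x \<in> \<Sigma> \<Longrightarrow> s x = 0"
    and near: "\<And>q. q \<in> \<Sigma> \<Longrightarrow> q \<notin> hopf_circle \<Longrightarrow> \<exists>r>0. \<forall>p\<in>S3 \<inter> ball q r. s p = 0 \<longrightarrow> p \<in> \<Sigma>"
  obtains F where "continuous_on UNIV F" "\<And>p. Im (F p) = s p"
    "\<And>p. p \<in> \<Sigma> \<Longrightarrow> snd p \<noteq> 0 \<Longrightarrow> Re (F p) > 0"
    "\<And>p. p \<in> S3 - \<Sigma> \<Longrightarrow> snd p \<noteq> 0 \<Longrightarrow> s p = 0 \<Longrightarrow> Re (F p) < 0"
proof -
  define N where "N = {p \<in> S3. snd p \<noteq> 0 \<and> s p = 0} - \<Sigma>"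
  define F where "F = (\<lambda>p. complex_of_real (infdist p (N \<union> hopf_circle) - infdist p \<Sigma>) + \<i> * complex_of_real (s p))"
  have ne: "hopf_circle \<noteq> {}" "\<Sigma> \<noteq> {}" using \<gamma>_in by blast+
  have closed: "closed hopf_circle" "closed \<Sigma>"
    using compact_surface compact_imp_closed by (auto intro: closed_Times)
  show ?thesis
  proof (rule that[of F])
    show "continuous_on UNIV F"
      unfolding F_def by (intro continuous_intros continuous_on_infdist cont_s continuous_on_id)
    show "Im (F p) = s p" for p by (simp add: F_def)
    show "Re (F p) > 0" if p: "p \<in> \<Sigma>" "snd p \<noteq> 0" for p
    proof -
      have pK: "p \<notin> hopf_circle" using p(2) by (cases p) simp
      obtain r where r: "r > 0" "\<forall>x\<in>S3 \<inter> ball p r. s x = 0 \<longrightarrow> x \<in> \<Sigma>" using near[OF p(1) pK] by blast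
      have "ball p r \<inter> N = {}" using r(2) unfolding N_def by blast
      then have "p \<notin> closure N"
        using r(1) by (meson centre_in_ball disjoint_iff_not_equal open_Int_closure_eq_empty open_ball)
      then have "p \<notin> closure (N \<union> hopf_circle)" using pK closed(1) by (simp add: closure_closed)
      then have "infdist p (N \<union> hopf_circle) \<noteq> 0" using ne(1) in_closure_iff_infdist_zero[of "N \<union> hopf_circle" p] by blast
      then have "infdist p (N \<union> hopf_circle) > 0" using infdist_nonneg[of p "N \<union> hopf_circle"] by simp
      then show ?thesis using p(1) by (simp add: F_def)
    qed
    show "Re (F p) < 0" if p: "p \<in> S3 - \<Sigma>" "snd p \<noteq> 0" "s p = 0" for p
    proof -
      have "p \<in> N" using p by (simp add: N_def)
      then have "infdist p (N \<union> hopf_circle) = 0" by simp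
      moreover have "infdist p \<Sigma> > 0" using p(1) closed(2) ne(2) by (intro infdist_pos_not_in_closed) auto
      ultimately show ?thesis by (simp add: F_def)
    qed
  qed
qed

text \<open>
  The value is \<open>2 \<pi> \<i>\<close> or \<open>-2 \<pi> \<i>\<close>: passing from \<open>b\<close> to \<open>a\<close> across the positive real axis and back across
  the negative one is a full turn.
\<close>

lemma Ln_difference_half_turn:
  assumes "Im a * Im b < 0"
  shows "(Ln (- b) - Ln (- a)) + (Ln a - Ln b) \<noteq> 0"
proof (cases "Im a > 0")
  case True
  then have "Im b < 0" using assms by (simp add: zero_less_mult_iff mult_less_0_iff)
  then have "Ln (- a) = Ln a - \<i> * pi" "Ln (- b) = Ln b + \<i> * pi"
    using True by (subst Ln_minus; force)+
  then show ?thesis by simp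
next
  case False
  then have ab: "Im a < 0" "Im b > 0" using assms by (auto simp: mult_less_0_iff)
  then have "Ln (- a) = Ln a + \<i> * pi" "Ln (- b) = Ln b - \<i> * pi"
    by (subst Ln_minus; force)+
  then show ?thesis by simp
qed

text \<open>
  Let \<open>F\<close> be the map dual to the surface.  In the coordinates \<open>E\<close> the universal cover of the complement of
  the circle is \<open>ball 0 1 \<times> \<real>\<close>, which is contractible, so \<open>F\<close> has a logarithm \<open>g\<close> there, and \<open>g\<close> changes by
  a constant \<open>DD\<close> when the angle \<open>\<beta>\<close> increases by \<open>2 \<pi>\<close>.  The meridian crosses the surface exactly once,
  so \<open>DD\<close> is not zero.  Pushing the circle off the surface along \<open>- Z\<close> gives a loop whose angle
  increases by \<open>2 \<pi> n\<close>, where \<open>n\<close> is the winding number in question, so along it \<open>g\<close> changes by \<open>n * DD\<close>.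
  But \<open>F\<close> avoids the positive real axis on this loop, so \<open>g\<close> does not change at all.
\<close>

lemma winding_zero_inward:
  assumes inward: "\<forall>t\<in>{0..2 * pi}. contingent \<Sigma> (\<gamma> t, 0) (Z t)"
    and \<zeta>: "continuous_on {0..2 * pi} \<zeta>" "\<And>t. t \<in> {0..2 * pi} \<Longrightarrow> snd (Z t) = exp (\<zeta> t)"
    and loop: "\<gamma> (2 * pi) = \<gamma> 0" "Z (2 * pi) = Z 0"
  shows "\<zeta> (2 * pi) = \<zeta> 0"
proof -
  have I0: "0 \<in> {0..2 * pi}" "2 * pi \<in> {0..2 * pi}" by simp_all
  obtain s :: "C2 \<Rightarrow> real" where s: "continuous_on UNIV s" "\<And>x. x \<in> \<Sigma> \<Longrightarrow> s x = 0"
    "\<And>x. x \<in> \<Sigma> \<Longrightarrow> \<exists>s'. strict_deriv s s' x \<and> (\<exists>v\<in>tangent_S3 x. s' v \<noteq> 0) \<and> (\<forall>v\<in>tangent_space \<Sigma> x. s' v = 0)"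
    by (rule seifert_defining_function[OF seifert]) (rule that)
  have near: "\<exists>r>0. \<forall>p\<in>S3 \<inter> ball q r. s p = 0 \<longrightarrow> p \<in> \<Sigma>" if q: "q \<in> \<Sigma>" "q \<notin> hopf_circle" for q
  proof -
    obtain s' where s': "strict_deriv s s' q" "\<exists>v\<in>tangent_S3 q. s' v \<noteq> 0" "\<forall>v\<in>tangent_space \<Sigma> q. s' v = 0"
      using s(3)[OF q(1)] by blast
    show ?thesis by (rule seifert_zero_set_near_interior[OF seifert q s' s(2)])
  qed
  obtain F where F: "continuous_on UNIV F" "\<And>p. Im (F p) = s p"
    "\<And>p. p \<in> \<Sigma> \<Longrightarrow> snd p \<noteq> 0 \<Longrightarrow> Re (F p) > 0"
    "\<And>p. p \<in> S3 - \<Sigma> \<Longrightarrow> snd p \<noteq> 0 \<Longrightarrow> s p = 0 \<Longrightarrow> Re (F p) < 0"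
    by (rule seifert_circle_function[OF s(1,2) near]) (assumption+, rule that)
  have F_off: "- F p \<notin> \<real>\<^sub>\<le>\<^sub>0" if "p \<in> S3" "p \<notin> \<Sigma>" "snd p \<noteq> 0" for p
    using F(2)[of p] F(4)[of p] that by (auto simp: complex_nonpos_Reals_iff simp del: split_paired_All)
  have F_on: "F p \<notin> \<real>\<^sub>\<le>\<^sub>0" if "s p = 0 \<longrightarrow> p \<in> \<Sigma>" "snd p \<noteq> 0" for p
    using F(2)[of p] F(3)[of p] that by (auto simp: complex_nonpos_Reals_iff simp del: split_paired_All)
  have F_nz: "F p \<noteq> 0" if "p \<in> S3" "snd p \<noteq> 0" for p
    using F_off[of p] F_on[of p] that by (cases "p \<in> \<Sigma>") auto

  \<comment> \<open>Polar coordinates: \<open>E\<close> maps \<open>U\<close> onto the complement of the circle in the sphere.\<close>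
  define E where "E = (\<lambda>(z :: complex, \<beta>). (z, complex_of_real (sqrt (1 - (norm z)\<^sup>2)) * cis \<beta>))"
  define U where "U = ball (0::complex) 1 \<times> (UNIV :: real set)"
  have norm_lt: "(norm z)\<^sup>2 < 1" if "z \<in> ball 0 1" for z :: complex
    using that by (simp add: abs_square_less_1)
  have E_S3: "E p \<in> S3" "snd (E p) \<noteq> 0" if "p \<in> U" for p
    using that norm_lt[of "fst p"] by (auto simp: E_def U_def S3_iff norm_Pair norm_mult split: prod.splits)
  have contE: "continuous_on A E" for A
    unfolding E_def split_def cis_conv_exp by (intro continuous_intros)
  have "convex U" unfolding U_def by (intro convex_Times convex_ball convex_UNIV)
  then have conU: "connected U" "contractible U" using convex_connected convex_imp_contractible by blast+
  have contFE: "continuous_on A (\<lambda>p. F (E p))" for A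
    by (rule continuous_on_compose2[OF F(1) contE]) simp
  obtain g where g: "continuous_on U g" "\<And>p. p \<in> U \<Longrightarrow> F (E p) = exp (g p)"
    by (rule continuous_logarithm_on_contractible[OF contFE[of U] conU(2)])
      (simp add: F_nz E_S3, rule that)
  have E_period: "E (z, \<beta> + 2 * pi) = E (z, \<beta>)" for z \<beta>
    by (simp add: E_def complex_eq_iff)
  define DD where "DD = g (0, 2 * pi) - g (0, 0)"
  have period: "g (z, \<beta> + 2 * pi) = g (z, \<beta>) + DD" if z: "z \<in> ball 0 1" for z \<beta>
  proof -
    have in_U: "(z, \<beta>) \<in> U" "(0, 0) \<in> U" "\<And>p. (fst p, snd p + 2 * pi) \<in> U \<longleftrightarrow> p \<in> U" using z by (auto simp: U_def)
    have "(\<lambda>p. g (fst p, snd p + 2 * pi)) (z, \<beta>) - (\<lambda>p. g (fst p, snd p + 2 * pi)) (0, 0) = g (z, \<beta>) - g (0, 0)"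
    proof (rule log_unique[OF conU(1) _ g(1) _ in_U(1,2)])
      show "continuous_on U (\<lambda>p. g (fst p, snd p + 2 * pi))"
        by (rule continuous_on_compose2[OF g(1)]) (auto intro!: continuous_intros simp: U_def)
      show "exp (g (fst p, snd p + 2 * pi)) = exp (g p)" if "p \<in> U" for p
        using g(2)[of "(fst p, snd p + 2 * pi)"] g(2)[OF that] in_U(3)[of p] that E_period[of "fst p" "snd p"] by simp
    qed
    then show ?thesis by (simp add: DD_def algebra_simps)
  qed
  have period_nat: "g (z, \<beta> + 2 * pi * real n) = g (z, \<beta>) + of_nat n * DD" if z: "z \<in> ball 0 1" for z \<beta> n
  proof (induction n)
    case (Suc n)
    have "\<beta> + 2 * pi * real (Suc n) = (\<beta> + 2 * pi * real n) + 2 * pi" by (simp add: algebra_simps)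
    then show ?case using period[OF z, of "\<beta> + 2 * pi * real n"] Suc by (simp only: of_nat_Suc) (simp add: algebra_simps)
  qed simp
  have period_int: "g (z, \<beta> + 2 * pi * real_of_int n) = g (z, \<beta>) + of_int n * DD" if z: "z \<in> ball 0 1" for z \<beta> n
  proof (cases n rule: int_cases2)
    case (nonneg m)
    then show ?thesis using period_nat[OF z, of \<beta> m] by simp
  next
    case (nonpos m)
    then show ?thesis using period_nat[OF z, of "\<beta> - 2 * pi * real m" m] by simp
  qed

  \<comment> \<open>The constant \<open>DD\<close> is computed on a small meridian, with angles measured from the framing.\<close>
  define e0 where "e0 = cis (Im (\<zeta> 0))"
  have Z0: "snd (Z 0) = of_real (exp (Re (\<zeta> 0))) * e0"
    using \<zeta>(2)[OF I0(1)] by (simp add: e0_def exp_eq_polar exp_of_real)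
  obtain s' where s': "strict_deriv s s' (\<gamma> 0, 0)" "\<exists>v\<in>tangent_S3 (\<gamma> 0, 0). s' v \<noteq> 0" "\<forall>v\<in>tangent_space \<Sigma> (\<gamma> 0, 0). s' v = 0"
    using s(3)[OF \<gamma>_in(2)] by blast
  have ne0: "norm e0 = 1" by (simp add: e0_def)
  obtain \<delta> \<epsilon>0 \<sigma> where \<delta>: "0 < \<delta>" "\<delta> < pi / 2" "0 < \<epsilon>0" "\<epsilon>0 < 1" "\<sigma> \<noteq> 0"
    and cross: "\<And>\<epsilon> x m. 0 < \<epsilon> \<Longrightarrow> \<epsilon> < \<epsilon>0 \<Longrightarrow> m = (\<lambda>x. (of_real (sqrt (1 - \<epsilon>\<^sup>2)) * \<gamma> 0, of_real \<epsilon> * (e0 * cis x))) \<Longrightarrow>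
       (\<forall>x\<in>{\<delta>..2 * pi - \<delta>}. m x \<notin> \<Sigma>) \<and> (\<forall>x\<in>{-\<delta>..\<delta>}. s (m x) = 0 \<longrightarrow> m x \<in> \<Sigma>) \<and>
       \<sigma> * s (m \<delta>) > 0 \<and> \<sigma> * s (m (-\<delta>)) < (0::real)"
    by (rule meridian_crosses_once[OF inward[rule_format, OF I0(1)] s' s(2) ne0 Z0 exp_gt_zero]) (assumption, rule that)
  have DD: "DD \<noteq> 0"
  proof -
    define \<epsilon> where "\<epsilon> = \<epsilon>0 / 2"
    have \<epsilon>: "0 < \<epsilon>" "\<epsilon> < \<epsilon>0" "\<epsilon> < 1" using \<delta>(3,4) by (auto simp: \<epsilon>_def)
    define m where "m = (\<lambda>x. (of_real (sqrt (1 - \<epsilon>\<^sup>2)) * \<gamma> 0, of_real \<epsilon> * (e0 * cis x)))"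
    define z0 where "z0 = of_real (sqrt (1 - \<epsilon>\<^sup>2)) * \<gamma> 0"
    define P where "P = (\<lambda>x. g (z0, Im (\<zeta> 0) + x))"
    have \<epsilon>2: "0 < \<epsilon>\<^sup>2" "\<epsilon>\<^sup>2 < 1" using \<epsilon> by (auto simp: abs_square_less_1)
    have nz0: "(norm z0)\<^sup>2 = 1 - \<epsilon>\<^sup>2" using \<epsilon>2 norm_\<gamma>[of 0] by (simp add: z0_def norm_mult)
    then have z0: "z0 \<in> ball 0 1" using \<epsilon>2 power2_less_imp_less[of "norm z0" 1] by simp
    have inU: "(z0, b) \<in> U" for b using z0 by (simp add: U_def)
    have Em: "E (z0, Im (\<zeta> 0) + x) = m x" for x
      using \<epsilon>(1) nz0 by (simp add: E_def m_def z0_def[symmetric] e0_def cis_mult)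
    have contP: "continuous_on A P" for A
      unfolding P_def by (rule continuous_on_compose2[OF g(1)]) (auto intro!: continuous_intros simp: inU)
    have expP: "exp (P x) = F (m x)" for x using g(2)[OF inU, of "Im (\<zeta> 0) + x"] Em[of x] by (simp add: P_def)
    have mS: "m x \<in> S3" "snd (m x) \<noteq> 0" for x using E_S3[OF inU, of "Im (\<zeta> 0) + x"] Em by simp_all
    have contFm: "continuous_on A (\<lambda>x. F (m x))" for A
      by (rule continuous_on_compose2[OF F(1)]) (auto intro!: continuous_intros simp: m_def cis_conv_exp)
    note cr = cross[OF \<epsilon>(1,2) m_def]
    have h1: "P \<delta> - P (-\<delta>) = Ln (F (m \<delta>)) - Ln (F (m (-\<delta>)))"
    proof (rule log_unique[of "{-\<delta>..\<delta>}" P "\<lambda>x. Ln (F (m x))"])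
      show "continuous_on {-\<delta>..\<delta>} (\<lambda>x. Ln (F (m x)))"
        by (rule continuous_on_Ln'[OF contFm]) (use F_on mS cr in blast)
    qed (use \<delta>(1) contP expP F_nz mS in auto)
    have h2: "P (2 * pi - \<delta>) - P \<delta> = (Ln (- F (m (2 * pi - \<delta>))) + \<i> * pi) - (Ln (- F (m \<delta>)) + \<i> * pi)"
    proof (rule log_unique[of "{\<delta>..2 * pi - \<delta>}" P "\<lambda>x. Ln (- F (m x)) + \<i> * pi"])
      have "continuous_on {\<delta>..2 * pi - \<delta>} (\<lambda>x. Ln (- F (m x)))"
        by (rule continuous_on_Ln'[OF continuous_on_minus[OF contFm]]) (use F_off mS cr in blast)
      then show "continuous_on {\<delta>..2 * pi - \<delta>} (\<lambda>x. Ln (- F (m x)) + \<i> * pi)"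
        by (rule continuous_on_add[OF _ continuous_on_const])
      show "exp (P x) = exp (Ln (- F (m x)) + \<i> * pi)" for x
        using expP[of x] F_nz[OF mS[of x]] by (simp add: exp_add)
    qed (use \<delta>(1,2) contP in auto)
    have h3: "m (2 * pi - \<delta>) = m (-\<delta>)"
      by (simp add: m_def complex_eq_iff)
    have h4: "P (2 * pi - \<delta>) = P (-\<delta>) + DD"
      using period[OF z0, of "Im (\<zeta> 0) - \<delta>"] by (simp add: P_def algebra_simps)
    have "DD = (Ln (- F (m (-\<delta>))) - Ln (- F (m \<delta>))) + (Ln (F (m \<delta>)) - Ln (F (m (-\<delta>))))"
      using h1 h2 h4 unfolding h3 by algebra
    moreover have "Im (F (m \<delta>)) * Im (F (m (-\<delta>))) < 0"
    proof -
      have "\<sigma> * s (m \<delta>) * (\<sigma> * s (m (-\<delta>))) < 0" using cr mult_pos_neg by blast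
      then have "\<sigma>\<^sup>2 * (s (m \<delta>) * s (m (-\<delta>))) < 0" by (simp add: power2_eq_square algebra_simps)
      moreover have "\<sigma>\<^sup>2 > 0" using \<delta>(5) by simp
      ultimately show ?thesis unfolding F(2) by (simp add: mult_less_0_iff)
    qed
    ultimately show ?thesis using Ln_difference_half_turn by metis
  qed

  \<comment> \<open>The loop pushed off along \<open>- Z\<close>; adding \<open>\<pi>\<close> to the argument of \<open>Z\<close> gives its angle \<open>\<beta>\<close>.\<close>
  obtain d where d: "d > 0" "\<forall>t\<in>{0..2 * pi}. \<forall>\<epsilon>. 0 < \<epsilon> \<and> \<epsilon> < d \<longrightarrow> \<epsilon> * norm (snd (Z t)) < 1 \<and>
    (of_real (sqrt (1 - (norm (- \<epsilon> *\<^sub>R snd (Z t)))\<^sup>2)) * \<gamma> t, - \<epsilon> *\<^sub>R snd (Z t)) \<notin> \<Sigma>"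
    using outward_push_misses_surface[OF inward] by blast
  define \<epsilon> where "\<epsilon> = d / 2"
  have \<epsilon>: "0 < \<epsilon>" "\<epsilon> < d" using d(1) by (auto simp: \<epsilon>_def)
  define z where "z = (\<lambda>t. of_real (sqrt (1 - (\<epsilon> * norm (snd (Z t)))\<^sup>2)) * \<gamma> t)"
  define \<beta> where "\<beta> = (\<lambda>t. Im (\<zeta> t) + pi)"
  have contZ2: "continuous_on {0..2 * pi} (\<lambda>t. snd (Z t))" by (intro continuous_intros cont_Z)
  have path: "continuous_on {0..2 * pi} (\<lambda>t. (z t, \<beta> t))"
    unfolding z_def \<beta>_def by (intro continuous_intros contZ2 cont_\<gamma> \<zeta>(1))
  have pt: "(z t, \<beta> t) \<in> U" "E (z t, \<beta> t) \<notin> \<Sigma>" if t: "t \<in> {0..2 * pi}" for t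
  proof -
    define \<rho> where "\<rho> = \<epsilon> * norm (snd (Z t))"
    have \<rho>: "0 < \<rho>" "\<rho> < 1" using d(2) t \<epsilon> Z_nonzero[OF t] by (auto simp: \<rho>_def)
    have \<rho>2: "0 < \<rho>\<^sup>2" "\<rho>\<^sup>2 < 1" using \<rho> by (auto simp: abs_square_less_1)
    have nz: "(norm (z t))\<^sup>2 = 1 - \<rho>\<^sup>2" using \<rho>2 norm_\<gamma>[of t] by (simp add: z_def \<rho>_def[symmetric] norm_mult)
    then have "norm (z t) < 1" using \<rho>2 power2_less_imp_less[of "norm (z t)" 1] by simp
    then show "(z t, \<beta> t) \<in> U" by (simp add: U_def)
    have "snd (Z t) = of_real (norm (snd (Z t))) * cis (Im (\<zeta> t))"
      using \<zeta>(2)[OF t] by (simp add: exp_eq_polar exp_of_real norm_mult)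
    then have "- \<epsilon> *\<^sub>R snd (Z t) = of_real \<rho> * cis (\<beta> t)"
      unfolding \<rho>_def \<beta>_def cis_mult[symmetric] scaleR_conv_of_real
      by (simp add: mult.assoc)
    moreover have "norm (- \<epsilon> *\<^sub>R snd (Z t)) = \<rho>" using \<epsilon> by (simp add: \<rho>_def)
    moreover have "E (z t, \<beta> t) = (z t, of_real \<rho> * cis (\<beta> t))" using nz \<rho>(1) by (simp add: E_def)
    moreover have "(of_real (sqrt (1 - (norm (- \<epsilon> *\<^sub>R snd (Z t)))\<^sup>2)) * \<gamma> t, - \<epsilon> *\<^sub>R snd (Z t)) \<notin> \<Sigma>"
      using d(2) t \<epsilon> by blast
    ultimately show "E (z t, \<beta> t) \<notin> \<Sigma>" by (simp add: z_def \<rho>_def)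
  qed
  have z_loop: "z (2 * pi) = z 0" using loop by (simp add: z_def)
  obtain n :: int where n: "\<zeta> (2 * pi) = \<zeta> 0 + (of_int (2 * n) * pi) * \<i>"
    using \<zeta>(2)[OF I0(1)] \<zeta>(2)[OF I0(2)] loop(2) exp_eq[of "\<zeta> (2 * pi)" "\<zeta> 0"] by auto
  have \<beta>_end: "\<beta> (2 * pi) = \<beta> 0 + 2 * pi * real_of_int n" by (simp add: \<beta>_def n)
  have z0: "z 0 \<in> ball 0 1" using pt(1)[OF I0(1)] by (simp add: U_def)
  have ends: "g (z (2 * pi), \<beta> (2 * pi)) - g (z 0, \<beta> 0) = of_int n * DD"
    unfolding z_loop \<beta>_end period_int[OF z0] by simp
  have E_end: "E (z (2 * pi), \<beta> (2 * pi)) = E (z 0, \<beta> 0)"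
    unfolding z_loop \<beta>_end using cis_multiple_2pi[of "real_of_int n"] by (simp add: E_def cis_mult[symmetric])
  have "g (z (2 * pi), \<beta> (2 * pi)) - g (z 0, \<beta> 0) =
     (Ln (- F (E (z (2 * pi), \<beta> (2 * pi)))) + \<i> * pi) - (Ln (- F (E (z 0, \<beta> 0))) + \<i> * pi)"
  proof (rule log_unique[of "{0..2 * pi}" "\<lambda>t. g (z t, \<beta> t)" "\<lambda>t. Ln (- F (E (z t, \<beta> t))) + \<i> * pi"])
    show "continuous_on {0..2 * pi} (\<lambda>t. g (z t, \<beta> t))"
      by (rule continuous_on_compose2[OF g(1) path]) (use pt(1) in blast)
    have "continuous_on {0..2 * pi} (\<lambda>t. F (E (z t, \<beta> t)))"
      by (rule continuous_on_compose2[OF contFE[of UNIV] path]) simp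
    then have "continuous_on {0..2 * pi} (\<lambda>t. Ln (- F (E (z t, \<beta> t))))"
      by (intro continuous_on_Ln' continuous_on_minus) (use F_off E_S3 pt in blast)+
    then show "continuous_on {0..2 * pi} (\<lambda>t. Ln (- F (E (z t, \<beta> t))) + \<i> * pi)"
      by (rule continuous_on_add[OF _ continuous_on_const])
    show "exp (g (z t, \<beta> t)) = exp (Ln (- F (E (z t, \<beta> t))) + \<i> * pi)" if "t \<in> {0..2 * pi}" for t
      using g(2)[OF pt(1)[OF that]] F_nz[OF E_S3[OF pt(1)[OF that]]] by (simp add: exp_add)
  qed simp_all
  then have "of_int n * DD = 0" using ends E_end by simp
  then have "n = 0" using DD by simp
  then show ?thesis using n by simp
qed

end

text \<open>
  An outward section becomes inward when replaced by its negative, which does not affect the winding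
  number.
\<close>

lemma (in framed_hopf_surface) winding_zero:
  assumes \<zeta>: "continuous_on {0..2 * pi} \<zeta>" "\<And>t. t \<in> {0..2 * pi} \<Longrightarrow> snd (Z t) = exp (\<zeta> t)"
    and loop: "\<gamma> (2 * pi) = \<gamma> 0" "Z (2 * pi) = Z 0"
  shows "\<zeta> (2 * pi) = \<zeta> 0"
proof (cases "\<forall>t\<in>{0..2 * pi}. contingent \<Sigma> (\<gamma> t, 0) (Z t)")
  case True
  then show ?thesis using winding_zero_inward \<zeta> loop by blast
next
  case False
  then have outward: "\<forall>t\<in>{0..2 * pi}. contingent \<Sigma> (\<gamma> t, 0) (- Z t)" using inward_constant by blast
  interpret neg: framed_hopf_surface \<Sigma> \<gamma> "\<lambda>t. - Z t"
  proof
    show "continuous_on {0..2 * pi} (\<lambda>t. - Z t)" by (intro continuous_intros cont_Z)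
    show "- Z t \<in> tangent_space \<Sigma> (\<gamma> t, 0)" if "t \<in> {0..2 * pi}" for t
      using tangent_space_diff[OF tangent_Z[OF that] tangent_Z[OF that], of 2] by (simp add: scaleR_2)
  qed (use seifert cont_\<gamma> norm_\<gamma> Z_nonzero in auto)
  have "\<zeta> (2 * pi) + \<i> * pi = \<zeta> 0 + \<i> * pi"
  proof (rule neg.winding_zero_inward[OF outward, of "\<lambda>t. \<zeta> t + \<i> * pi"])
    show "continuous_on {0..2 * pi} (\<lambda>t. \<zeta> t + \<i> * pi)" by (intro continuous_intros \<zeta>(1))
    show "snd (- Z t) = exp (\<zeta> t + \<i> * pi)" if "t \<in> {0..2 * pi}" for t
      using \<zeta>(2)[OF that] by (simp add: exp_add)
  qed (use loop in simp_all)
  then show ?thesis by simp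
qed

section \<open>Orientation of the leaves\<close>

lemma det_4:
  "det (A::'a::comm_ring_1^4^4) =
     A$1$1 * (A$2$2 * (A$3$3 * A$4$4 - A$3$4 * A$4$3) - A$2$3 * (A$3$2 * A$4$4 - A$3$4 * A$4$2) + A$2$4 * (A$3$2 * A$4$3 - A$3$3 * A$4$2)) -
     A$1$2 * (A$2$1 * (A$3$3 * A$4$4 - A$3$4 * A$4$3) - A$2$3 * (A$3$1 * A$4$4 - A$3$4 * A$4$1) + A$2$4 * (A$3$1 * A$4$3 - A$3$3 * A$4$1)) +
     A$1$3 * (A$2$1 * (A$3$2 * A$4$4 - A$3$4 * A$4$2) - A$2$2 * (A$3$1 * A$4$4 - A$3$4 * A$4$1) + A$2$4 * (A$3$1 * A$4$2 - A$3$2 * A$4$1)) -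
     A$1$4 * (A$2$1 * (A$3$2 * A$4$3 - A$3$3 * A$4$2) - A$2$2 * (A$3$1 * A$4$3 - A$3$3 * A$4$1) + A$2$3 * (A$3$1 * A$4$2 - A$3$2 * A$4$1))"
proof -
  have f1234: "finite {2::4, 3, 4}" "1 \<notin> {2::4, 3, 4}" by auto
  have f234: "finite {3::4, 4}" "2 \<notin> {3::4, 4}" by auto
  have f34: "finite {4::4}" "3 \<notin> {4::4}" by auto
  show ?thesis
    unfolding det_def UNIV_4
    unfolding sum_over_permutations_insert[OF f1234]
    unfolding sum_over_permutations_insert[OF f234]
    unfolding sum_over_permutations_insert[OF f34]
    unfolding permutes_sing
    by (simp add: sign_swap_id permutation_swap_id sign_compose swap_id_eq permutation_compose
        Transposition.transpose_def algebra_simps)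
qed

lemma vector_4:
  "(vector [x,y,z,w] :: ('a::zero)^4)$1 = x" "(vector [x,y,z,w] :: ('a::zero)^4)$2 = y"
  "(vector [x,y,z,w] :: ('a::zero)^4)$3 = z" "(vector [x,y,z,w] :: ('a::zero)^4)$4 = w"
  unfolding vector_def by simp_all

lemma real_coords_nth:
  "real_coords p $ 1 = Re (fst p)" "real_coords p $ 2 = Im (fst p)"
  "real_coords p $ 3 = Re (snd p)" "real_coords p $ 4 = Im (snd p)"
  by (simp_all add: real_coords_def vector_4)

lemma inner_C2: "inner p q = Re (cnj (fst p) * fst q + cnj (snd p) * snd q)" for p q :: C2
  by (simp add: inner_prod_def inner_complex_def)

text \<open>
  Identify \<open>\<complex>\<^sup>2\<close> with the quaternions.  The vectors \<open>u = j p\<close> and \<open>w = \<i> j p\<close> complete \<open>p\<close> and \<open>\<i> p\<close> to an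
  oriented orthonormal basis, \<open>omega\<close> takes values \<open>b\<close> and \<open>\<i> b\<close> on them, and the determinant of
  \<open>(p, v, u, w)\<close> is the component of \<open>v\<close> along \<open>\<i> p\<close>, which is positive by assumption.
\<close>

lemma positive_leaf_vectorI:
  assumes p: "p \<in> S3" and v: "inner p v = 0" "omega a p v = 0" "Im (cnj (fst p) * fst v + cnj (snd p) * snd v) > 0"
    and nz: "a * of_real ((norm (fst p))\<^sup>2) + (1 - a) * of_real ((norm (snd p))\<^sup>2) \<noteq> 0"
  shows "positive_leaf_vector (omega a) p v"
proof -
  obtain p1 p2 where pp: "p = (p1, p2)" by (cases p)
  obtain v1 v2 where vv: "v = (v1, v2)" by (cases v)
  define u :: C2 where "u = (- cnj p2, cnj p1)"
  define w :: C2 where "w = (- \<i> * cnj p2, \<i> * cnj p1)"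
  define b where "b = a * of_real ((norm p1)\<^sup>2) + (1 - a) * of_real ((norm p2)\<^sup>2)"
  have b: "b \<noteq> 0" using nz by (simp add: pp b_def)
  have b_eq: "b = a * (p1 * cnj p1) + (1 - a) * (p2 * cnj p2)" unfolding b_def complex_norm_square ..
  have om: "omega a p u = b" "omega a p w = \<i> * b"
    by (simp_all add: omega_def pp u_def w_def b_eq algebra_simps)
  have co: "coorientation_form (omega a) p u w > 0"
  proof -
    have "coorientation_form (omega a) p u w = (Re b)\<^sup>2 + (Im b)\<^sup>2"
      unfolding coorientation_form_def om by (simp add: power2_eq_square)
    also have "\<dots> = (norm b)\<^sup>2" by (rule cmod_power2[symmetric])
    also have "\<dots> > 0" using b by simp
    finally show ?thesis .
  qed
  have tan: "u \<in> tangent_S3 p" "w \<in> tangent_S3 p"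
    by (simp_all add: tangent_S3_def inner_C2 pp u_def w_def algebra_simps)
  have np: "(norm p1)\<^sup>2 + (norm p2)\<^sup>2 = 1" using p by (simp add: S3_iff pp norm_Pair)
  have "det (vector [real_coords p, real_coords v, real_coords u, real_coords w] :: real ^ 4 ^ 4) =
      ((norm p1)\<^sup>2 + (norm p2)\<^sup>2) * Im (cnj p1 * v1 + cnj p2 * v2)"
    unfolding det_4 vector_4 real_coords_nth pp vv u_def w_def cmod_power2
    by (simp add: power2_eq_square algebra_simps)
  also have "\<dots> > 0" using v(3) np by (simp add: pp vv)
  finally have "positive_frame_S3 p v u w"
    using tan v(1) by (simp add: positive_frame_S3_def tangent_S3_def)
  then show ?thesis
    unfolding positive_leaf_vector_def using p v co by (auto simp: tangent_S3_def simp del: split_paired_Ex)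
qed

text \<open>
  At a point of the circle the determinant of the frame is the product of two determinants of size two,
  one for \<open>(p, v)\<close> and one for the second components of the pair, and the coorientation form is a positive
  multiple of the latter.
\<close>

lemma positive_leaf_vector_hopfD:
  assumes a: "a \<noteq> 0" and u: "norm u = 1" and pos: "positive_leaf_vector (omega a) (u, 0) v"
  shows "snd v = 0" "fst v = (\<i> * u) * of_real (Im (cnj u * fst v))" "Im (cnj u * fst v) > 0"
proof -
  have v: "inner (u, 0) v = 0" "omega a (u, 0) v = 0"
    using pos unfolding positive_leaf_vector_def tangent_S3_def by simp_all
  obtain x w where xw: "coorientation_form (omega a) (u, 0) x w > 0" "positive_frame_S3 (u, 0) v x w"
    using pos unfolding positive_leaf_vector_def by blast
  have "u \<noteq> 0" using u by auto
  then show sv: "snd v = 0" using v(2) a by (simp add: omega_def)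
  show "fst v = (\<i> * u) * of_real (Im (cnj u * fst v))"
    using v(1) by (intro orthogonal_on_circle u) (simp add: inner_prod_def)
  have "coorientation_form (omega a) (u, 0) x w = (norm (a * u))\<^sup>2 * Im (cnj (snd x) * snd w)"
    unfolding coorientation_form_def omega_def cmod_power2 by (simp add: power2_eq_square algebra_simps)
  then have 1: "Im (cnj (snd x) * snd w) > 0" using xw(1) by (simp add: zero_less_mult_iff)
  have "det (vector [real_coords (u, 0), real_coords v, real_coords x, real_coords w] :: real ^ 4 ^ 4) =
      Im (cnj u * fst v) * Im (cnj (snd x) * snd w)"
    unfolding det_4 vector_4 real_coords_nth by (simp add: sv algebra_simps)
  then have "Im (cnj u * fst v) * Im (cnj (snd x) * snd w) > 0"
    using xw(2) by (simp add: positive_frame_S3_def)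
  then show "Im (cnj u * fst v) > 0" using 1 by (simp add: zero_less_mult_iff)
qed

text \<open>
  The angle is the integral of the angular speed \<open>r > 0\<close>.  Its total increase is a positive multiple of
  \<open>2 \<pi>\<close>, and it is \<open>2 \<pi>\<close> itself because \<open>\<gamma>\<close> runs through the circle only once.
\<close>

lemma closed_leaf_param_angle:
  assumes a: "a \<noteq> 0" and c: "closed_leaf_param (omega a) hopf_circle \<gamma>"
  obtains \<theta> r where "\<theta> 0 = 0" "\<theta> (2 * pi) = 2 * pi" "continuous_on {0..2 * pi} \<theta>"
    "\<And>t. \<gamma> t = (fst (\<gamma> t), 0)" "\<And>t. norm (fst (\<gamma> t)) = 1"
    "\<And>t. t \<in> {0..2 * pi} \<Longrightarrow> fst (\<gamma> t) = fst (\<gamma> 0) * cis (\<theta> t)"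
    "\<And>t. t \<in> {0..2 * pi} \<Longrightarrow> (\<theta> has_vector_derivative r t) (at t within {0..2 * pi})"
    "\<And>t. (\<gamma> has_vector_derivative (\<i> * fst (\<gamma> t) * of_real (r t), 0)) (at t)" "\<And>t. r t > (0::real)"
proof -
  have sm: "smooth_on UNIV \<gamma>" and per: "\<And>t. \<gamma> (t + 2 * pi) = \<gamma> t" and inj: "inj_on \<gamma> {0..<2 * pi}"
    and ran: "range \<gamma> = hopf_circle"
    and pos: "\<And>t. positive_leaf_vector (omega a) (\<gamma> t) (vector_derivative \<gamma> (at t))"
    using c unfolding closed_leaf_param_def by simp_all
  have "\<gamma> t \<in> hopf_circle" for t using ran by blast
  then have g0: "\<gamma> t = (fst (\<gamma> t), 0)" and ng: "norm (fst (\<gamma> t)) = 1" for t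
    by (auto simp: mem_Times_iff prod_eq_iff)
  have der: "(\<gamma> has_vector_derivative D \<gamma> t 1) (at t)" for t
  proof -
    have d: "(\<gamma> has_derivative D \<gamma> t) (at t)" using smooth_onD(1)[OF sm UNIV_I] .
    have "D \<gamma> t = (\<lambda>x. x *\<^sub>R D \<gamma> t 1)"
    proof
      fix x
      have "D \<gamma> t (x *\<^sub>R 1) = x *\<^sub>R D \<gamma> t 1"
        by (rule linear_scale[OF bounded_linear.linear[OF has_derivative_bounded_linear[OF d]]])
      then show "D \<gamma> t x = x *\<^sub>R D \<gamma> t 1" by simp
    qed
    then show ?thesis using d unfolding has_vector_derivative_def by simp
  qed
  have vd: "vector_derivative \<gamma> (at t) = D \<gamma> t 1" for t
    by (rule vector_derivative_at[OF der])
  define r where "r = (\<lambda>t. Im (cnj (fst (\<gamma> t)) * fst (D \<gamma> t 1)))"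
  have pos': "positive_leaf_vector (omega a) (fst (\<gamma> t), 0) (D \<gamma> t 1)" for t
    using pos[of t] g0[of t] vd by simp
  have r: "r t > 0" "D \<gamma> t 1 = (\<i> * fst (\<gamma> t) * of_real (r t), 0)" for t
  proof -
    have "Im (cnj (fst (\<gamma> t)) * fst (D \<gamma> t 1)) = r t" by (simp add: r_def)
    note h = positive_leaf_vector_hopfD[OF a ng pos'[of t], unfolded this]
    show "r t > 0" by (rule h(3))
    show "D \<gamma> t 1 = (\<i> * fst (\<gamma> t) * of_real (r t), 0)"
      by (rule prod_eqI) (simp_all only: fst_conv snd_conv h(1), rule h(2))
  qed
  have contr: "continuous_on A r" for A
    unfolding r_def
    using smooth_onD(2)[OF sm UNIV_I] smooth_on_continuous[OF sm]
    by (intro continuous_intros) (auto intro: continuous_on_subset)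
  define \<theta> where "\<theta> = (\<lambda>t. integral {0..t} r)"
  have th_der: "(\<theta> has_vector_derivative r t) (at t within {0..2 * pi})" if "t \<in> {0..2 * pi}" for t
    unfolding \<theta>_def using integral_has_vector_derivative[OF contr that] .
  have th_cont: "continuous_on {0..2 * pi} \<theta>"
    using th_der has_vector_derivative_continuous unfolding continuous_on_eq_continuous_within by blast
  have th0: "\<theta> 0 = 0" by (simp add: \<theta>_def)
  have eq: "fst (\<gamma> t) = fst (\<gamma> 0) * cis (\<theta> t)" if t: "t \<in> {0..2 * pi}" for t
  proof -
    have "((\<lambda>t. fst (\<gamma> t) * cis (- \<theta> t)) has_vector_derivative 0) (at t within {0..2 * pi})"
      if t: "t \<in> {0..2 * pi}" for t
    proof -
      have "((\<lambda>t. fst (\<gamma> t)) has_vector_derivative \<i> * fst (\<gamma> t) * of_real (r t)) (at t within {0..2 * pi})"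
        using bounded_linear.has_vector_derivative[OF bounded_linear_fst der[of t]] r(2)
        by (auto intro: has_vector_derivative_at_within)
      moreover have "((\<lambda>t. cis (- \<theta> t)) has_vector_derivative - r t *\<^sub>R (\<i> * cis (- \<theta> t))) (at t within {0..2 * pi})"
        using vector_diff_chain_within[OF has_vector_derivative_minus[OF th_der[OF t]]
            has_vector_derivative_at_within[OF has_vector_derivative_cis[of "- \<theta> t"]]]
        by (simp add: o_def)
      ultimately show ?thesis
        by (rule has_vector_derivative_eq_rhs[OF has_vector_derivative_mult])
          (simp add: scaleR_conv_of_real)
    qed
    then have "\<exists>c. \<forall>t\<in>{0..2 * pi}. fst (\<gamma> t) * cis (- \<theta> t) = c"
      by (intro has_derivative_zero_constant) (simp_all add: has_vector_derivative_def)
    then obtain c where c: "\<And>t. t \<in> {0..2 * pi} \<Longrightarrow> fst (\<gamma> t) * cis (- \<theta> t) = c" by blast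
    have "fst (\<gamma> t) * cis (- \<theta> t) = fst (\<gamma> 0)" using c[OF t] c[of 0] th0 by simp
    then have "fst (\<gamma> 0) * cis (\<theta> t) = fst (\<gamma> t) * (cis (- \<theta> t) * cis (\<theta> t))" by (simp add: mult.assoc)
    then show ?thesis by (simp add: cis_mult)
  qed
  have g1: "fst (\<gamma> 0) \<noteq> 0" using ng[of 0] by auto
  have "fst (\<gamma> (2 * pi)) = fst (\<gamma> 0)" using per[of 0] by simp
  then have "cis (\<theta> (2 * pi)) = 1" using eq[of "2 * pi"] g1 by simp
  then have "cos (\<theta> (2 * pi)) = 1" by (simp add: complex_eq_iff)
  then obtain n :: int where n: "\<theta> (2 * pi) = of_int n * 2 * pi" by (auto simp: cos_one_2pi_int)
  have "\<theta> 0 < \<theta> (2 * pi)"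
  proof (rule DERIV_pos_imp_increasing_open[OF _ _ th_cont])
    fix x assume x: "0 < x" "x < 2 * pi"
    then have "at x within {0..2 * pi} = at x" by (intro at_within_interior) (simp add: interior_atLeastAtMost_real)
    then have "DERIV \<theta> x :> r x"
      using th_der[of x] x by (simp add: has_real_derivative_iff_has_vector_derivative)
    then show "\<exists>y. DERIV \<theta> x :> y \<and> 0 < y" using r(1) by blast
  qed simp
  then have n1: "n \<ge> 1" using n th0 by (simp add: zero_less_mult_iff)
  have "n = 1"
  proof (rule ccontr)
    assume "n \<noteq> 1"
    then have "2 \<le> real_of_int n" using n1 by simp
    then have n2: "2 * (2 * pi) \<le> \<theta> (2 * pi)" unfolding n by simp
    then obtain t where t: "0 \<le> t" "t \<le> 2 * pi" "\<theta> t = 2 * pi"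
      using IVT'[of \<theta> 0 "2 * pi" "2 * pi"] th0 th_cont by auto
    have "t \<noteq> 0" "t \<noteq> 2 * pi" using t(3) th0 n2 by auto
    moreover have "fst (\<gamma> t) = fst (\<gamma> 0)" using eq[of t] t by simp
    then have "\<gamma> t = \<gamma> 0" using g0[of t] g0[of 0] by simp
    ultimately show False using inj t(1,2) unfolding inj_on_def by force
  qed
  then have "\<theta> (2 * pi) = 2 * pi" using n by simp
  then show ?thesis
    using that[OF th0 _ th_cont g0 ng eq th_der _ r(1)] der r(2) by simp
qed

section \<open>Inverting a chart\<close>

lemma strict_deriv_imp_has_derivative:
  assumes "strict_deriv f f' q"
  shows "(f has_derivative f') (at q)"
  unfolding has_derivative_at_alt
proof (intro conjI allI impI)
  show "bounded_linear f'" by (rule strict_deriv_linear[OF assms])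
  fix e :: real assume "0 < e"
  then obtain r where r: "r > 0"
    "\<And>x y. x \<in> ball q r \<Longrightarrow> y \<in> ball q r \<Longrightarrow> norm (f x - f y - f' (x - y)) \<le> e * norm (x - y)"
    by (rule strict_derivD[OF assms]) (rule that)
  show "\<exists>d>0. \<forall>y. norm (y - q) < d \<longrightarrow> norm (f y - f q - f' (y - q)) \<le> e * norm (y - q)"
    using r by (intro exI[of _ r]) (auto simp: dist_norm norm_minus_commute)
qed

text \<open>
  A chart \<open>\<Psi>\<close> as in \<open>adapted_chart\<close>, without reference to a foliation.  Its inverse is obtained from the
  extension \<open>cone_map\<close> to an open cone, which is homogeneous in the first component: a map between open
  subsets of \<open>\<complex>\<^sup>2\<close>, to which invariance of domain and the inverse function theorem apply.  The unit sphere
  corresponds to the slice where the first component has modulus one.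
\<close>

locale sphere_chart =
  fixes W :: "C2 set" and \<Psi> :: "C2 \<Rightarrow> C2"
  assumes open_W: "open W" and smooth: "smooth_on W \<Psi>" and inj: "inj_on \<Psi> (W \<inter> S3)"
    and onto_circle: "\<And>p. p \<in> W \<inter> S3 \<Longrightarrow> norm (fst (\<Psi> p)) = 1"
    and immersive: "\<And>p v. p \<in> W \<inter> S3 \<Longrightarrow> v \<in> tangent_S3 p \<Longrightarrow> D \<Psi> p v = 0 \<Longrightarrow> v = 0"
begin

definition cone_dom :: "C2 set" where "cone_dom = {p. p \<noteq> 0 \<and> sgn p \<in> W}"

definition cone_map :: "C2 \<Rightarrow> C2" where
  "cone_map p = (norm p *\<^sub>R fst (\<Psi> (sgn p)), snd (\<Psi> (sgn p)))"

definition cone_inv :: "C2 \<Rightarrow> C2" where "cone_inv = inv_into cone_dom cone_map"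

lemma sgn_in: "p \<in> cone_dom \<Longrightarrow> sgn p \<in> W \<inter> S3"
  by (simp add: cone_dom_def S3_iff norm_sgn)

lemma S3_in_cone: "p \<in> W \<inter> S3 \<Longrightarrow> p \<in> cone_dom" "p \<in> W \<inter> S3 \<Longrightarrow> sgn p = p"
  by (auto simp: cone_dom_def S3_iff sgn_div_norm)

lemma cone_map_S3: "p \<in> W \<inter> S3 \<Longrightarrow> cone_map p = \<Psi> p"
  using S3_in_cone(2)[of p] by (simp add: cone_map_def S3_iff)

lemma continuous_sgn_cone: "continuous_on cone_dom sgn"
  by (intro continuous_on_sgn continuous_on_id) (simp add: cone_dom_def)

lemma open_cone: "open cone_dom"
proof -
  have "continuous_on (- {0}) (sgn :: C2 \<Rightarrow> C2)" by (intro continuous_on_sgn continuous_on_id) simp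
  then have "open (- {0} \<inter> sgn -` W)" by (rule continuous_open_preimage) (auto simp: open_W)
  moreover have "- {0} \<inter> sgn -` W = cone_dom" unfolding cone_dom_def by blast
  ultimately show ?thesis by simp
qed

lemma continuous_cone_map: "continuous_on cone_dom cone_map"
proof -
  have "continuous_on cone_dom (\<lambda>p. \<Psi> (sgn p))"
    by (rule continuous_on_compose2[OF smooth_on_continuous[OF smooth] continuous_sgn_cone]) (use sgn_in in blast)
  then show ?thesis unfolding cone_map_def by (intro continuous_intros)
qed

lemma norm_cone_map: "p \<in> cone_dom \<Longrightarrow> norm (fst (cone_map p)) = norm p"
  using onto_circle[OF sgn_in] by (simp add: cone_map_def)

lemma inj_cone_map: "inj_on cone_map cone_dom"
proof (rule inj_onI)
  fix p q assume p: "p \<in> cone_dom" and q: "q \<in> cone_dom" and eq: "cone_map p = cone_map q"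
  have n: "norm p = norm q" using norm_cone_map[OF p] norm_cone_map[OF q] eq by simp
  have p0: "p \<noteq> 0" "q \<noteq> 0" using p q by (simp_all add: cone_dom_def)
  have "\<Psi> (sgn p) = \<Psi> (sgn q)"
    using eq n p0 by (intro prod_eqI) (simp_all add: cone_map_def)
  then have "sgn p = sgn q" using inj sgn_in p q by (meson inj_onD)
  then have "norm p *\<^sub>R sgn p = norm q *\<^sub>R sgn q" using n by simp
  moreover have "norm x *\<^sub>R sgn x = x" for x :: C2 by (cases "x = 0") (simp_all add: sgn_div_norm)
  ultimately show "p = q" by simp
qed

lemma cone_inv_map: "p \<in> cone_dom \<Longrightarrow> cone_inv (cone_map p) = p"
  unfolding cone_inv_def by (rule inv_into_f_f[OF inj_cone_map])

lemma cone_inv_chart: "p \<in> W \<inter> S3 \<Longrightarrow> cone_inv (\<Psi> p) = p"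
  using cone_inv_map[OF S3_in_cone(1)] cone_map_S3 by simp

lemma open_cone_image: "open (cone_map ` cone_dom)"
  by (rule invariance_of_domain[OF continuous_cone_map open_cone inj_cone_map])

lemma image_cone_slice:
  assumes "q \<in> cone_map ` cone_dom" "norm (fst q) = 1"
  shows "cone_inv q \<in> W \<inter> S3" "\<Psi> (cone_inv q) = q"
proof -
  obtain p where p: "p \<in> cone_dom" "q = cone_map p" using assms(1) by blast
  then have "norm p = 1" using norm_cone_map[OF p(1)] assms(2) by simp
  then have pS: "p \<in> W \<inter> S3" using sgn_in[OF p(1)] by (simp add: S3_iff sgn_div_norm)
  have "cone_inv q = p" using cone_inv_map[OF p(1)] p(2) by simp
  then show "cone_inv q \<in> W \<inter> S3" "\<Psi> (cone_inv q) = q" using pS cone_map_S3[OF pS] p(2) by simp_all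
qed

lemma image_chart_openin: "openin (top_of_set (sphere 0 1 \<times> UNIV)) (\<Psi> ` (W \<inter> S3))"
proof -
  have "\<Psi> ` (W \<inter> S3) = (sphere 0 1 \<times> UNIV) \<inter> cone_map ` cone_dom"
  proof (intro equalityI subsetI)
    fix q assume "q \<in> \<Psi> ` (W \<inter> S3)"
    then obtain p where "p \<in> W \<inter> S3" "q = \<Psi> p" by blast
    then show "q \<in> (sphere 0 1 \<times> UNIV) \<inter> cone_map ` cone_dom"
      using onto_circle[of p] cone_map_S3[of p] S3_in_cone(1)[of p] by (auto simp: mem_Times_iff image_iff simp del: split_paired_Ex intro!: bexI[of _ p])
  next
    fix q assume "q \<in> (sphere 0 1 \<times> UNIV) \<inter> cone_map ` cone_dom"
    then have "q \<in> cone_map ` cone_dom" "norm (fst q) = 1" by (auto simp: mem_Times_iff)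
    from image_cone_slice[OF this] show "q \<in> \<Psi> ` (W \<inter> S3)" by (metis image_eqI)
  qed
  then show ?thesis using open_cone_image by (simp add: openin_open_Int)
qed

lemma has_derivative_chart_sgn:
  assumes p: "p \<in> W \<inter> S3"
  shows "((\<lambda>q. \<Psi> (sgn q)) has_derivative (\<lambda>v. D \<Psi> p (v - (p \<bullet> v) *\<^sub>R p))) (at p)"
proof -
  have np: "norm p = 1" using p by (simp add: S3_iff)
  have "(\<Psi> has_derivative D \<Psi> p) (at (sgn p))" using smooth_onD(1)[OF smooth] p S3_in_cone(2)[OF p] by simp
  from has_derivative_compose[OF strict_deriv_imp_has_derivative[OF strict_deriv_sgn[OF np]] this] show ?thesis .
qed

text \<open>
  Since \<open>fst (\<Psi> p)\<close> stays on the unit circle.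
\<close>

lemma chart_tangent_circle:
  assumes p: "p \<in> W \<inter> S3" and v: "v \<in> tangent_S3 p"
  shows "fst (\<Psi> p) \<bullet> fst (D \<Psi> p v) = 0"
proof -
  have d: "((\<lambda>q. fst (\<Psi> (sgn q))) has_derivative (\<lambda>v. fst (D \<Psi> p (v - (p \<bullet> v) *\<^sub>R p)))) (at p)"
    by (rule has_derivative_fst[OF has_derivative_chart_sgn[OF p]])
  have "((\<lambda>q. fst (\<Psi> (sgn q)) \<bullet> fst (\<Psi> (sgn q))) has_derivative (\<lambda>v. fst (\<Psi> (sgn p)) \<bullet> fst (D \<Psi> p (v - (p \<bullet> v) *\<^sub>R p)) +
      fst (D \<Psi> p (v - (p \<bullet> v) *\<^sub>R p)) \<bullet> fst (\<Psi> (sgn p)))) (at p)"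
    by (rule has_derivative_inner[OF d d])
  moreover have "((\<lambda>q. fst (\<Psi> (sgn q)) \<bullet> fst (\<Psi> (sgn q))) has_derivative (\<lambda>v. 0)) (at p)"
  proof (rule has_derivative_transform_within_open[OF has_derivative_const open_cone S3_in_cone(1)[OF p]])
    fix q assume "q \<in> cone_dom"
    then show "1 = fst (\<Psi> (sgn q)) \<bullet> fst (\<Psi> (sgn q))" using onto_circle[OF sgn_in] by (simp add: dot_square_norm)
  qed
  ultimately have "(\<lambda>v. fst (\<Psi> (sgn p)) \<bullet> fst (D \<Psi> p (v - (p \<bullet> v) *\<^sub>R p)) +
      fst (D \<Psi> p (v - (p \<bullet> v) *\<^sub>R p)) \<bullet> fst (\<Psi> (sgn p))) = (\<lambda>v. 0)" by (rule has_derivative_unique)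
  from fun_cong[OF this, of v] show ?thesis
    using v S3_in_cone(2)[OF p] by (simp add: tangent_S3_def inner_commute)
qed

text \<open>
  The derivative of \<open>cone_map\<close> at \<open>p\<close> is injective: its first component recovers \<open>p \<bullet> v\<close>, and on vectors
  tangent to the sphere it is \<open>D \<Psi> p\<close>.
\<close>

lemma cone_inv_derivative:
  assumes p: "p \<in> W \<inter> S3"
  obtains g' where "(cone_inv has_derivative g') (at (\<Psi> p))"
    "\<And>z. g' (0, z) \<in> tangent_S3 p \<and> D \<Psi> p (g' (0, z)) = (0, z)"
proof -
  have np: "norm p = 1" using p by (simp add: S3_iff)
  have sp: "sgn p = p" by (rule S3_in_cone(2)[OF p])
  define pr where "pr = (\<lambda>v. v - (p \<bullet> v) *\<^sub>R p)"
  have pr_tan: "pr v \<in> tangent_S3 p" for v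
    using np by (simp add: pr_def tangent_S3_def inner_diff_right dot_square_norm)
  define F' where "F' = (\<lambda>v. ((p \<bullet> v) *\<^sub>R fst (\<Psi> p) + fst (D \<Psi> p (pr v)), snd (D \<Psi> p (pr v))))"
  have d\<Psi>: "((\<lambda>q. \<Psi> (sgn q)) has_derivative (\<lambda>v. D \<Psi> p (pr v))) (at p)"
    unfolding pr_def by (rule has_derivative_chart_sgn[OF p])
  have dn: "(norm has_derivative (\<lambda>v. v \<bullet> sgn p)) (at p)" using np by (intro has_derivative_norm) auto
  have "(cone_map has_derivative (\<lambda>v. (norm p *\<^sub>R fst (D \<Psi> p (pr v)) + (v \<bullet> sgn p) *\<^sub>R fst (\<Psi> (sgn p)), snd (D \<Psi> p (pr v))))) (at p)"
    unfolding cone_map_def[abs_def]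
    by (intro has_derivative_Pair has_derivative_scaleR dn has_derivative_fst has_derivative_snd d\<Psi>)
  then have dF: "(cone_map has_derivative F') (at p)"
    by (simp add: F'_def np sp inner_commute add.commute)
  have key: "p \<bullet> v = fst (\<Psi> p) \<bullet> fst (F' v)" for v
    using chart_tangent_circle[OF p pr_tan[of v]] onto_circle[OF p]
    by (simp add: F'_def inner_add_right dot_square_norm)
  have slice: "v \<in> tangent_S3 p \<and> D \<Psi> p v = (0, z)" if "F' v = (0, z)" for v z
  proof -
    have pv: "p \<bullet> v = 0" using key[of v] that by simp
    then have prv: "pr v = v" by (simp add: pr_def)
    have "fst (D \<Psi> p v) = 0" "snd (D \<Psi> p v) = z" using that pv unfolding F'_def prv by simp_all
    then show ?thesis using pv by (simp add: tangent_S3_def prod_eq_iff)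
  qed
  have lin: "linear F'" using has_derivative_bounded_linear[OF dF] by (rule bounded_linear.linear)
  have "inj F'"
  proof (unfold linear_injective_0[OF lin], intro allI impI)
    fix v assume "F' v = 0"
    then have "v \<in> tangent_S3 p" "D \<Psi> p v = 0" using slice[of v 0] by (simp_all add: zero_prod_def)
    then show "v = 0" by (rule immersive[OF p])
  qed
  then obtain g' where g': "linear g'" "\<And>x. g' (F' x) = x" "\<And>x. F' (g' x) = x"
    using linear_injective_isomorphism[OF lin] by blast
  have "(cone_inv has_derivative g') (at (cone_map p))"
    by (rule has_derivative_inverse_strong[OF open_cone S3_in_cone(1)[OF p] continuous_cone_map cone_inv_map dF])
      (use g'(3) in \<open>auto simp: fun_eq_iff\<close>)
  then have "(cone_inv has_derivative g') (at (\<Psi> p))" using cone_map_S3[OF p] by simp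
  then show ?thesis by (rule that) (use slice g'(3) in blast)
qed

end

lemma adapted_chart_sphere_chart:
  assumes "adapted_chart \<omega> \<gamma> Z W \<Psi>"
  shows "sphere_chart W \<Psi>"
proof
  note a = assms[unfolded adapted_chart_def]
  show "open W" "smooth_on W \<Psi>" "inj_on \<Psi> (W \<inter> S3)" using a by simp_all
  show "norm (fst (\<Psi> p)) = 1" if "p \<in> W \<inter> S3" for p
  proof -
    have "\<Psi> ` (W \<inter> S3) \<subseteq> sphere 0 1 \<times> UNIV" using a openin_imp_subset by blast
    then have "\<Psi> p \<in> sphere 0 1 \<times> UNIV" using that by blast
    then show ?thesis by (simp add: mem_Times_iff)
  qed
  show "v = 0" if "p \<in> W \<inter> S3" "v \<in> tangent_S3 p" "D \<Psi> p v = 0" for p v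
  proof -
    have "\<forall>p\<in>W \<inter> S3. \<forall>v\<in>tangent_S3 p. D \<Psi> p v = 0 \<longrightarrow> v = 0" using a by (elim conjE)
    then show ?thesis using that by blast
  qed
qed

text \<open>
  On the slice over \<open>cis t\<close> the chart is, to first order, the second coordinate of \<open>\<complex>\<^sup>2\<close> divided by that of
  \<open>Z t\<close>: it is a multiple of \<open>omega\<close>, which at \<open>(z1, 0)\<close> is \<open>a z1 dz2\<close>, and the multiple is
  determined by \<open>Z t\<close> being sent to \<open>1\<close>.
\<close>

lemma adapted_chart_slice_derivative:
  assumes ad: "adapted_chart (omega a) \<gamma> Z W \<Psi>" and a: "a \<noteq> 0"
    and \<gamma>: "\<And>t. \<gamma> t = (fst (\<gamma> t), 0)" "\<And>t. norm (fst (\<gamma> t)) = 1" "\<And>t. (\<gamma> has_vector_derivative (\<i> * fst (\<gamma> t) * of_real (r t), 0)) (at t)"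
    and Z: "Z t \<in> tangent_S3 (\<gamma> t)"
  shows "((\<lambda>w. snd (sphere_chart.cone_inv W \<Psi> (cis t, w))) has_field_derivative snd (Z t)) (at 0)"
proof -
  interpret sphere_chart W \<Psi> by (rule adapted_chart_sphere_chart[OF ad])
  note ad' = ad[unfolded adapted_chart_def]
  have \<Psi>\<gamma>: "\<Psi> (\<gamma> t) = (cis t, 0)" for t using ad' by (elim conjE) (rule spec)
  have \<Psi>Z: "snd (D \<Psi> (\<gamma> t) (Z t)) = 1" for t using ad' by (elim conjE) (drule spec[of "\<lambda>t. snd (D \<Psi> (\<gamma> t) (Z t)) = 1" t])
  have gW: "\<gamma> t \<in> W \<inter> S3" for t
  proof -
    have "\<gamma> t \<in> W" using ad' by (elim conjE) blast
    moreover have "\<gamma> t \<in> S3" using \<gamma>(2)[of t] by (subst \<gamma>(1)) (simp add: S3_iff norm_Pair)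
    ultimately show ?thesis by simp
  qed
  have "\<forall>p\<in>W \<inter> S3. \<exists>c. c \<noteq> 0 \<and> (\<forall>v\<in>tangent_S3 p. fst (D \<Psi> p v) = 0 \<longrightarrow> snd (D \<Psi> p v) = c * omega a p v)"
    using ad' by (elim conjE)
  then obtain c where c: "c \<noteq> 0" "\<And>v. v \<in> tangent_S3 (\<gamma> t) \<Longrightarrow> fst (D \<Psi> (\<gamma> t) v) = 0 \<Longrightarrow> snd (D \<Psi> (\<gamma> t) v) = c * omega a (\<gamma> t) v"
    using gW[of t] by blast
  have om: "omega a (\<gamma> t) v = a * fst (\<gamma> t) * snd v" for v by (subst \<gamma>(1)) (simp add: omega_def)
  define \<gamma>' where "\<gamma>' = (\<i> * fst (\<gamma> t) * of_real (r t), 0 :: complex)"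
  have dgam: "(\<gamma> has_vector_derivative \<gamma>') (at t)" using \<gamma>(3)[of t] by (simp add: \<gamma>'_def)
  have d\<Psi>: "(\<Psi> has_derivative D \<Psi> (\<gamma> t)) (at (\<gamma> t))" using smooth_onD(1)[OF smooth] gW by blast
  have lin: "linear (D \<Psi> (\<gamma> t))" using has_derivative_bounded_linear[OF d\<Psi>] by (rule bounded_linear.linear)
  have "((\<lambda>t. \<Psi> (\<gamma> t)) has_vector_derivative D \<Psi> (\<gamma> t) \<gamma>') (at t)"
    using has_derivative_compose[OF dgam[unfolded has_vector_derivative_def] d\<Psi>]
    by (simp add: has_vector_derivative_def linear_scale[OF lin])
  moreover have "((\<lambda>t. \<Psi> (\<gamma> t)) has_vector_derivative (\<i> * cis t, 0)) (at t)"
    unfolding \<Psi>\<gamma> by (intro has_vector_derivative_Pair has_vector_derivative_cis has_vector_derivative_const)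
  ultimately have D\<gamma>: "D \<Psi> (\<gamma> t) \<gamma>' = (\<i> * cis t, 0)" by (rule vector_derivative_unique_at)
  have \<gamma>'_tan: "\<gamma>' \<in> tangent_S3 (\<gamma> t)"
    by (simp add: tangent_S3_def \<gamma>'_def inner_prod_def inner_complex_def algebra_simps)
  define \<rho> where "\<rho> = Im (cnj (cis t) * fst (D \<Psi> (\<gamma> t) (Z t)))"
  have "cis t \<bullet> fst (D \<Psi> (\<gamma> t) (Z t)) = 0" using chart_tangent_circle[OF gW Z] \<Psi>\<gamma>[of t] by simp
  then have fZ: "fst (D \<Psi> (\<gamma> t) (Z t)) = (\<i> * cis t) * of_real \<rho>"
    unfolding \<rho>_def by (intro orthogonal_on_circle) simp_all
  define v where "v = Z t - \<rho> *\<^sub>R \<gamma>'"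
  have Dv: "D \<Psi> (\<gamma> t) v = D \<Psi> (\<gamma> t) (Z t) - \<rho> *\<^sub>R (\<i> * cis t, 0)"
    by (simp only: v_def linear_diff[OF lin] linear_scale[OF lin] D\<gamma>)
  have "v \<in> tangent_S3 (\<gamma> t)" using Z \<gamma>'_tan by (simp add: v_def tangent_S3_def inner_diff_right)
  moreover have "fst (D \<Psi> (\<gamma> t) v) = 0" unfolding Dv by (simp add: fZ scaleR_conv_of_real)
  ultimately have "snd (D \<Psi> (\<gamma> t) v) = c * omega a (\<gamma> t) v" by (rule c(2))
  then have one: "1 = c * (a * fst (\<gamma> t) * snd (Z t))" unfolding om Dv by (simp add: v_def \<gamma>'_def \<Psi>Z)
  obtain g' where g': "(cone_inv has_derivative g') (at (\<Psi> (\<gamma> t)))"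
    "\<And>z. g' (0, z) \<in> tangent_S3 (\<gamma> t) \<and> D \<Psi> (\<gamma> t) (g' (0, z)) = (0, z)"
    by (rule cone_inv_derivative[OF gW]) (rule that)
  have sg: "snd (g' (0, w)) = snd (Z t) * w" for w
  proof -
    have "w = c * omega a (\<gamma> t) (g' (0, w))" using c(2)[of "g' (0, w)"] g'(2)[of w] by simp
    also have "\<dots> = (c * (a * fst (\<gamma> t))) * snd (g' (0, w))" by (simp add: om)
    finally have w: "w = (c * (a * fst (\<gamma> t))) * snd (g' (0, w))" .
    have "snd (g' (0, w)) = 1 * snd (g' (0, w))" by simp
    also have "\<dots> = snd (Z t) * ((c * (a * fst (\<gamma> t))) * snd (g' (0, w)))" by (subst one) (simp add: mult_ac)
    finally show ?thesis using w by simp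
  qed
  have "((\<lambda>w. (cis t, w)) has_derivative (\<lambda>w. (0, w))) (at 0)"
    by (intro has_derivative_Pair has_derivative_const has_derivative_ident)
  from has_derivative_snd[OF has_derivative_compose[OF this g'(1)[unfolded \<Psi>\<gamma>]]]
  show ?thesis unfolding has_field_derivative_def sg .
qed

text \<open>
  A point of the sphere with small second component is near the circle, and the first component of the
  chart tells near which point of it.  Proved by contradiction with a convergent subsequence.
\<close>

lemma tube_closeness:
  assumes ad: "adapted_chart \<omega> \<gamma> Z W \<Psi>" and cont: "continuous_on UNIV \<gamma>" and ran: "range \<gamma> = hopf_circle" and \<eta>: "\<eta> > 0"
  obtains \<epsilon> where "\<epsilon> > 0" "\<And>p t. p \<in> W \<inter> S3 \<Longrightarrow> t \<in> {0..2 * pi} \<Longrightarrow> norm (snd p) \<le> \<epsilon> \<Longrightarrow> fst (\<Psi> p) = cis t \<Longrightarrow> norm (p - \<gamma> t) < \<eta>"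
proof (rule ccontr)
  assume neg: "\<not> thesis"
  interpret sphere_chart W \<Psi> by (rule adapted_chart_sphere_chart[OF ad])
  note ad' = ad[unfolded adapted_chart_def]
  have \<Psi>\<gamma>: "\<Psi> (\<gamma> t) = (cis t, 0)" for t using ad' by (elim conjE) (rule spec)
  have gW: "\<gamma> t \<in> W \<inter> S3" for t
  proof -
    have "\<gamma> t \<in> W" using ad' by (elim conjE) blast
    moreover have "\<gamma> t \<in> hopf_circle" using ran by blast
    then have "\<gamma> t \<in> S3" by (auto simp: S3_iff norm_Pair)
    ultimately show ?thesis by simp
  qed
  have ex: "\<exists>p t. p \<in> W \<inter> S3 \<and> t \<in> {0..2 * pi} \<and> norm (snd p) \<le> inverse (real (Suc n)) \<and> fst (\<Psi> p) = cis t \<and> \<not> norm (p - \<gamma> t) < \<eta>" for n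
  proof (rule ccontr)
    assume "\<not> ?thesis"
    then have "norm (p - \<gamma> t) < \<eta>" if "p \<in> W \<inter> S3" "t \<in> {0..2 * pi}" "norm (snd p) \<le> inverse (real (Suc n))" "fst (\<Psi> p) = cis t" for p t
      using that by blast
    then show False using neg that[of "inverse (real (Suc n))"] by simp
  qed
  obtain p where ex': "\<forall>n. \<exists>t. p n \<in> W \<inter> S3 \<and> t \<in> {0..2 * pi} \<and> norm (snd (p n)) \<le> inverse (real (Suc n)) \<and>
      fst (\<Psi> (p n)) = cis t \<and> \<not> norm (p n - \<gamma> t) < \<eta>"
    using choice[OF allI[OF ex]] ..
  obtain t where "\<forall>n. p n \<in> W \<inter> S3 \<and> t n \<in> {0..2 * pi} \<and> norm (snd (p n)) \<le> inverse (real (Suc n)) \<and>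
      fst (\<Psi> (p n)) = cis (t n) \<and> \<not> norm (p n - \<gamma> (t n)) < \<eta>"
    using choice[OF ex'] ..
  then have pt: "\<And>n. p n \<in> W \<inter> S3" "\<And>n. t n \<in> {0..2 * pi}" "\<And>n. norm (snd (p n)) \<le> inverse (real (Suc n))"
    "\<And>n. fst (\<Psi> (p n)) = cis (t n)" "\<And>n. \<not> norm (p n - \<gamma> (t n)) < \<eta>"
    by blast+
  have comp: "compact (S3 \<times> {0..2 * pi})" unfolding S3_def by (intro compact_Times) auto
  have pS: "\<forall>n. (p n, t n) \<in> S3 \<times> {0..2 * pi}" using pt(1,2) by simp
  obtain l \<sigma> where l: "l \<in> S3 \<times> {0..2 * pi}" "strict_mono \<sigma>" "((\<lambda>n. (p n, t n)) \<circ> \<sigma>) \<longlonglongrightarrow> l"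
    by (rule seq_compactE[OF compact_imp_seq_compact[OF comp] pS]) (rule that)
  obtain q s where qs: "l = (q, s)" by (cases l)
  have lim_p: "(\<lambda>n. p (\<sigma> n)) \<longlonglongrightarrow> q" and lim_t: "(\<lambda>n. t (\<sigma> n)) \<longlonglongrightarrow> s"
    using tendsto_fst[OF l(3)] tendsto_snd[OF l(3)] by (simp_all add: qs o_def)
  have "(\<lambda>n. norm (snd (p (\<sigma> n)))) \<longlonglongrightarrow> 0"
  proof (rule tendsto_sandwich[OF _ _ tendsto_const])
    show "(\<lambda>n. inverse (real (Suc (\<sigma> n)))) \<longlonglongrightarrow> 0"
      using LIMSEQ_subseq_LIMSEQ[OF LIMSEQ_inverse_real_of_nat l(2)] by (simp add: o_def)
  qed (use pt(3) in auto)
  moreover have "(\<lambda>n. norm (snd (p (\<sigma> n)))) \<longlonglongrightarrow> norm (snd q)" by (intro tendsto_intros lim_p)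
  ultimately have "norm (snd q) = 0" using LIMSEQ_unique by blast
  then have "q \<in> hopf_circle" using l(1) by (auto simp: qs S3_iff mem_Times_iff norm_Pair norm_prod_def)
  then obtain \<tau> where \<tau>: "q = \<gamma> \<tau>" using ran by blast
  have "isCont \<Psi> q"
    using smooth_on_continuous[OF smooth] open_W gW[of \<tau>] \<tau> by (simp add: continuous_on_eq_continuous_at)
  then have "(\<lambda>n. \<Psi> (p (\<sigma> n))) \<longlonglongrightarrow> \<Psi> q" using lim_p by (rule isCont_tendsto_compose)
  then have "(\<lambda>n. cis (t (\<sigma> n))) \<longlonglongrightarrow> cis \<tau>" using tendsto_fst[of "\<lambda>n. \<Psi> (p (\<sigma> n))"] by (fastforce simp: pt(4) \<tau> \<Psi>\<gamma>)
  moreover have "(\<lambda>n. cis (t (\<sigma> n))) \<longlonglongrightarrow> cis s" unfolding cis_conv_exp by (intro tendsto_intros lim_t)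
  ultimately have "cis \<tau> = cis s" using LIMSEQ_unique by blast
  then have "\<Psi> (\<gamma> \<tau>) = \<Psi> (\<gamma> s)" by (simp add: \<Psi>\<gamma>)
  then have qs': "q = \<gamma> s" using inj_onD[OF inj] gW \<tau> by blast
  have "(\<lambda>n. \<gamma> (t (\<sigma> n))) \<longlonglongrightarrow> \<gamma> s"
    by (rule isCont_tendsto_compose[OF _ lim_t]) (use cont in \<open>simp add: continuous_on_eq_continuous_at\<close>)
  then have "(\<lambda>n. norm (p (\<sigma> n) - \<gamma> (t (\<sigma> n)))) \<longlonglongrightarrow> norm (q - \<gamma> s)" by (intro tendsto_intros lim_p)
  then have "\<eta> \<le> norm (q - \<gamma> s)" by (rule tendsto_lowerbound) (use pt(5) in \<open>auto simp: not_less\<close>)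
  then show False using qs' \<eta> by simp
qed

text \<open>
  On a leaf \<open>a z1 dz2 = (1 - a) z2 dz1\<close>, so \<open>z2 exp(- (1 - a)/a log z1)\<close> is constant.  As long as the curve
  stays near the circle point of angle \<open>\<theta> t\<close>, a continuous logarithm of \<open>z1\<close> is given by \<open>\<i> \<theta>\<close> plus the
  principal logarithm of the ratio \<open>u\<close>, which is near \<open>1\<close>.
\<close>

lemma leaf_curve_explicit:
  fixes c :: "real \<Rightarrow> C2" and \<theta> :: "real \<Rightarrow> real" and u0 :: complex
  assumes a: "a \<noteq> 0" and u0: "norm u0 = 1" and T: "T \<in> {0..2 * pi}"
    and \<theta>: "\<theta> 0 = 0" "\<And>t. t \<in> {0..2 * pi} \<Longrightarrow> (\<theta> has_vector_derivative r t) (at t within {0..2 * pi})"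
    and c: "\<And>t. t \<in> {0..2 * pi} \<Longrightarrow> (c has_vector_derivative c' t) (at t within {0..2 * pi})"
    and leaf: "\<And>t. t \<in> {0..2 * pi} \<Longrightarrow> omega a (c t) (c' t) = 0"
    and near: "\<And>t. t \<in> {0..T} \<Longrightarrow> norm (c t - (u0 * cis (\<theta> t), 0)) < 1/2"
  defines "u \<equiv> \<lambda>t. fst (c t) * cis (- \<theta> t) * cnj u0"
  shows "\<And>t. t \<in> {0..T} \<Longrightarrow> norm (u t - 1) < 1/2"
    "snd (c T) = snd (c 0) * exp ((1 - a) / a * (\<i> * \<theta> T + Ln (u T) - Ln (u 0)))"
proof -
  define \<kappa> where "\<kappa> = (1 - a) / a"
  have u00: "u0 * cnj u0 = 1" using u0 by (simp add: complex_norm_square[symmetric])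
  have sub: "{0..T} \<subseteq> {0..2 * pi}" using T by auto
  show u1: "norm (u t - 1) < 1/2" if t: "t \<in> {0..T}" for t
  proof -
    have "cis (\<theta> t) * cis (- \<theta> t) = 1" by (simp add: cis_mult)
    then have "u t - 1 = (fst (c t) - u0 * cis (\<theta> t)) * (cis (- \<theta> t) * cnj u0)"
      using u00 unfolding u_def by algebra
    then have "norm (u t - 1) = norm (fst (c t - (u0 * cis (\<theta> t), 0)))" using u0 by (simp add: norm_mult)
    also have "\<dots> \<le> norm (c t - (u0 * cis (\<theta> t), 0))" by (metis norm_fst_le prod.collapse)
    finally show ?thesis using near[OF t] by simp
  qed
  have upos: "u t \<notin> \<real>\<^sub>\<le>\<^sub>0" if t: "t \<in> {0..T}" for t
  proof -
    have "\<bar>Re (u t - 1)\<bar> < 1/2" using u1[OF t] abs_Re_le_cmod[of "u t - 1"] by linarith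
    then show ?thesis by (auto simp: complex_nonpos_Reals_iff)
  qed
  define Y where "Y = (\<lambda>t. snd (c t) * exp (- \<kappa> * (\<i> * of_real (\<theta> t) + Ln (u t))))"
  have dY: "(Y has_vector_derivative 0) (at t within {0..T})" if t: "t \<in> {0..T}" for t
  proof -
    have t2: "t \<in> {0..2 * pi}" using t sub by blast
    have ut: "u t \<noteq> 0" using upos[OF t] by auto
    have dc: "(c has_vector_derivative c' t) (at t within {0..T})"
      using c[OF t2] sub by (rule has_vector_derivative_within_subset)
    have d\<theta>: "(\<theta> has_vector_derivative r t) (at t within {0..T})"
      using \<theta>(2)[OF t2] sub by (rule has_vector_derivative_within_subset)
    have dc1: "((\<lambda>t. fst (c t)) has_vector_derivative fst (c' t)) (at t within {0..T})"
      and dc2: "((\<lambda>t. snd (c t)) has_vector_derivative snd (c' t)) (at t within {0..T})"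
      using bounded_linear.has_vector_derivative[OF bounded_linear_fst dc]
        bounded_linear.has_vector_derivative[OF bounded_linear_snd dc] by simp_all
    have dcis: "((\<lambda>t. cis (- \<theta> t)) has_vector_derivative - r t *\<^sub>R (\<i> * cis (- \<theta> t))) (at t within {0..T})"
      using vector_diff_chain_within[OF has_vector_derivative_minus[OF d\<theta>]
          has_vector_derivative_at_within[OF has_vector_derivative_cis[of "- \<theta> t"]]]
      by (simp add: o_def)
    define u' where "u' = (fst (c' t) * cis (- \<theta> t) - \<i> * r t * (fst (c t) * cis (- \<theta> t))) * cnj u0"
    have du: "(u has_vector_derivative u') (at t within {0..T})"
      unfolding u_def
      by (rule has_vector_derivative_eq_rhs[OF has_vector_derivative_mult_left[OF has_vector_derivative_mult[OF dc1 dcis]]])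
        (simp add: u'_def scaleR_conv_of_real algebra_simps)
    have dLn: "((\<lambda>t. Ln (u t)) has_vector_derivative u' * inverse (u t)) (at t within {0..T})"
      using field_vector_diff_chain_within[OF du, of Ln "inverse (u t)"]
        has_field_derivative_at_within[OF has_field_derivative_Ln[OF upos[OF t]]] by (simp add: o_def)
    have d\<theta>': "((\<lambda>t. \<i> * of_real (\<theta> t)) has_vector_derivative \<i> * of_real (r t)) (at t within {0..T})"
      using has_vector_derivative_mult_right[OF has_vector_derivative_of_real[OF d\<theta>[folded has_real_derivative_iff_has_vector_derivative]]] .
    define m where "m = (\<lambda>t. - \<kappa> * (\<i> * of_real (\<theta> t) + Ln (u t)))"
    have dm: "(m has_vector_derivative - \<kappa> * (\<i> * of_real (r t) + u' * inverse (u t))) (at t within {0..T})"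
      unfolding m_def by (intro has_vector_derivative_mult_right has_vector_derivative_add d\<theta>' dLn)
    have dexp: "((\<lambda>t. exp (m t)) has_vector_derivative (- \<kappa> * (\<i> * of_real (r t) + u' * inverse (u t))) * exp (m t)) (at t within {0..T})"
      using field_vector_diff_chain_within[OF dm has_field_derivative_at_within[OF DERIV_exp]]
      by (simp add: o_def)
    have "(Y has_vector_derivative snd (c t) * ((- \<kappa> * (\<i> * of_real (r t) + u' * inverse (u t))) * exp (m t)) + snd (c' t) * exp (m t)) (at t within {0..T})"
      unfolding Y_def m_def[symmetric] using has_vector_derivative_mult[OF dc2 dexp] by (simp add: m_def)
    moreover have "snd (c t) * ((- \<kappa> * (\<i> * of_real (r t) + u' * inverse (u t))) * exp (m t)) + snd (c' t) * exp (m t) = 0"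
    proof -
      have c1: "fst (c t) \<noteq> 0" using ut by (auto simp: u_def)
      have "u' = u t * (fst (c' t) / fst (c t) - \<i> * of_real (r t))"
        using c1 by (simp add: u'_def u_def field_simps)
      then have "u' * inverse (u t) = fst (c' t) / fst (c t) - \<i> * of_real (r t)" using ut by simp
      then have "\<i> * of_real (r t) + u' * inverse (u t) = fst (c' t) / fst (c t)" by simp
      moreover have "snd (c' t) = \<kappa> * snd (c t) * (fst (c' t) / fst (c t))"
        using leaf[OF t2] c1 a by (simp add: omega_def \<kappa>_def field_simps)
      ultimately show ?thesis by (simp add: algebra_simps)
    qed
    ultimately show ?thesis by simp
  qed
  then have "\<exists>k. \<forall>t\<in>{0..T}. Y t = k"
    by (intro has_derivative_zero_constant) (simp_all add: has_vector_derivative_def)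
  then have "Y T = Y 0" using T by force
  then have "snd (c T) * exp (- (\<kappa> * (\<i> * of_real (\<theta> T) + Ln (u T)))) = snd (c 0) * exp (- (\<kappa> * Ln (u 0)))"
    by (simp add: Y_def \<theta>(1))
  then have "snd (c T) * (exp (- (\<kappa> * (\<i> * of_real (\<theta> T) + Ln (u T)))) * exp (\<kappa> * (\<i> * of_real (\<theta> T) + Ln (u T)))) =
      snd (c 0) * (exp (- (\<kappa> * Ln (u 0))) * exp (\<kappa> * (\<i> * of_real (\<theta> T) + Ln (u T))))"
    by (simp only: mult.assoc[symmetric])
  then have "snd (c T) = snd (c 0) * exp (\<kappa> * (\<i> * of_real (\<theta> T) + Ln (u T)) - \<kappa> * Ln (u 0))"
    by (simp add: exp_add[symmetric])
  then show "snd (c T) = snd (c 0) * exp ((1 - a) / a * (\<i> * \<theta> T + Ln (u T) - Ln (u 0)))"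
    by (simp add: \<kappa>_def[symmetric] algebra_simps)
qed

section \<open>Linear holonomy along the circle\<close>

lemma norm_Ln_near_1:
  assumes "norm (u - 1) < 1/2"
  shows "norm (Ln u) \<le> 1"
  using norm_Ln_le[of "u - 1"] assms by simp

text \<open>
  Bootstrapping: while \<open>snd (c t)\<close> is at most \<open>\<epsilon>\<close>, the explicit formula bounds it by \<open>C\<close> times its initial
  value, which is less than \<open>\<epsilon>\<close>; so it cannot reach \<open>\<epsilon>\<close>.
\<close>

lemma leaf_curve_stays_near:
  fixes c :: "real \<Rightarrow> C2" and \<theta> :: "real \<Rightarrow> real" and u0 :: complex
  assumes a: "a \<noteq> 0" and u0: "norm u0 = 1"
    and \<theta>: "\<theta> 0 = 0" "\<And>t. t \<in> {0..2 * pi} \<Longrightarrow> (\<theta> has_vector_derivative r t) (at t within {0..2 * pi})"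
    and B: "\<And>t. t \<in> {0..2 * pi} \<Longrightarrow> \<bar>\<theta> t\<bar> \<le> B"
    and c: "\<And>t. t \<in> {0..2 * pi} \<Longrightarrow> (c has_vector_derivative c' t) (at t within {0..2 * pi})"
    and leaf: "\<And>t. t \<in> {0..2 * pi} \<Longrightarrow> omega a (c t) (c' t) = 0"
    and tube: "\<And>t. t \<in> {0..2 * pi} \<Longrightarrow> norm (snd (c t)) \<le> \<epsilon> \<Longrightarrow> norm (c t - (u0 * cis (\<theta> t), 0)) < 1/2"
    and C: "C = exp (norm ((1 - a) / a) * (B + 2))"
    and start: "norm (snd (c 0)) * C < \<epsilon>"
    and t: "t \<in> {0..2 * pi}"
  shows "norm (snd (c t)) \<le> norm (snd (c 0)) * C" "norm (snd (c t)) < \<epsilon>"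
proof -
  define \<kappa> where "\<kappa> = (1 - a) / a"
  have B0: "B \<ge> 0" using B[of 0] \<theta>(1) by simp
  have C1: "C \<ge> 1" unfolding C using B0 by simp
  have cont: "continuous_on {0..2 * pi} (\<lambda>t. norm (snd (c t)))"
  proof -
    have "continuous_on {0..2 * pi} c"
      unfolding continuous_on_eq_continuous_within using has_vector_derivative_continuous[OF c] by blast
    then show ?thesis by (intro continuous_intros)
  qed
  have step: "norm (snd (c T)) \<le> norm (snd (c 0)) * C"
    if T: "T \<in> {0..2 * pi}" and small: "\<And>t. t \<in> {0..T} \<Longrightarrow> norm (snd (c t)) \<le> \<epsilon>" for T
  proof -
    have near: "norm (c t - (u0 * cis (\<theta> t), 0)) < 1/2" if "t \<in> {0..T}" for t
      using that T by (intro tube small) auto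
    have e: "\<And>t. t \<in> {0..T} \<Longrightarrow> norm (fst (c t) * cis (- \<theta> t) * cnj u0 - 1) < 1/2"
      "snd (c T) = snd (c 0) * exp ((1 - a) / a * (\<i> * \<theta> T + Ln (fst (c T) * cis (- \<theta> T) * cnj u0) -
          Ln (fst (c 0) * cis (- \<theta> 0) * cnj u0)))"
      by (rule leaf_curve_explicit[OF a u0 T \<theta> c leaf near]; assumption)+
    define u where "u = (\<lambda>t. fst (c t) * cis (- \<theta> t) * cnj u0)"
    have u: "norm (Ln (u T)) \<le> 1" "norm (Ln (u 0)) \<le> 1"
    proof -
      have "norm (u s - 1) < 1/2" if "s \<in> {0..T}" for s unfolding u_def by (rule e(1)[OF that])
      then show "norm (Ln (u T)) \<le> 1" "norm (Ln (u 0)) \<le> 1" using T by (auto intro!: norm_Ln_near_1)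
    qed
    have "norm (\<i> * of_real (\<theta> T) + Ln (u T) - Ln (u 0)) \<le> norm (\<i> * of_real (\<theta> T)) + norm (Ln (u T)) + norm (Ln (u 0))"
      using norm_triangle_ineq4[of "\<i> * of_real (\<theta> T) + Ln (u T)" "Ln (u 0)"] norm_triangle_ineq[of "\<i> * of_real (\<theta> T)" "Ln (u T)"] by linarith
    also have "\<dots> \<le> B + 2" using u B[OF T] by (simp add: norm_mult)
    finally have "norm (\<kappa> * (\<i> * of_real (\<theta> T) + Ln (u T) - Ln (u 0))) \<le> norm \<kappa> * (B + 2)"
      unfolding norm_mult by (rule mult_left_mono) simp
    then have "norm (exp (\<kappa> * (\<i> * of_real (\<theta> T) + Ln (u T) - Ln (u 0)))) \<le> C"
      unfolding C \<kappa>_def[symmetric] by (intro order_trans[OF norm_exp]) simp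
    then have "norm (snd (c 0)) * norm (exp (\<kappa> * (\<i> * of_real (\<theta> T) + Ln (u T) - Ln (u 0)))) \<le> norm (snd (c 0)) * C"
      by (rule mult_left_mono) simp
    then show ?thesis using e(2) unfolding u_def \<kappa>_def by (simp only: norm_mult)
  qed
  have all: "norm (snd (c t)) < \<epsilon>" if t: "t \<in> {0..2 * pi}" for t
  proof (rule ccontr)
    assume "\<not> norm (snd (c t)) < \<epsilon>"
    define A where "A = {t \<in> {0..2 * pi}. \<epsilon> \<le> norm (snd (c t))}"
    have A: "t \<in> A" using t \<open>\<not> norm (snd (c t)) < \<epsilon>\<close> by (simp add: A_def)
    have "closed A"
      using continuous_closed_preimage[OF cont closed_real_atLeastAtMost closed_atLeast, of \<epsilon>]
      by (simp add: A_def vimage_def Int_def)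
    moreover have bdd: "bdd_below A" by (rule bdd_belowI[of _ 0]) (simp add: A_def)
    ultimately have T: "Inf A \<in> A" using A closed_contains_Inf by blast
    have least: "norm (snd (c s)) < \<epsilon>" if "s \<in> {0..<Inf A}" for s
    proof (rule ccontr)
      assume "\<not> norm (snd (c s)) < \<epsilon>"
      then have "s \<in> A" using that T by (simp add: A_def)
      then have "Inf A \<le> s" using bdd cInf_lower by blast
      then show False using that by simp
    qed
    \<comment> \<open>\<open>T0\<close> is the first time at which \<open>snd (c t)\<close> reaches \<open>\<epsilon>\<close>.\<close>
    define T0 where "T0 = Inf A"
    have T0: "T0 \<in> {0..2 * pi}" "\<epsilon> \<le> norm (snd (c T0))" using T by (simp_all add: A_def T0_def)
    have start': "norm (snd (c 0)) < \<epsilon>"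
      using start C1 mult_left_mono[OF C1, of "norm (snd (c 0))"] by simp
    then have "T0 > 0" using T0 by (cases "T0 = 0") auto
    have "norm (snd (c T0)) \<le> \<epsilon>"
    proof -
      have "closure {0..<T0} \<subseteq> {s \<in> {0..2 * pi}. norm (snd (c s)) \<le> \<epsilon>}"
      proof (rule closure_minimal)
        show "{0..<T0} \<subseteq> {s \<in> {0..2 * pi}. norm (snd (c s)) \<le> \<epsilon>}"
          using least T0(1) by (auto simp: T0_def less_imp_le)
        show "closed {s \<in> {0..2 * pi}. norm (snd (c s)) \<le> \<epsilon>}"
          using continuous_closed_preimage[OF cont closed_real_atLeastAtMost closed_atMost, of \<epsilon>]
          by (simp add: vimage_def Int_def)
      qed
      moreover have "T0 \<in> closure {0..<T0}" using \<open>T0 > 0\<close> by simp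
      ultimately show ?thesis by blast
    qed
    then have "norm (snd (c s)) \<le> \<epsilon>" if "s \<in> {0..T0}" for s
      using that least[of s] by (cases "s = T0") (auto simp: T0_def less_imp_le)
    then have "norm (snd (c T0)) \<le> norm (snd (c 0)) * C" by (rule step[OF T0(1)])
    then show False using start T0(2) by simp
  qed
  then show "norm (snd (c t)) < \<epsilon>" using t by simp
  show "norm (snd (c t)) \<le> norm (snd (c 0)) * C"
    using all t by (intro step) (auto intro!: less_imp_le)
qed

text \<open>
  The second component \<open>S\<close> of the inverse chart converts the holonomy germ into the second coordinate of
  the leaf curve.  By the explicit formula this coordinate at time \<open>t\<close> is the initial one times a factor
  that tends to \<open>exp ((1 - a)/a \<i> \<theta> t)\<close> as the leaf tends to the circle.  Both sides are the derivative at
  \<open>0\<close> of the same function of \<open>z\<close>.  Only the leaf curves of the single points \<open>z\<close> are given, so all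
  limits are taken at a fixed time.
\<close>

lemma holonomy_derivative:
  assumes a: "a \<noteq> 0" and ad: "adapted_chart (omega a) \<gamma> Z W \<Psi>" and hol: "leaf_holonomy (omega a) W \<Psi> \<phi>"
    and ran: "range \<gamma> = hopf_circle" and cont\<gamma>: "continuous_on UNIV \<gamma>"
    and \<gamma>: "\<And>t. \<gamma> t = (fst (\<gamma> t), 0)" "\<And>t. norm (fst (\<gamma> t)) = 1"
      "\<And>t. (\<gamma> has_vector_derivative (\<i> * fst (\<gamma> t) * of_real (r t), 0)) (at t)"
    and \<theta>: "\<theta> 0 = 0" "\<And>t. t \<in> {0..2 * pi} \<Longrightarrow> (\<theta> has_vector_derivative r t) (at t within {0..2 * pi})"
      "\<And>t. t \<in> {0..2 * pi} \<Longrightarrow> fst (\<gamma> t) = fst (\<gamma> 0) * cis (\<theta> t)" "continuous_on {0..2 * pi} \<theta>"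
    and Z: "\<And>t. t \<in> {0..2 * pi} \<Longrightarrow> Z t \<in> tangent_S3 (\<gamma> t)"
    and t: "t \<in> {0..2 * pi}" and d: "(\<phi> t has_field_derivative d) (at 0)"
  shows "snd (Z t) * d = snd (Z 0) * exp ((1 - a) / a * (\<i> * \<theta> t))"
proof -
  interpret sphere_chart W \<Psi> by (rule adapted_chart_sphere_chart[OF ad])
  define \<kappa> where "\<kappa> = (1 - a) / a"
  define u0 where "u0 = fst (\<gamma> 0)"
  have u0: "norm u0 = 1" by (simp add: u0_def \<gamma>(2))
  have \<gamma>u: "\<gamma> s = (u0 * cis (\<theta> s), 0)" if "s \<in> {0..2 * pi}" for s
    using \<gamma>(1)[of s] \<theta>(3)[OF that] by (simp add: u0_def)
  have \<Psi>\<gamma>: "\<Psi> (\<gamma> t) = (cis t, 0)" for t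
    using ad unfolding adapted_chart_def by (elim conjE) (rule spec)
  have gW: "\<gamma> t \<in> W \<inter> S3" for t
  proof -
    have "\<gamma> t \<in> W" using ad unfolding adapted_chart_def by (elim conjE) blast
    moreover have "\<gamma> t \<in> hopf_circle" using ran by blast
    then have "\<gamma> t \<in> S3" by (auto simp: S3_iff norm_Pair)
    ultimately show ?thesis by simp
  qed
  define S where "S = (\<lambda>s w. snd (cone_inv (cis s, w)))"
  have dS: "(S s has_field_derivative snd (Z s)) (at 0)" if "s \<in> {0..2 * pi}" for s
    unfolding S_def by (rule adapted_chart_slice_derivative[OF ad a \<gamma> Z[OF that]])
  have S0: "S s 0 = 0" for s
    using cone_inv_chart[OF gW[of s]] \<gamma>(1)[of s] by (simp add: S_def \<Psi>\<gamma>) (metis snd_conv)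
  obtain r0 where r0: "r0 > 0" "\<forall>z\<in>ball 0 r0. \<phi> 0 z = z \<and>
         (\<exists>c c'. \<forall>t\<in>{0..2 * pi}.
            c t \<in> W \<inter> S3 \<and> \<Psi> (c t) = (cis t, \<phi> t z) \<and>
            (c has_vector_derivative c' t) (at t within {0..2 * pi}) \<and>
            positive_leaf_vector (omega a) (c t) (c' t))"
    using hol unfolding leaf_holonomy_def by blast
  have "\<forall>z\<in>ball 0 r0. \<exists>c c'. \<forall>t\<in>{0..2 * pi}.
            c t \<in> W \<inter> S3 \<and> \<Psi> (c t) = (cis t, \<phi> t z) \<and>
            (c has_vector_derivative c' t) (at t within {0..2 * pi}) \<and>
            positive_leaf_vector (omega a) (c t) (c' t)" using r0(2) by blast
  from bchoice[OF this] obtain c where "\<forall>z\<in>ball 0 r0. \<exists>c'. \<forall>t\<in>{0..2 * pi}.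
            c z t \<in> W \<inter> S3 \<and> \<Psi> (c z t) = (cis t, \<phi> t z) \<and>
            (c z has_vector_derivative c' t) (at t within {0..2 * pi}) \<and>
            positive_leaf_vector (omega a) (c z t) (c' t)" ..
  from bchoice[OF this] obtain c' where cc': "\<forall>z\<in>ball 0 r0. \<forall>t\<in>{0..2 * pi}.
            c z t \<in> W \<inter> S3 \<and> \<Psi> (c z t) = (cis t, \<phi> t z) \<and>
            (c z has_vector_derivative c' z t) (at t within {0..2 * pi}) \<and>
            positive_leaf_vector (omega a) (c z t) (c' z t)" ..
  have c: "c z s \<in> W \<inter> S3" "\<Psi> (c z s) = (cis s, \<phi> s z)"
    "(c z has_vector_derivative c' z s) (at s within {0..2 * pi})" "omega a (c z s) (c' z s) = 0"
    if "z \<in> ball 0 r0" "s \<in> {0..2 * pi}" for z s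
    using cc' that unfolding positive_leaf_vector_def by blast+
  have cS: "snd (c z s) = S s (\<phi> s z)" if "z \<in> ball 0 r0" "s \<in> {0..2 * pi}" for z s
    using cone_inv_chart[OF c(1)[OF that]] c(2)[OF that] by (simp add: S_def)
  have I0: "0 \<in> {0..2 * pi}" by simp
  have cS0: "snd (c z 0) = S 0 z" if "z \<in> ball 0 r0" for z using cS[OF that I0] r0(2) that by simp
  obtain B where B: "\<And>s. s \<in> {0..2 * pi} \<Longrightarrow> \<bar>\<theta> s\<bar> \<le> B"
  proof -
    have "bounded (\<theta> ` {0..2 * pi})" by (intro compact_imp_bounded compact_continuous_image \<theta>(4)) simp
    then obtain b where "\<forall>x\<in>\<theta> ` {0..2 * pi}. norm x \<le> b" unfolding bounded_iff by blast
    then show thesis by (intro that[of b]) simp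
  qed
  define C where "C = exp (norm \<kappa> * (B + 2))"
  have C0: "C > 0" by (simp add: C_def)
  obtain \<epsilon>1 where \<epsilon>1: "\<epsilon>1 > 0" "\<And>p t. p \<in> W \<inter> S3 \<Longrightarrow> t \<in> {0..2 * pi} \<Longrightarrow> norm (snd p) \<le> \<epsilon>1 \<Longrightarrow> fst (\<Psi> p) = cis t \<Longrightarrow> norm (p - \<gamma> t) < 1/2"
    by (rule tube_closeness[OF ad cont\<gamma> ran, of "1/2"]) (simp, rule that)
  have tube: "norm (c z s - (u0 * cis (\<theta> s), 0)) < 1/2" if "z \<in> ball 0 r0" "s \<in> {0..2 * pi}" "norm (snd (c z s)) \<le> \<epsilon>1" for z s
    using \<epsilon>1(2)[OF c(1)[OF that(1,2)] that(2,3)] c(2)[OF that(1,2)] \<gamma>u[OF that(2)] by simp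
  have stay: "norm (snd (c z s)) \<le> norm (S 0 z) * C" "norm (snd (c z s)) < \<epsilon>1"
    if z: "z \<in> ball 0 r0" "norm (S 0 z) * C < \<epsilon>1" and s: "s \<in> {0..2 * pi}" for z s
  proof -
    have start: "norm (snd (c z 0)) * C < \<epsilon>1" using z(2) cS0[OF z(1)] by simp
    have Ceq: "C = exp (norm ((1 - a) / a) * (B + 2))" by (simp add: C_def \<kappa>_def)
    have "norm (snd (c z s)) \<le> norm (snd (c z 0)) * C"
      by (rule leaf_curve_stays_near(1)[OF a u0 \<theta>(1,2) B c(3,4)[OF z(1)] tube[OF z(1)] Ceq start s]; assumption)
    then show "norm (snd (c z s)) \<le> norm (S 0 z) * C" using cS0[OF z(1)] by simp
    show "norm (snd (c z s)) < \<epsilon>1"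
      by (rule leaf_curve_stays_near(2)[OF a u0 \<theta>(1,2) B c(3,4)[OF z(1)] tube[OF z(1)] Ceq start s]; assumption)
  qed
  define u where "u = (\<lambda>z s. fst (c z s) * cis (- \<theta> s) * cnj u0)"
  have expl: "snd (c z t) = S 0 z * exp (\<kappa> * (\<i> * \<theta> t + Ln (u z t) - Ln (u z 0)))"
    if z: "z \<in> ball 0 r0" "norm (S 0 z) * C < \<epsilon>1" for z
    unfolding u_def \<kappa>_def cS0[OF z(1), symmetric]
  proof (rule leaf_curve_explicit(2)[OF a u0 t \<theta>(1,2) c(3,4)[OF z(1)]]; (assumption)?)
    fix s assume "s \<in> {0..t}"
    then have s: "s \<in> {0..2 * pi}" using t by auto
    show "norm (c z s - (u0 * cis (\<theta> s), 0)) < 1 / 2"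
      by (rule tube[OF z(1) s less_imp_le[OF stay(2)[OF z s]]])
  qed
  have isCont_S: "isCont (S 0) 0" using dS[OF I0] by (rule DERIV_isCont)
  then have S_lim: "(\<lambda>z. norm (S 0 z) * C) \<midarrow>0\<rightarrow> 0"
    unfolding isCont_def S0 by (intro tendsto_eq_intros) auto
  have ev_r0: "\<forall>\<^sub>F z in at 0. z \<in> ball 0 r0" using r0(1) by (intro eventually_at_in_open') auto
  have u_lim: "(\<lambda>z. u z s) \<midarrow>0\<rightarrow> 1" if s: "s \<in> {0..2 * pi}" for s
  proof (rule tendstoI)
    fix \<eta> :: real assume \<eta>: "\<eta> > 0"
    obtain \<epsilon>2 where \<epsilon>2: "\<epsilon>2 > 0" "\<And>p t. p \<in> W \<inter> S3 \<Longrightarrow> t \<in> {0..2 * pi} \<Longrightarrow> norm (snd p) \<le> \<epsilon>2 \<Longrightarrow> fst (\<Psi> p) = cis t \<Longrightarrow> norm (p - \<gamma> t) < \<eta>"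
      by (rule tube_closeness[OF ad cont\<gamma> ran \<eta>]) (rule that)
    have "\<forall>\<^sub>F z in at 0. norm (S 0 z) * C < min \<epsilon>1 \<epsilon>2"
      using order_tendstoD(2)[OF S_lim, of "min \<epsilon>1 \<epsilon>2"] \<epsilon>1(1) \<epsilon>2(1) by simp
    then show "\<forall>\<^sub>F z in at 0. dist (u z s) 1 < \<eta>"
      using ev_r0
    proof eventually_elim
      case (elim z)
      then have small: "norm (snd (c z s)) \<le> \<epsilon>2" using stay(1)[of z s] s by auto
      have "norm (c z s - \<gamma> s) < \<eta>" using c(2)[OF elim(2) s] by (intro \<epsilon>2(2)[OF c(1)[OF elim(2) s] s small]) simp
      moreover have "norm (fst (c z s - \<gamma> s)) \<le> norm (c z s - \<gamma> s)" by (metis norm_fst_le prod.collapse)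
      ultimately have "norm (fst (c z s - \<gamma> s)) < \<eta>" by simp
      then have n: "norm (fst (c z s) - u0 * cis (\<theta> s)) < \<eta>" by (simp add: \<gamma>u[OF s])
      have "cis (\<theta> s) * cis (- \<theta> s) = 1" "u0 * cnj u0 = 1"
        using u0 by (simp_all add: cis_mult complex_norm_square[symmetric])
      then have "u z s - 1 = (fst (c z s) - u0 * cis (\<theta> s)) * (cis (- \<theta> s) * cnj u0)"
        unfolding u_def by algebra
      then show ?case using n u0 by (simp add: dist_norm norm_mult)
    qed
  qed
  have z0: "(0::complex) \<in> ball 0 r0" using r0(1) by simp
  \<comment> \<open>The leaf curve of \<open>z = 0\<close> never leaves the circle.\<close>
  have \<phi>0: "\<phi> t 0 = 0"
  proof -
    have "norm (snd (c 0 t)) \<le> 0" using stay(1)[OF z0 _ t] \<epsilon>1(1) by (simp add: S0)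
    have "norm (c 0 t - \<gamma> t) < \<eta>" if \<eta>: "\<eta> > 0" for \<eta>
    proof -
      obtain \<epsilon>2 where \<epsilon>2: "\<epsilon>2 > 0" "\<And>p t. p \<in> W \<inter> S3 \<Longrightarrow> t \<in> {0..2 * pi} \<Longrightarrow> norm (snd p) \<le> \<epsilon>2 \<Longrightarrow> fst (\<Psi> p) = cis t \<Longrightarrow> norm (p - \<gamma> t) < \<eta>"
        by (rule tube_closeness[OF ad cont\<gamma> ran \<eta>]) (rule that)
      show ?thesis
        using c(2)[OF z0 t] \<epsilon>2(1) \<open>norm (snd (c 0 t)) \<le> 0\<close> by (intro \<epsilon>2(2)[OF c(1)[OF z0 t] t]) auto
    qed
    then have "norm (c 0 t - \<gamma> t) \<le> 0" by (meson less_irrefl not_le)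
    then have "c 0 t = \<gamma> t" by simp
    then show ?thesis using c(2)[OF z0 t] \<Psi>\<gamma>[of t] by simp
  qed
  have "((\<lambda>z. S t (\<phi> t z)) has_field_derivative snd (Z t) * d) (at 0)"
    using DERIV_chain2[of "S t" "snd (Z t)" "\<phi> t" 0 d UNIV] dS[OF t] d \<phi>0 by simp
  then have lim1: "(\<lambda>z. S t (\<phi> t z) / z) \<midarrow>0\<rightarrow> snd (Z t) * d"
    by (simp add: has_field_derivative_iff \<phi>0 S0)
  have lim0: "(\<lambda>z. S 0 z / z) \<midarrow>0\<rightarrow> snd (Z 0)"
    using dS[OF I0] by (simp add: has_field_derivative_iff S0)
  have Ln_lim: "(\<lambda>z. Ln (u z s)) \<midarrow>0\<rightarrow> Ln 1" if "s \<in> {0..2 * pi}" for s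
    by (intro tendsto_Ln u_lim that) (simp add: complex_nonpos_Reals_iff)
  have "(\<lambda>z. exp (\<kappa> * (\<i> * \<theta> t + Ln (u z t) - Ln (u z 0)))) \<midarrow>0\<rightarrow> exp (\<kappa> * (\<i> * \<theta> t + Ln 1 - Ln 1))"
    by (intro tendsto_exp tendsto_mult tendsto_add tendsto_diff tendsto_const Ln_lim t I0)
  then have lim2: "(\<lambda>z. (S 0 z / z) * exp (\<kappa> * (\<i> * \<theta> t + Ln (u z t) - Ln (u z 0)))) \<midarrow>0\<rightarrow> snd (Z 0) * exp (\<kappa> * (\<i> * \<theta> t))"
    using tendsto_mult[OF lim0] by simp
  have "\<forall>\<^sub>F z in at 0. norm (S 0 z) * C < \<epsilon>1" using order_tendstoD(2)[OF S_lim \<epsilon>1(1)] .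
  then have "\<forall>\<^sub>F z in at 0. (S 0 z / z) * exp (\<kappa> * (\<i> * \<theta> t + Ln (u z t) - Ln (u z 0))) = S t (\<phi> t z) / z"
    using ev_r0
  proof eventually_elim
    case (elim z)
    then show ?case using expl[OF elim(2,1)] cS[OF elim(2) t] by simp
  qed
  with lim2 have "(\<lambda>z. S t (\<phi> t z) / z) \<midarrow>0\<rightarrow> snd (Z 0) * exp (\<kappa> * (\<i> * \<theta> t))"
    by (rule Lim_transform_eventually)
  from tendsto_unique[OF at_neq_bot lim1 this] show ?thesis unfolding \<kappa>_def .
qed

section \<open>A model chart\<close>

text \<open>
  Complex-valued so that it can be multiplied by the complex number \<open>\<kappa>\<close> under the exponential.
\<close>

definition log_modulus :: "C2 \<Rightarrow> complex" where
  "log_modulus p = of_real (ln (norm (fst p)))"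

lemma open_fst_nonzero: "open {p :: C2. fst p \<noteq> 0}"
  by (intro open_Collect_neq continuous_intros)

lemma log_modulus_derivative:
  assumes "fst p \<noteq> 0"
  shows "(log_modulus has_derivative (\<lambda>v. of_real (fst p \<bullet> fst v) * exp (- 2 * log_modulus p))) (at p)"
proof -
  have n: "norm (fst p) > 0" using assms by simp
  have "((\<lambda>p::C2. norm (fst p)) has_derivative (\<lambda>v. fst v \<bullet> sgn (fst p))) (at p)"
    using has_derivative_compose[OF has_derivative_fst[OF has_derivative_ident] has_derivative_norm[OF assms]] by simp
  from has_derivative_compose[OF this DERIV_ln[OF n, unfolded has_field_derivative_def]]
  have "((\<lambda>p::C2. ln (norm (fst p))) has_derivative (\<lambda>v. inverse (norm (fst p)) * (fst v \<bullet> sgn (fst p)))) (at p)" .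
  then have "(log_modulus has_derivative (\<lambda>v. of_real (inverse (norm (fst p)) * (fst v \<bullet> sgn (fst p))))) (at p)"
    unfolding log_modulus_def[abs_def] by (rule has_derivative_of_real)
  moreover have "exp (- 2 * log_modulus p) = of_real (inverse (norm (fst p)) * inverse (norm (fst p)))"
  proof -
    have "exp (- 2 * ln (norm (fst p))) = inverse (exp (ln (norm (fst p))) * exp (ln (norm (fst p))))"
      by (simp add: exp_minus[symmetric] exp_add[symmetric])
    then have "exp (- 2 * ln (norm (fst p))) = inverse (norm (fst p)) * inverse (norm (fst p))" using n by simp
    then show ?thesis by (metis exp_of_real log_modulus_def of_real_minus of_real_mult of_real_numeral)
  qed
  ultimately show ?thesis
    by (simp add: sgn_div_norm inner_commute mult.commute mult.left_commute)
qed

text \<open>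
  The derivative of \<open>log |z1|\<close> is a linear expression times \<open>exp (- 2 log |z1|)\<close>, so each order of
  differentiability gives the next one.
\<close>

lemma log_modulus_Ck: "Ck_on k {p :: C2. fst p \<noteq> 0} log_modulus"
proof (induction k)
  case 0
  show ?case unfolding Ck_on.simps
    by (rule continuous_at_imp_continuous_on) (use log_modulus_derivative has_derivative_continuous in blast)
next
  case (Suc k)
  show ?case
  proof (rule Ck_on_SucI[OF open_fst_nonzero])
    show "(log_modulus has_derivative (\<lambda>v. of_real (fst p \<bullet> fst v) * exp (- 2 * log_modulus p))) (at p)"
      if "p \<in> {p. fst p \<noteq> 0}" for p using that log_modulus_derivative by simp
    show "Ck_on k {p. fst p \<noteq> 0} (\<lambda>p. of_real (fst p \<bullet> fst v) * exp (- 2 * log_modulus p))" for v :: C2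
    proof (rule Ck_on_mult[OF open_fst_nonzero _ Ck_on_exp[OF open_fst_nonzero]])
      have "bounded_linear (\<lambda>p::C2. of_real (fst p \<bullet> fst v) :: complex)"
        by (intro bounded_linear_of_real[THEN bounded_linear_compose] bounded_linear_inner_left[THEN bounded_linear_compose] bounded_linear_fst)
      then show "Ck_on k {p. fst p \<noteq> 0} (\<lambda>p::C2. of_real (fst p \<bullet> fst v) :: complex)"
        by (rule Ck_on_linear[OF open_fst_nonzero])
      show "Ck_on k {p. fst p \<noteq> 0} (\<lambda>p. - 2 * log_modulus p)"
        by (rule Ck_on_linear_compose[OF bounded_linear_mult_right open_fst_nonzero Suc])
    qed
  qed
qed

text \<open>
  The chart \<open>(z1 / |z1|, z2 |z1| powr (- \<kappa>))\<close>.  With \<open>\<kappa> = (1 - a)/a\<close>, the differential of the second component along a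
  slice is a multiple of \<open>omega a\<close>, and leaves become the curves \<open>(cis t, exp (\<i> \<kappa> t) z)\<close>.
\<close>

definition model_chart :: "complex \<Rightarrow> C2 \<Rightarrow> C2" where
  "model_chart \<kappa> p = (fst p * exp (- 1 * log_modulus p), snd p * exp (- \<kappa> * log_modulus p))"

lemma model_chart_smooth: "smooth_on {p. fst p \<noteq> 0} (model_chart \<kappa>)"
  unfolding smooth_on_def model_chart_def[abs_def]
  by (intro allI Ck_on_Pair Ck_on_mult Ck_on_exp open_fst_nonzero Ck_on_linear bounded_linear_fst bounded_linear_snd
      Ck_on_linear_compose[OF bounded_linear_mult_right] log_modulus_Ck)

definition log_rate :: "C2 \<Rightarrow> C2 \<Rightarrow> real" where
  "log_rate p v = (fst p \<bullet> fst v) / (norm (fst p))\<^sup>2"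

lemma exp_log_modulus:
  assumes "fst p \<noteq> 0"
  shows "exp (- 1 * log_modulus p) = of_real (inverse (norm (fst p)))"
    "exp (- 2 * log_modulus p) = of_real (inverse ((norm (fst p))\<^sup>2))"
proof -
  have n: "norm (fst p) > 0" using assms by simp
  have "exp (- 1 * log_modulus p) = of_real (exp (- ln (norm (fst p))))"
    unfolding log_modulus_def by (metis exp_of_real mult_minus1 of_real_minus)
  then show 1: "exp (- 1 * log_modulus p) = of_real (inverse (norm (fst p)))" using n by (simp add: exp_minus)
  have "exp (- 2 * log_modulus p) = exp (- 1 * log_modulus p) * exp (- 1 * log_modulus p)" by (simp add: exp_add[symmetric])
  then show "exp (- 2 * log_modulus p) = of_real (inverse ((norm (fst p))\<^sup>2))" unfolding 1 by (simp add: power2_eq_square)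
qed

lemma model_chart_derivative:
  assumes "fst p \<noteq> 0"
  shows "D (model_chart \<kappa>) p v =
    ((fst v - fst p * log_rate p v) * exp (- 1 * log_modulus p), (snd v - \<kappa> * snd p * log_rate p v) * exp (- \<kappa> * log_modulus p))"
proof -
  have dl: "(log_modulus has_derivative (\<lambda>v. of_real (log_rate p v))) (at p)"
    using log_modulus_derivative[OF assms] unfolding exp_log_modulus(2)[OF assms]
    by (simp add: log_rate_def divide_inverse)
  have de: "((\<lambda>p. exp (c * log_modulus p)) has_derivative (\<lambda>v. exp (c * log_modulus p) * (c * of_real (log_rate p v)))) (at p)" for c
    using has_derivative_compose[OF has_derivative_mult_right[OF dl, of c] DERIV_exp[of "c * log_modulus p", unfolded has_field_derivative_def]] .
  have "(model_chart \<kappa> has_derivative (\<lambda>v.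
      (fst p * (exp (- 1 * log_modulus p) * (- 1 * of_real (log_rate p v))) + fst v * exp (- 1 * log_modulus p),
       snd p * (exp (- \<kappa> * log_modulus p) * (- \<kappa> * of_real (log_rate p v))) + snd v * exp (- \<kappa> * log_modulus p)))) (at p)"
    unfolding model_chart_def[abs_def]
    by (intro has_derivative_Pair has_derivative_mult de has_derivative_fst has_derivative_snd has_derivative_ident)
  from frechet_derivative_at[OF this, symmetric] show ?thesis by (simp add: algebra_simps)
qed

locale hopf_model =
  fixes a :: complex
  assumes a: "a \<noteq> 0"
begin

definition "\<kappa> = (1 - a) / a"
text \<open>
  On the sphere the inequality makes the chart an immersion; it holds near the circle.
\<close>

definition "chart_dom = {p :: C2. fst p \<noteq> 0 \<and> (norm (fst p))\<^sup>2 + Re \<kappa> * (norm (snd p))\<^sup>2 > 0}"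
definition "circle t = (cis t, 0 :: complex)" for t

lemma a_\<kappa>: "a * \<kappa> = 1 - a" using a by (simp add: \<kappa>_def)

lemma open_chart_dom: "open chart_dom"
  unfolding chart_dom_def Collect_conj_eq
  by (intro open_Int open_fst_nonzero open_Collect_less continuous_intros)

lemma smooth_chart: "smooth_on chart_dom (model_chart \<kappa>)"
  by (rule smooth_on_subset[OF model_chart_smooth]) (auto simp: chart_dom_def)

lemma tangent_lift:
  assumes p: "p \<in> chart_dom \<inter> S3" and v: "fst v = fst p * l" "snd v = \<kappa> * snd p * l"
  shows "cnj (fst p) * fst v + cnj (snd p) * snd v =
    l * (of_real ((norm (fst p))\<^sup>2) + \<kappa> * of_real ((norm (snd p))\<^sup>2))"
  unfolding complex_norm_square v by (simp add: algebra_simps)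

text \<open>
  For a point of the sphere with \<open>x = ln |z1|\<close>, the squared modulus of the second component of the chart is
  \<open>g x = exp (- 2 k x) - exp (2 (1 - k) x)\<close>, where \<open>k\<close> is the real part of \<open>\<kappa>\<close>.  The inequality in the definition
  of \<open>chart_dom\<close> says that the derivative of \<open>g\<close> is negative at \<open>x\<close>, and then it is negative between \<open>x\<close> and \<open>0\<close>; so the
  chart determines \<open>|z1|\<close>.
\<close>

lemma inj_chart: "inj_on (model_chart \<kappa>) (chart_dom \<inter> S3)"
proof -
  define k where "k = Re \<kappa>"
  define g where "g = (\<lambda>x::real. exp (- 2 * k * x) - exp (2 * (1 - k) * x))"
  have pos: "k + (1 - k) * exp (2 * x) > 0" if "x = ln (norm (fst p))" "p \<in> chart_dom \<inter> S3" for x p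
  proof -
    define A where "A = (norm (fst p))\<^sup>2"
    have p1: "fst p \<noteq> 0" "(norm (snd p))\<^sup>2 = 1 - A"
      using that(2) by (auto simp: chart_dom_def S3_iff norm_prod_def A_def)
    then have "exp (2 * x) = A" unfolding that(1) A_def exp_double by simp
    moreover have "A + k * (1 - A) > 0" using that(2) p1(2) by (simp add: chart_dom_def k_def A_def)
    ultimately show ?thesis by (simp add: algebra_simps)
  qed
  have g_eq: "(norm (snd (model_chart \<kappa> p)))\<^sup>2 = g (ln (norm (fst p)))" if p: "p \<in> chart_dom \<inter> S3" for p
  proof -
    define x where "x = ln (norm (fst p))"
    have p1: "fst p \<noteq> 0" "(norm (snd p))\<^sup>2 = 1 - (norm (fst p))\<^sup>2"
      using p by (auto simp: chart_dom_def S3_iff norm_prod_def)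
    have "norm (exp (- \<kappa> * log_modulus p)) = exp (- k * x)"
      by (simp add: norm_exp_eq_Re log_modulus_def x_def k_def)
    then have "(norm (snd (model_chart \<kappa> p)))\<^sup>2 = (1 - (norm (fst p))\<^sup>2) * exp (- 2 * k * x)"
      using p1(2) exp_double[of "- k * x"]
      by (simp only: model_chart_def snd_conv norm_mult power_mult_distrib) (simp add: mult.assoc)
    moreover have "(norm (fst p))\<^sup>2 = exp (2 * x)" using p1(1) unfolding x_def exp_double by simp
    moreover have "exp (2 * x) * exp (- 2 * k * x) = exp (2 * (1 - k) * x)"
      unfolding exp_add[symmetric] by (simp add: algebra_simps)
    ultimately show ?thesis unfolding g_def x_def[symmetric] by (simp add: left_diff_distrib)
  qed
  have x0: "ln (norm (fst p)) \<le> 0" if "p \<in> chart_dom \<inter> S3" for p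
  proof -
    have "fst p \<noteq> 0" "(norm (fst p))\<^sup>2 + (norm (snd p))\<^sup>2 = 1"
      using that by (auto simp: chart_dom_def S3_iff norm_prod_def)
    then have "(norm (fst p))\<^sup>2 \<le> 1" using zero_le_power2[of "norm (snd p)"] by linarith
    then have "norm (fst p) \<le> 1" by (simp add: abs_square_le_1)
    then show ?thesis using \<open>fst p \<noteq> 0\<close> by simp
  qed
  have decr: "g y < g x" if xy: "x < y" "y \<le> 0" and x: "k + (1 - k) * exp (2 * x) > 0" for x y
  proof (rule DERIV_neg_imp_decreasing[OF xy(1)])
    fix \<xi> assume \<xi>: "x \<le> \<xi>" "\<xi> \<le> y"
    have "k + (1 - k) * exp (2 * \<xi>) > 0"
    proof (cases "k \<le> 1")
      case True
      have "(1 - k) * exp (2 * x) \<le> (1 - k) * exp (2 * \<xi>)" using True \<xi> by (intro mult_left_mono) auto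
      then show ?thesis using x by linarith
    next
      case False
      have "exp (2 * \<xi>) \<le> 1" using \<xi> xy by simp
      then have "(k - 1) * exp (2 * \<xi>) \<le> (k - 1) * 1" using False by (intro mult_left_mono) auto
      then show ?thesis by (simp add: algebra_simps)
    qed
    then have "exp (- 2 * k * \<xi>) * (2 * (k + (1 - k) * exp (2 * \<xi>))) > 0" by simp
    moreover have "DERIV g \<xi> :> - (exp (- 2 * k * \<xi>) * (2 * (k + (1 - k) * exp (2 * \<xi>))))"
    proof -
      have "exp (2 * (1 - k) * \<xi>) = exp (- 2 * k * \<xi>) * exp (2 * \<xi>)"
        by (simp add: exp_add[symmetric] algebra_simps)
      then show ?thesis unfolding g_def
        by (auto intro!: derivative_eq_intros simp: algebra_simps)
    qed
    ultimately show "\<exists>y. DERIV g \<xi> :> y \<and> y < 0" by (intro exI conjI) auto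
  qed
  show ?thesis
  proof (rule inj_onI)
    fix p q assume pq: "p \<in> chart_dom \<inter> S3" "q \<in> chart_dom \<inter> S3" and eq: "model_chart \<kappa> p = model_chart \<kappa> q"
    define x where "x = ln (norm (fst p))"
    define y where "y = ln (norm (fst q))"
    have "g x = g y" using g_eq[OF pq(1)] g_eq[OF pq(2)] eq by (simp add: x_def y_def)
    moreover have "x \<le> 0" "y \<le> 0" using x0 pq by (simp_all add: x_def y_def)
    moreover have "k + (1 - k) * exp (2 * x) > 0" "k + (1 - k) * exp (2 * y) > 0"
      using pos pq x_def y_def by blast+
    ultimately have "x = y" using decr[of x y] decr[of y x] by (cases x y rule: linorder_cases) auto
    then have "log_modulus p = log_modulus q" by (simp add: log_modulus_def x_def y_def)
    then show "p = q" using eq by (simp add: model_chart_def prod_eq_iff)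
  qed
qed

sublocale sphere_chart chart_dom "model_chart \<kappa>"
proof
  show "open chart_dom" by (rule open_chart_dom)
  show "smooth_on chart_dom (model_chart \<kappa>)" by (rule smooth_chart)
  show "inj_on (model_chart \<kappa>) (chart_dom \<inter> S3)" by (rule inj_chart)
  show "norm (fst (model_chart \<kappa> p)) = 1" if "p \<in> chart_dom \<inter> S3" for p
    using that exp_log_modulus(1)[of p] by (simp add: model_chart_def chart_dom_def norm_mult norm_inverse)
  show "v = 0" if p: "p \<in> chart_dom \<inter> S3" and v: "v \<in> tangent_S3 p" "D (model_chart \<kappa>) p v = 0" for p v
  proof -
    have p1: "fst p \<noteq> 0" using p by (simp add: chart_dom_def)
    define l where "l = log_rate p v"
    have lv: "fst v = fst p * l" "snd v = \<kappa> * snd p * l"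
      using v(2) unfolding model_chart_derivative[OF p1] l_def[symmetric] by (simp_all add: zero_prod_def)
    have "Re (l * (of_real ((norm (fst p))\<^sup>2) + \<kappa> * of_real ((norm (snd p))\<^sup>2))) = 0"
      using v(1) unfolding tangent_lift[OF p lv, symmetric] tangent_S3_def by (simp only: mem_Collect_eq inner_C2)
    moreover have "Re (of_real l * (of_real A + \<kappa> * of_real B)) = l * (A + Re \<kappa> * B)" for A B by simp
    ultimately have "l * ((norm (fst p))\<^sup>2 + Re \<kappa> * (norm (snd p))\<^sup>2) = 0" by simp
    then have "l = 0" using p by (simp add: chart_dom_def)
    then show ?thesis using lv by (simp add: prod_eq_iff)
  qed
qed

lemma circle_dom: "circle t \<in> chart_dom \<inter> S3" by (simp add: circle_def chart_dom_def S3_iff norm_Pair)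

lemma chart_circle: "model_chart \<kappa> (circle t) = (cis t, 0)"
  by (simp add: model_chart_def circle_def log_modulus_def)

lemma circle_derivative: "(circle has_vector_derivative (\<i> * cis t, 0)) (at t)"
  unfolding circle_def[abs_def] by (intro has_vector_derivative_Pair has_vector_derivative_cis has_vector_derivative_const)

lemma adapted_model: "adapted_chart (omega a) circle (\<lambda>_. (0, 1)) chart_dom (model_chart \<kappa>)"
  unfolding adapted_chart_def
proof (intro conjI allI ballI impI)
  show "range circle \<subseteq> chart_dom" using circle_dom by blast
  show "v = 0" if "p \<in> chart_dom \<inter> S3" "v \<in> tangent_S3 p" "D (model_chart \<kappa>) p v = 0" for p v using immersive that by blast
  show "snd (D (model_chart \<kappa>) (circle t) (0, 1)) = 1" for t
    using circle_dom[of t] by (subst model_chart_derivative) (simp_all add: circle_def log_modulus_def)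
  fix p assume p: "p \<in> chart_dom \<inter> S3"
  then have p1: "fst p \<noteq> 0" by (simp add: chart_dom_def)
  define c where "c = exp (- \<kappa> * log_modulus p) / (a * fst p)"
  show "\<exists>c. c \<noteq> 0 \<and> (\<forall>v\<in>tangent_S3 p. fst (D (model_chart \<kappa>) p v) = 0 \<longrightarrow> snd (D (model_chart \<kappa>) p v) = c * omega a p v)"
  proof (intro exI[of _ c] conjI ballI impI)
    show "c \<noteq> 0" using p1 a by (simp add: c_def)
    fix v assume "fst (D (model_chart \<kappa>) p v) = 0"
    then have fv: "fst v = fst p * log_rate p v" unfolding model_chart_derivative[OF p1] by simp
    have "omega a p v = a * fst p * snd v - (1 - a) * snd p * (fst p * log_rate p v)" unfolding omega_def fv ..
    also have "\<dots> = a * fst p * (snd v - \<kappa> * snd p * log_rate p v)" unfolding a_\<kappa>[symmetric] by (simp add: algebra_simps)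
    finally show "snd (D (model_chart \<kappa>) p v) = c * omega a p v"
      using p1 a unfolding model_chart_derivative[OF p1] by (simp add: c_def)
  qed
qed (use open_chart_dom smooth_chart inj_chart image_chart_openin chart_circle in simp_all)

text \<open>
  The vector \<open>v\<close> is \<open>l (z1, \<kappa> z2)\<close> with \<open>Im l = 1\<close>, hence in the kernel of \<open>omega a\<close>.  Tangency to the sphere
  determines the real part of \<open>l\<close>, and the inequality in the definition of \<open>chart_dom\<close> gives the orientation.
\<close>

lemma positive_leaf_lift:
  assumes p: "p \<in> chart_dom \<inter> S3" and v: "v \<in> tangent_S3 p"
    and lv: "D (model_chart \<kappa>) p v = (\<i> * fst (model_chart \<kappa> p), \<i> * \<kappa> * snd (model_chart \<kappa> p))"
  shows "positive_leaf_vector (omega a) p v"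
proof (rule positive_leaf_vectorI)
  have p1: "fst p \<noteq> 0" using p by (simp add: chart_dom_def)
  define l where "l = complex_of_real (log_rate p v) + \<i>"
  have e: "fst v = fst p * l" "snd v = \<kappa> * snd p * l"
  proof -
    have "(fst v - fst p * log_rate p v) * exp (- 1 * log_modulus p) = (\<i> * fst p) * exp (- 1 * log_modulus p)"
      "(snd v - \<kappa> * snd p * log_rate p v) * exp (- \<kappa> * log_modulus p) = (\<i> * \<kappa> * snd p) * exp (- \<kappa> * log_modulus p)"
      using lv unfolding model_chart_derivative[OF p1] unfolding model_chart_def by (simp_all add: mult_ac)
    then have "fst v - fst p * log_rate p v = \<i> * fst p" "snd v - \<kappa> * snd p * log_rate p v = \<i> * \<kappa> * snd p"
      by (simp_all only: mult_cancel_right exp_not_eq_zero simp_thms)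
    then show "fst v = fst p * l" "snd v = \<kappa> * snd p * l" unfolding l_def by algebra+
  qed
  define Q where "Q = of_real ((norm (fst p))\<^sup>2) + \<kappa> * of_real ((norm (snd p))\<^sup>2)"
  have Q: "Re Q > 0" using p by (simp add: Q_def chart_dom_def)
  show "p \<in> S3" using p by simp
  show inn: "inner p v = 0" using v by (simp add: tangent_S3_def)
  have "omega a p v = (a * \<kappa> - (1 - a)) * (fst p * snd p * l)" unfolding omega_def e by algebra
  then show "omega a p v = 0" by (simp add: a_\<kappa>)
  have M: "cnj (fst p) * fst v + cnj (snd p) * snd v = l * Q" using tangent_lift[OF p e] by (simp add: Q_def)
  then have "Re (l * Q) = 0" using inn by (simp only: inner_C2)
  then have im: "Im Q = log_rate p v * Re Q" by (simp add: l_def)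
  have "Im (l * Q) = ((log_rate p v)\<^sup>2 + 1) * Re Q" using im by (simp add: l_def power2_eq_square algebra_simps)
  moreover have "(log_rate p v)\<^sup>2 + 1 > 0" by (smt (verit) zero_le_power2)
  ultimately show "Im (cnj (fst p) * fst v + cnj (snd p) * snd v) > 0" unfolding M using Q by simp
  have "a * of_real ((norm (fst p))\<^sup>2) + (1 - a) * of_real ((norm (snd p))\<^sup>2) = a * Q"
    unfolding Q_def a_\<kappa>[symmetric] by (simp add: algebra_simps)
  moreover have "Q \<noteq> 0" using Q by auto
  ultimately show "a * of_real ((norm (fst p))\<^sup>2) + (1 - a) * of_real ((norm (snd p))\<^sup>2) \<noteq> 0" using a by simp
qed

definition "hol t z = exp (\<i> * \<kappa> * of_real t) * z" for t :: real and z :: complex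

text \<open>
  The leaf curves are the preimages of the curves \<open>(cis t, exp (\<i> \<kappa> t) z)\<close> under the chart.  For small \<open>z\<close> these
  lie in the image of the chart, which is a neighbourhood of the circle.  They are
  considered for \<open>|t| < 8\<close>, an open interval that contains \<open>[0, 2 \<pi>]\<close>, to have two-sided derivatives.
\<close>

lemma leaf_holonomy_model: "leaf_holonomy (omega a) chart_dom (model_chart \<kappa>) hol"
proof -
  have img: "sphere 0 1 \<times> {0} \<subseteq> cone_map ` cone_dom"
  proof
    fix q :: C2 assume "q \<in> sphere 0 1 \<times> {0}"
    then obtain u where q: "q = (u, 0)" "norm u = 1" by (cases q) auto
    have "u \<noteq> 0" using q(2) by auto
    then have u: "(u, 0) = circle (Arg u)" using q(2) cis_Arg[of u] by (simp add: circle_def sgn_div_norm)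
    have "q = model_chart \<kappa> (circle (Arg u))" using chart_circle[of "Arg u"] u q(1) by (simp add: circle_def)
    also have "\<dots> = cone_map (circle (Arg u))" using cone_map_S3[OF circle_dom] by simp
    finally show "q \<in> cone_map ` cone_dom" using S3_in_cone(1)[OF circle_dom] by blast
  qed
  have "compact (sphere (0::complex) 1 \<times> {0::complex})" by (intro compact_Times) auto
  then obtain e where e: "e > 0" "(\<Union>x\<in>sphere 0 1 \<times> {0}. ball x e) \<subseteq> cone_map ` cone_dom"
    using compact_subset_open_imp_ball_epsilon_subset[OF _ open_cone_image img] by blast
  define r where "r = e / exp (norm \<kappa> * 8)"
  have r: "r > 0" using e(1) by (simp add: r_def)
  have in_img: "(cis t, hol t z) \<in> cone_map ` cone_dom" if z: "z \<in> ball 0 r" and t: "\<bar>t\<bar> < 8" for z t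
  proof -
    have "norm (\<i> * \<kappa> * of_real t) \<le> norm \<kappa> * 8" using t by (simp add: norm_mult mult_left_mono)
    then have "norm (exp (\<i> * \<kappa> * of_real t)) \<le> exp (norm \<kappa> * 8)" by (intro order_trans[OF norm_exp]) simp
    then have "norm (hol t z) \<le> exp (norm \<kappa> * 8) * norm z" unfolding hol_def norm_mult by (intro mult_right_mono) auto
    also have "\<dots> < exp (norm \<kappa> * 8) * r" using z by simp
    also have "\<dots> = e" by (simp add: r_def)
    finally have "(cis t, hol t z) \<in> ball (cis t, 0) e" by (simp add: dist_Pair_Pair)
    moreover have "(cis t, 0) \<in> sphere (0::complex) 1 \<times> {0::complex}" by simp
    ultimately show ?thesis using e(2) by blast
  qed
  show ?thesis
    unfolding leaf_holonomy_def
  proof (intro exI[of _ r] conjI ballI r)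
    show "hol t holomorphic_on ball 0 r" for t unfolding hol_def[abs_def] by (intro holomorphic_intros)
    fix z :: complex assume z: "z \<in> ball 0 r"
    show "hol 0 z = z" by (simp add: hol_def)
    define c where "c = (\<lambda>t. cone_inv (cis t, hol t z))"
    have c: "c t \<in> chart_dom \<inter> S3" "model_chart \<kappa> (c t) = (cis t, hol t z)" if "\<bar>t\<bar> < 8" for t
      using image_cone_slice[OF in_img[OF z that]] by (simp_all add: c_def)
    define c' where "c' = (\<lambda>t. vector_derivative c (at t))"
    have key: "(c has_vector_derivative c' t) (at t) \<and> positive_leaf_vector (omega a) (c t) (c' t)" if t: "\<bar>t\<bar> < 8" for t
    proof -
      obtain g' where g': "(cone_inv has_derivative g') (at (model_chart \<kappa> (c t)))"
        by (rule cone_inv_derivative[OF c(1)[OF t]])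
      have dh: "((\<lambda>t. hol t z) has_vector_derivative \<i> * \<kappa> * hol t z) (at t)"
      proof -
        have "((\<lambda>w. exp (\<i> * \<kappa> * w) * z) has_field_derivative \<i> * \<kappa> * hol t z) (at (complex_of_real t))"
          by (auto intro!: derivative_eq_intros simp: hol_def)
        then show ?thesis unfolding hol_def by (rule has_vector_derivative_real_field)
      qed
      have d: "((\<lambda>t. (cis t, hol t z)) has_vector_derivative (\<i> * cis t, \<i> * \<kappa> * hol t z)) (at t)"
        by (intro has_vector_derivative_Pair has_vector_derivative_cis dh)
      have "(c has_derivative (\<lambda>x. g' (x *\<^sub>R (\<i> * cis t, \<i> * \<kappa> * hol t z)))) (at t)"
        using has_derivative_compose[OF d[unfolded has_vector_derivative_def] g'[unfolded c(2)[OF t]]] by (simp add: c_def)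
      then have "c differentiable (at t)" by (rule differentiableI)
      then have dc: "(c has_vector_derivative c' t) (at t)" unfolding c'_def by (simp add: vector_derivative_works)
      have op: "open {-8<..<8::real}" "t \<in> {-8<..<8}" using t by auto
      have "((\<lambda>t. c t \<bullet> c t) has_derivative (\<lambda>x. c t \<bullet> (x *\<^sub>R c' t) + (x *\<^sub>R c' t) \<bullet> c t)) (at t)"
        by (intro has_derivative_inner dc[unfolded has_vector_derivative_def])
      moreover have "((\<lambda>t. c t \<bullet> c t) has_derivative (\<lambda>x. 0)) (at t)"
      proof (rule has_derivative_transform_within_open[OF has_derivative_const op])
        fix s :: real assume "s \<in> {-8<..<8}"
        then have "c s \<in> S3" using c(1)[of s] by (simp add: abs_less_iff)
        then show "1 = c s \<bullet> c s" by (simp add: S3_iff dot_square_norm)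
      qed
      ultimately have "(\<lambda>x. c t \<bullet> (x *\<^sub>R c' t) + (x *\<^sub>R c' t) \<bullet> c t) = (\<lambda>x. 0)" by (rule has_derivative_unique)
      from fun_cong[OF this, of 1] have tan: "c' t \<in> tangent_S3 (c t)" by (simp add: tangent_S3_def inner_commute)
      have d\<Psi>: "(model_chart \<kappa> has_derivative D (model_chart \<kappa>) (c t)) (at (c t))"
        using smooth_onD(1)[OF smooth_chart] c(1)[OF t] by blast
      have "((\<lambda>t. model_chart \<kappa> (c t)) has_vector_derivative D (model_chart \<kappa>) (c t) (c' t)) (at t)"
        using has_derivative_compose[OF dc[unfolded has_vector_derivative_def] d\<Psi>]
        by (simp add: has_vector_derivative_def
            linear_scale[OF bounded_linear.linear[OF has_derivative_bounded_linear[OF d\<Psi>]]])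
      moreover have "((\<lambda>t. model_chart \<kappa> (c t)) has_vector_derivative (\<i> * cis t, \<i> * \<kappa> * hol t z)) (at t)"
      proof (rule has_vector_derivative_transform_within_open[OF d op])
        fix s :: real assume "s \<in> {-8<..<8}"
        then show "(cis s, hol s z) = model_chart \<kappa> (c s)" using c(2)[of s] by (simp add: abs_less_iff)
      qed
      ultimately have "D (model_chart \<kappa>) (c t) (c' t) = (\<i> * cis t, \<i> * \<kappa> * hol t z)" by (rule vector_derivative_unique_at)
      then have "positive_leaf_vector (omega a) (c t) (c' t)"
        using c(2)[OF t] by (intro positive_leaf_lift[OF c(1)[OF t] tan]) simp
      with dc show ?thesis ..
    qed
    have lt8: "\<bar>t\<bar> < 8" if "t \<in> {0..2 * pi}" for t using that pi_less_4 by auto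
    show "\<exists>c c'. \<forall>t\<in>{0..2 * pi}. c t \<in> chart_dom \<inter> S3 \<and> model_chart \<kappa> (c t) = (cis t, hol t z) \<and>
            (c has_vector_derivative c' t) (at t within {0..2 * pi}) \<and> positive_leaf_vector (omega a) (c t) (c' t)"
    proof (rule exI[of _ c], rule exI[of _ c'], rule ballI)
      fix t assume "t \<in> {0..2 * pi}"
      then have t: "\<bar>t\<bar> < 8" by (rule lt8)
      have "(c has_vector_derivative c' t) (at t within {0..2 * pi})"
        using key[OF t] by (blast intro: has_vector_derivative_at_within)
      then show "c t \<in> chart_dom \<inter> S3 \<and> model_chart \<kappa> (c t) = (cis t, hol t z) \<and>
            (c has_vector_derivative c' t) (at t within {0..2 * pi}) \<and> positive_leaf_vector (omega a) (c t) (c' t)"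
        using c[OF t] key[OF t] by simp
    qed
  qed
qed

end

section \<open>Logarithmic monodromy of the first circle\<close>

text \<open>
  The flat Seifert surface of the circle: the points with \<open>z2\<close> real and nonnegative.  It induces
  the framing \<open>(0, 1)\<close>.
\<close>

definition half_disk :: "C2 set" where
  "half_disk = {p \<in> S3. Im (snd p) = 0 \<and> Re (snd p) \<ge> 0}"

lemma D_linear: "bounded_linear f \<Longrightarrow> D f p = f"
  by (rule frechet_derivative_at[symmetric]) (rule bounded_linear_imp_has_derivative)

lemma bounded_linear_coordinates:
  "bounded_linear (\<lambda>p :: C2. Im (snd p))" "bounded_linear (\<lambda>p :: C2. Re (snd p))"
  by (intro bounded_linear_compose[OF bounded_linear_Im bounded_linear_snd]
      bounded_linear_compose[OF bounded_linear_Re bounded_linear_snd])+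

lemma hopf_circle_iff: "p \<in> hopf_circle \<longleftrightarrow> p \<in> S3 \<and> snd p = 0"
  by (auto simp: S3_iff norm_prod_def mem_Times_iff abs_square_eq_1)

lemma half_disk_chart:
  assumes "norm u = 1"
  shows "boundary_chart hopf_circle half_disk (u, 0) UNIV (\<lambda>p. Im (snd p)) (\<lambda>p. Re (snd p))"
  unfolding boundary_chart_def
proof (intro conjI allI)
  show "half_disk \<inter> UNIV = {q \<in> S3 \<inter> UNIV. Im (snd q) = 0 \<and> Re (snd q) \<ge> 0}" by (simp add: half_disk_def)
  show "hopf_circle \<inter> UNIV = {q \<in> S3 \<inter> UNIV. Im (snd q) = 0 \<and> Re (snd q) = 0}"
    by (rule set_eqI) (simp only: Int_UNIV_right mem_Collect_eq hopf_circle_iff complex_eq_iff, auto)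
  fix x y
  show "\<exists>v\<in>tangent_S3 (u, 0). D (\<lambda>p. Im (snd p)) (u, 0) v = x \<and> D (\<lambda>p. Re (snd p)) (u, 0) v = y"
    unfolding D_linear[OF bounded_linear_coordinates(1)] D_linear[OF bounded_linear_coordinates(2)]
    by (rule bexI[of _ "(0, Complex y x)"]) (simp_all add: tangent_S3_def)
qed (simp_all add: smooth_on_linear bounded_linear_coordinates)

lemma half_disk_connected: "connected half_disk"
proof -
  have "half_disk = (\<lambda>z. (z, of_real (sqrt (1 - (norm z)\<^sup>2)))) ` cball 0 1"
  proof (intro equalityI subsetI)
    fix p assume p: "p \<in> half_disk"
    then have n: "(norm (fst p))\<^sup>2 + (norm (snd p))\<^sup>2 = 1" and s: "snd p = of_real (Re (snd p))" "Re (snd p) \<ge> 0"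
      by (auto simp: half_disk_def S3_iff norm_prod_def complex_eq_iff)
    have "norm (snd p) = Re (snd p)" by (subst s(1)) (use s(2) in simp)
    then have "Re (snd p) = sqrt (1 - (norm (fst p))\<^sup>2)" using n s(2) by (simp add: real_sqrt_unique algebra_simps)
    then have "p = (fst p, of_real (sqrt (1 - (norm (fst p))\<^sup>2)))" using s(1) by (metis prod.collapse)
    moreover have "(norm (fst p))\<^sup>2 \<le> 1" using n zero_le_power2[of "norm (snd p)"] by linarith
    then have "fst p \<in> cball 0 1" by (simp add: abs_square_le_1)
    ultimately show "p \<in> (\<lambda>z. (z, of_real (sqrt (1 - (norm z)\<^sup>2)))) ` cball 0 1" by (rule image_eqI)
  next
    fix p :: C2 assume "p \<in> (\<lambda>z. (z, of_real (sqrt (1 - (norm z)\<^sup>2)))) ` cball 0 1"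
    then obtain z :: complex where z: "norm z \<le> 1" "p = (z, of_real (sqrt (1 - (norm z)\<^sup>2)))" by auto
    then have "(norm z)\<^sup>2 \<le> 1" by (simp add: abs_square_le_1)
    then show "p \<in> half_disk" by (simp add: half_disk_def z(2) S3_iff norm_Pair)
  qed
  moreover have "connected ((\<lambda>z::complex. (z, complex_of_real (sqrt (1 - (norm z)\<^sup>2)))) ` cball 0 1)"
    by (intro connected_continuous_image continuous_intros convex_connected convex_cball)
  ultimately show ?thesis by simp
qed

lemma half_disk_compact: "compact half_disk"
proof -
  have "half_disk = S3 \<inter> ({p. Im (snd p) = 0} \<inter> {p. Re (snd p) \<ge> 0})" by (auto simp: half_disk_def)
  moreover have "closed ({p :: C2. Im (snd p) = 0} \<inter> {p. Re (snd p) \<ge> 0})"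
    by (intro closed_Int closed_Collect_eq closed_Collect_le continuous_intros)
  moreover have "compact S3" by (simp add: S3_def)
  ultimately show ?thesis by (metis compact_Int_closed)
qed

lemma half_disk_seifert: "seifert_surface hopf_circle half_disk"
  unfolding seifert_surface_def
proof (intro conjI ballI)
  show "half_disk \<subseteq> S3" by (auto simp: half_disk_def)
  show "hopf_circle \<subseteq> half_disk" using hopf_circle_iff by (auto simp: half_disk_def)
  show "\<exists>W (h :: C2 \<Rightarrow> real). open W \<and> p \<in> W \<and> smooth_on W h \<and> half_disk \<inter> W = {q \<in> S3 \<inter> W. h q = 0} \<and> (\<exists>v\<in>tangent_S3 p. D h p v \<noteq> 0)"
    if p: "p \<in> half_disk - hopf_circle" for p
  proof (intro exI conjI)
    show "open {q :: C2. Re (snd q) > 0}" by (intro open_Collect_less continuous_intros)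
    then show "smooth_on {q :: C2. Re (snd q) > 0} (\<lambda>q. Im (snd q))" by (rule smooth_on_linear) (rule bounded_linear_coordinates)
    have "snd p \<noteq> 0" using p hopf_circle_iff[of p] by (auto simp: half_disk_def)
    then show "p \<in> {q. Re (snd q) > 0}" using p by (auto simp: half_disk_def complex_eq_iff)
    show "half_disk \<inter> {q. Re (snd q) > 0} = {q \<in> S3 \<inter> {q. Re (snd q) > 0}. Im (snd q) = 0}" by (auto simp: half_disk_def)
    show "\<exists>v\<in>tangent_S3 p. D (\<lambda>q. Im (snd q)) p v \<noteq> 0"
      unfolding D_linear[OF bounded_linear_coordinates(1)]
      by (rule bexI[of _ "(0, \<i>)"]) (use p in \<open>simp_all add: tangent_S3_def inner_prod_def inner_complex_def half_disk_def\<close>)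
  qed
  show "\<exists>W (h :: C2 \<Rightarrow> real) (k :: C2 \<Rightarrow> real). open W \<and> p \<in> W \<and> smooth_on W h \<and> smooth_on W k \<and>
      half_disk \<inter> W = {q \<in> S3 \<inter> W. h q = 0 \<and> k q \<ge> 0} \<and> hopf_circle \<inter> W = {q \<in> S3 \<inter> W. h q = 0 \<and> k q = 0} \<and>
      (\<forall>x y. \<exists>v\<in>tangent_S3 p. D h p v = x \<and> D k p v = y)" if p: "p \<in> hopf_circle" for p
  proof -
    obtain u where "p = (u, 0)" "norm u = 1" using p by (cases p) auto
    then show ?thesis using half_disk_chart[of u] unfolding boundary_chart_def by blast
  qed
  show "\<exists>n. continuous_on half_disk n \<and> (\<forall>p\<in>half_disk. n p \<noteq> 0 \<and> n p \<in> tangent_S3 p \<and> (\<forall>v\<in>tangent_space half_disk p. inner (n p) v = 0))"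
  proof (intro exI[of _ "\<lambda>_. (0, \<i>)"] conjI ballI)
    fix p assume p: "p \<in> half_disk"
    show "(0, \<i>) \<in> tangent_S3 p" using p by (simp add: tangent_S3_def inner_prod_def inner_complex_def half_disk_def)
    fix v assume v: "v \<in> tangent_space half_disk p"
    have "D (\<lambda>q. Im (snd q)) p v = 0"
      by (rule tangent_spaceD[OF v open_UNIV UNIV_I smooth_on_linear[OF open_UNIV bounded_linear_coordinates(1)]])
        (simp add: half_disk_def)
    then have "Im (snd v) = 0" unfolding D_linear[OF bounded_linear_coordinates(1)] .
    then show "inner (0, \<i>) v = 0" by (simp add: inner_prod_def inner_complex_def)
  qed (simp_all add: zero_prod_def)
qed (rule half_disk_compact half_disk_connected)+

context hopf_model
begin

lemma smooth_circle: "smooth_on UNIV circle"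
proof -
  have eq: "circle = (\<lambda>t. (exp (\<i> * complex_of_real t), 0))" by (simp add: circle_def cis_conv_exp fun_eq_iff)
  have "Ck_on k UNIV (\<lambda>t. exp (\<i> * complex_of_real t))" for k
    by (intro Ck_on_exp Ck_on_linear bounded_linear_const_mult bounded_linear_of_real open_UNIV)
  then show ?thesis unfolding smooth_on_def eq by (intro allI Ck_on_Pair Ck_on_const open_UNIV)
qed

lemma circle_vector_derivative: "vector_derivative circle (at t) = (\<i> * cis t, 0)"
  by (rule vector_derivative_at[OF circle_derivative])

lemma circle_closed_leaf: "closed_leaf_param (omega a) hopf_circle circle"
  unfolding closed_leaf_param_def
proof (intro conjI allI)
  show "smooth_on UNIV circle" by (rule smooth_circle)
  show "circle (t + 2 * pi) = circle t" for t by (simp add: circle_def complex_eq_iff)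
  show "inj_on circle {0..<2 * pi}"
  proof (rule inj_onI)
    fix x y assume xy: "x \<in> {0..<2 * pi}" "y \<in> {0..<2 * pi}" "circle x = circle y"
    then have "cis x = cis y" by (simp add: circle_def)
    then have "sin x = sin y \<and> cos x = cos y" by (simp add: complex_eq_iff)
    then obtain n :: int where "x = y + 2 * pi * n" unfolding sin_cos_eq_iff by blast
    moreover from this have "\<bar>2 * pi * n\<bar> < 2 * pi * 1" using xy by auto
    then have "\<bar>real_of_int n\<bar> < 1" by (simp add: abs_mult)
    then have "n = 0" by linarith
    ultimately show "x = y" by simp
  qed
  show "range circle = hopf_circle"
  proof (intro equalityI subsetI)
    fix p assume "p \<in> hopf_circle"
    then obtain u where u: "p = (u, 0)" "norm u = 1" by (cases p) auto
    then have "u \<noteq> 0" by auto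
    then have "p = circle (Arg u)" using u cis_Arg[of u] by (simp add: circle_def sgn_div_norm)
    then show "p \<in> range circle" by simp
  qed (auto simp: circle_def)
  show "positive_leaf_vector (omega a) (circle t) (vector_derivative circle (at t))" for t
    unfolding circle_vector_derivative circle_def
  proof (rule positive_leaf_vectorI)
    show "Im (cnj (fst (cis t, 0)) * fst (\<i> * cis t, 0) + cnj (snd (cis t, 0)) * snd (\<i> * cis t, 0)) > 0"
      by (simp add: power2_eq_square[symmetric])
  qed (simp_all add: S3_iff norm_Pair inner_prod_def inner_complex_def omega_def a)
qed

lemma half_disk_section: "seifert_section circle half_disk (\<lambda>_. (0, 1))"
  unfolding seifert_section_def
proof (intro conjI allI)
  show "smooth_on UNIV (\<lambda>_::real. (0, 1) :: C2)" unfolding smooth_on_def by (simp add: Ck_on_const)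
  show "(0, 1) \<in> tangent_space half_disk (circle t)" for t
    unfolding circle_def
  proof (rule boundary_chart_tangent[OF half_disk_chart])
    show "D (\<lambda>p. Im (snd p)) (cis t, 0) (0, 1) = 0" unfolding D_linear[OF bounded_linear_coordinates(1)] by simp
  qed (simp_all add: tangent_S3_def half_disk_def S3_iff norm_Pair)
  show "(0, 1) \<notin> span {vector_derivative circle (at t)}" for t
    unfolding circle_vector_derivative by (auto simp: span_singleton)
qed simp

lemma model_monodromy: "log_monodromy_value (omega a) hopf_circle (2 * pi * \<i> * (1 - a) / a)"
  unfolding log_monodromy_value_def
proof (intro exI conjI)
  show "closed_leaf_param (omega a) hopf_circle circle" by (rule circle_closed_leaf)
  show "seifert_surface hopf_circle half_disk" by (rule half_disk_seifert)
  show "seifert_section circle half_disk (\<lambda>_. (0, 1))" by (rule half_disk_section)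
  show "adapted_chart (omega a) circle (\<lambda>_. (0, 1)) chart_dom (model_chart \<kappa>)" by (rule adapted_model)
  show "leaf_holonomy (omega a) chart_dom (model_chart \<kappa>) hol" by (rule leaf_holonomy_model)
  show "continuous_on {0..2 * pi} (\<lambda>t. \<i> * \<kappa> * complex_of_real t)" by (intro continuous_intros)
  show "\<forall>t\<in>{0..2 * pi}. (hol t has_field_derivative exp (\<i> * \<kappa> * complex_of_real t)) (at 0)"
    unfolding hol_def[abs_def] by (auto intro!: derivative_eq_intros)
  show "2 * pi * \<i> * (1 - a) / a = \<i> * \<kappa> * complex_of_real (2 * pi)" by (simp add: \<kappa>_def)
qed simp

end

text \<open>
  Writing \<open>snd (Z t) = exp (\<zeta> t)\<close>, the derivative of the holonomy is \<open>exp (\<zeta> 0 - \<zeta> t + (1 - a)/a \<i> \<theta> t)\<close>, whose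
  continuous logarithm is the exponent.  At \<open>t = 2 \<pi>\<close> the terms with \<open>\<zeta>\<close> cancel because the winding
  number vanishes.
\<close>

lemma hopf_monodromy_unique:
  assumes a: "a \<noteq> 0" and \<mu>: "log_monodromy_value (omega a) hopf_circle \<mu>"
  shows "\<mu> = 2 * pi * \<i> * (1 - a) / a"
proof -
  obtain \<gamma> \<Sigma> Z W \<Psi> \<phi> L where cl: "closed_leaf_param (omega a) hopf_circle \<gamma>" and S: "seifert_surface hopf_circle \<Sigma>"
    and sec: "seifert_section \<gamma> \<Sigma> Z" and ad: "adapted_chart (omega a) \<gamma> Z W \<Psi>" and hol: "leaf_holonomy (omega a) W \<Psi> \<phi>"
    and L: "continuous_on {0..2 * pi} L" "L 0 = 0" "\<And>t. t \<in> {0..2 * pi} \<Longrightarrow> (\<phi> t has_field_derivative exp (L t)) (at 0)"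
    and \<mu>L: "\<mu> = L (2 * pi)"
    using \<mu> unfolding log_monodromy_value_def by blast
  obtain \<theta> r where \<theta>: "\<theta> 0 = 0" "\<theta> (2 * pi) = 2 * pi" "continuous_on {0..2 * pi} \<theta>"
    and \<gamma>: "\<And>t. \<gamma> t = (fst (\<gamma> t), 0)" "\<And>t. norm (fst (\<gamma> t)) = 1"
    and \<gamma>\<theta>: "\<And>t. t \<in> {0..2 * pi} \<Longrightarrow> fst (\<gamma> t) = fst (\<gamma> 0) * cis (\<theta> t)"
    and d\<theta>: "\<And>t. t \<in> {0..2 * pi} \<Longrightarrow> (\<theta> has_vector_derivative r t) (at t within {0..2 * pi})"
    and d\<gamma>: "\<And>t. (\<gamma> has_vector_derivative (\<i> * fst (\<gamma> t) * of_real (r t), 0)) (at t)" and r: "\<And>t. r t > (0::real)"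
    by (rule closed_leaf_param_angle[OF a cl]) (rule that)
  have ran: "range \<gamma> = hopf_circle" and sm\<gamma>: "smooth_on UNIV \<gamma>" and per\<gamma>: "\<gamma> (0 + 2 * pi) = \<gamma> 0"
    using cl unfolding closed_leaf_param_def by blast+
  have cont\<gamma>: "continuous_on UNIV \<gamma>" by (rule smooth_on_continuous[OF sm\<gamma>])
  have smZ: "smooth_on UNIV Z" and perZ: "Z (0 + 2 * pi) = Z 0" and tanZ: "\<And>t. Z t \<in> tangent_space \<Sigma> (\<gamma> t)"
    and spanZ: "\<And>t. Z t \<notin> span {vector_derivative \<gamma> (at t)}"
    using sec unfolding seifert_section_def by blast+
  have \<Sigma>: "\<Sigma> \<subseteq> S3" "hopf_circle \<subseteq> \<Sigma>" using S unfolding seifert_surface_def by simp_all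
  have Ztan: "Z t \<in> tangent_S3 (\<gamma> t)" for t
  proof -
    have "\<gamma> t \<in> \<Sigma>" using ran \<Sigma>(2) by blast
    then show ?thesis using tangent_space_subset_tangent_S3[OF \<Sigma>(1)] tanZ by blast
  qed
  have Z0: "snd (Z t) \<noteq> 0" for t
  proof
    assume s0: "snd (Z t) = 0"
    define \<rho> where "\<rho> = Im (cnj (fst (\<gamma> t)) * fst (Z t))"
    have "fst (\<gamma> t) \<bullet> fst (Z t) = 0" using Ztan[of t] s0 by (simp add: tangent_S3_def inner_prod_def)
    then have "fst (Z t) = (\<i> * fst (\<gamma> t)) * of_real \<rho>" unfolding \<rho>_def by (intro orthogonal_on_circle \<gamma>(2))
    then have "Z t = (\<rho> / r t) *\<^sub>R (\<i> * fst (\<gamma> t) * of_real (r t), 0)"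
      using r[of t] s0 by (intro prod_eqI) (simp_all add: scaleR_conv_of_real field_simps)
    then have "Z t \<in> span {vector_derivative \<gamma> (at t)}"
      unfolding vector_derivative_at[OF d\<gamma>] by (metis span_base span_scale singletonI)
    then show False using spanZ by blast
  qed
  interpret framed_hopf_surface \<Sigma> "\<lambda>t. fst (\<gamma> t)" Z
  proof
    show "continuous_on {0..2 * pi} (\<lambda>t. fst (\<gamma> t))"
      by (intro continuous_on_fst continuous_on_subset[OF cont\<gamma>]) simp
    show "continuous_on {0..2 * pi} Z" by (rule continuous_on_subset[OF smooth_on_continuous[OF smZ]]) simp
    show "Z t \<in> tangent_space \<Sigma> (fst (\<gamma> t), 0)" for t using tanZ[of t] \<gamma>(1)[of t] by metis
  qed (rule S \<gamma>(2) Z0)+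
  have "continuous_on {0..2 * pi} (\<lambda>t. snd (Z t))" by (intro continuous_on_snd cont_Z)
  moreover have "contractible {0..2 * pi}" by (intro convex_imp_contractible) simp
  ultimately obtain \<zeta> where \<zeta>: "continuous_on {0..2 * pi} \<zeta>" "\<And>t. t \<in> {0..2 * pi} \<Longrightarrow> snd (Z t) = exp (\<zeta> t)"
    by (rule continuous_logarithm_on_contractible) (simp add: Z0, rule that)
  have wind: "\<zeta> (2 * pi) = \<zeta> 0"
    using winding_zero[OF \<zeta>] per\<gamma> perZ by simp
  define \<kappa> where "\<kappa> = (1 - a) / a"
  have "L (2 * pi) - L 0 = (\<zeta> 0 - \<zeta> (2 * pi) + \<kappa> * (\<i> * \<theta> (2 * pi))) - (\<zeta> 0 - \<zeta> 0 + \<kappa> * (\<i> * \<theta> 0))"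
  proof (rule log_unique[of "{0..2 * pi}" L "\<lambda>t. \<zeta> 0 - \<zeta> t + \<kappa> * (\<i> * \<theta> t)"])
    show "continuous_on {0..2 * pi} (\<lambda>t. \<zeta> 0 - \<zeta> t + \<kappa> * (\<i> * \<theta> t))" by (intro continuous_intros \<zeta>(1) \<theta>(3))
    fix t assume t: "t \<in> {0..2 * pi}"
    have "snd (Z t) * exp (L t) = snd (Z 0) * exp (\<kappa> * (\<i> * \<theta> t))"
      unfolding \<kappa>_def
      by (rule holonomy_derivative[OF a ad hol ran cont\<gamma> \<gamma> d\<gamma> \<theta>(1) d\<theta> \<gamma>\<theta> \<theta>(3) Ztan t L(3)[OF t]]; assumption)
    then have "exp (\<zeta> t) * exp (L t) = exp (\<zeta> 0) * exp (\<kappa> * (\<i> * \<theta> t))" using \<zeta>(2)[OF t] \<zeta>(2)[of 0] by simp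
    then have "exp (- \<zeta> t) * (exp (\<zeta> t) * exp (L t)) = exp (- \<zeta> t) * (exp (\<zeta> 0) * exp (\<kappa> * (\<i> * \<theta> t)))" by simp
    then show "exp (L t) = exp (\<zeta> 0 - \<zeta> t + \<kappa> * (\<i> * \<theta> t))"
      unfolding exp_add[symmetric] by (simp add: add.assoc[symmetric])
  qed (use L(1) in simp_all)
  then show ?thesis using wind \<theta>(1,2) L(2) \<mu>L by (simp add: \<kappa>_def)
qed

lemma hopf_has_log_monodromy:
  assumes "a \<noteq> 0"
  shows "has_log_monodromy (omega a) hopf_circle (2 * pi * \<i> * (1 - a) / a)"
proof -
  interpret hopf_model a using assms by unfold_locales
  show ?thesis unfolding has_log_monodromy_def using model_monodromy hopf_monodromy_unique[OF assms] by blast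
qed

section \<open>Interchanging the coordinates\<close>

abbreviation sw :: "C2 \<Rightarrow> C2" where "sw \<equiv> prod.swap"

lemma bounded_linear_swap: "bounded_linear sw"
  unfolding prod.swap_def by (intro bounded_linear_Pair bounded_linear_fst bounded_linear_snd)

lemma linear_swap: "linear sw" by (rule bounded_linear.linear[OF bounded_linear_swap])

lemma inner_swap: "inner (sw p) (sw q) = inner p q"
  by (simp add: inner_prod_def)

lemma norm_swap: "norm (sw p) = norm p"
  by (simp add: norm_prod_def add.commute)

lemma S3_swap: "sw p \<in> S3 \<longleftrightarrow> p \<in> S3"
  by (simp add: S3_iff norm_swap)

lemma tangent_S3_swap: "sw v \<in> tangent_S3 (sw p) \<longleftrightarrow> v \<in> tangent_S3 p" "v \<in> tangent_S3 (sw p) \<longleftrightarrow> sw v \<in> tangent_S3 p"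
  using inner_swap[of p v] inner_swap[of "sw p" v] by (simp_all add: tangent_S3_def)

text \<open>
  Interchanging the two coordinates of \<open>\<complex>\<^sup>2\<close> is a product of two transpositions of real coordinates.
\<close>

lemma positive_frame_swap: "positive_frame_S3 (sw p) (sw v) (sw u) (sw w) \<longleftrightarrow> positive_frame_S3 p v u w"
proof -
  have "det (vector [real_coords (sw p), real_coords (sw v), real_coords (sw u), real_coords (sw w)] :: real ^ 4 ^ 4) =
      det (vector [real_coords p, real_coords v, real_coords u, real_coords w] :: real ^ 4 ^ 4)"
    unfolding det_4 vector_4 real_coords_nth by (simp add: algebra_simps)
  then show ?thesis unfolding positive_frame_S3_def tangent_S3_swap(1) by simp
qed

text \<open>
  A form and its negative have the same kernel, the same coorientation and the same complex structure on
  the normal bundle, so the interchange of coordinates takes the foliation with parameter \<open>a\<close> to the one with parameter \<open>1 - a\<close>.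
\<close>

lemma omega_swap: "omega (1 - a) (sw p) (sw v) = - omega a p v"
  by (simp add: omega_def)

lemma positive_leaf_vector_swap:
  assumes "positive_leaf_vector (omega a) p v"
  shows "positive_leaf_vector (omega (1 - a)) (sw p) (sw v)"
proof -
  obtain u w where uw: "coorientation_form (omega a) p u w > 0" "positive_frame_S3 p v u w"
    using assms unfolding positive_leaf_vector_def by blast
  have "coorientation_form (omega (1 - a)) (sw p) (sw u) (sw w) > 0"
    using uw(1) unfolding coorientation_form_def omega_swap by simp
  moreover have "positive_frame_S3 (sw p) (sw v) (sw u) (sw w)" using uw(2) by (simp only: positive_frame_swap)
  moreover have "sw p \<in> S3" "sw v \<in> tangent_S3 (sw p)" "omega (1 - a) (sw p) (sw v) = 0"
    using assms unfolding positive_leaf_vector_def S3_swap tangent_S3_swap(1) omega_swap by simp_all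
  ultimately show ?thesis unfolding positive_leaf_vector_def by blast
qed

lemma open_swap: "open W \<Longrightarrow> open (sw -` W)"
  by (rule open_vimage) (simp_all add: linear_continuous_on bounded_linear_swap)

lemma smooth_on_swap_comp:
  assumes "open W" "smooth_on W f"
  shows "smooth_on (sw -` W) (\<lambda>x. f (sw x))"
  unfolding smooth_on_def
proof
  fix k
  show "Ck_on k (sw -` W) (\<lambda>x. f (sw x))"
    by (rule Ck_on_compose_linear[OF bounded_linear_swap open_swap[OF assms(1)], of W])
      (use assms(2) in \<open>auto simp: smooth_on_def\<close>)
qed

lemma D_swap:
  assumes "smooth_on W f" "sw p \<in> W"
  shows "D (\<lambda>x. f (sw x)) p v = D f (sw p) (sw v)"
proof -
  have "((\<lambda>x. f (sw x)) has_derivative (\<lambda>v. D f (sw p) (sw v))) (at p)"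
    by (rule has_derivative_compose[OF bounded_linear_imp_has_derivative[OF bounded_linear_swap] smooth_onD(1)[OF assms]])
  then show ?thesis by (simp add: frechet_derivative_at[symmetric])
qed

lemma tangent_space_swap:
  assumes "v \<in> tangent_space M (sw p)"
  shows "sw v \<in> tangent_space (sw -` M) p"
  unfolding tangent_space_def
proof (intro CollectI allI impI)
  fix W and h :: "C2 \<Rightarrow> real"
  assume h: "open W \<and> p \<in> W \<and> smooth_on W h \<and> (\<forall>q\<in>sw -` M \<inter> W. h q = 0)"
  have "D (\<lambda>x. h (sw x)) (sw p) v = 0"
  proof (rule tangent_spaceD[OF assms, of "sw -` W"])
    show "open (sw -` W)" "smooth_on (sw -` W) (\<lambda>x. h (sw x))" using h open_swap smooth_on_swap_comp by blast+
    show "sw p \<in> sw -` W" using h by simp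
    show "h (sw q) = 0" if "q \<in> M \<inter> sw -` W" for q using h that by simp
  qed
  then show "D h p (sw v) = 0" using D_swap[of W h "sw p" v] h by simp
qed

lemma vimage_swap_swap: "sw -` (sw -` A) = A"
  by (rule set_eqI) simp

lemma tangent_space_swap': "v \<in> tangent_space (sw -` M) p \<Longrightarrow> sw v \<in> tangent_space M (sw p)"
  using tangent_space_swap[of v "sw -` M" "sw p"] by (simp only: vimage_swap_swap swap_swap)

lemma closed_leaf_param_swap:
  assumes "closed_leaf_param (omega a) K \<gamma>"
  shows "closed_leaf_param (omega (1 - a)) (sw -` K) (\<lambda>t. sw (\<gamma> t))"
    "vector_derivative (\<lambda>t. sw (\<gamma> t)) (at t) = sw (vector_derivative \<gamma> (at t))"
proof -
  have sm: "smooth_on UNIV \<gamma>" and per: "\<And>t. \<gamma> (t + 2 * pi) = \<gamma> t" and inj: "inj_on \<gamma> {0..<2 * pi}"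
    and ran: "range \<gamma> = K"
    and pos: "\<And>t. positive_leaf_vector (omega a) (\<gamma> t) (vector_derivative \<gamma> (at t))"
    using assms unfolding closed_leaf_param_def by simp_all
  show vd: "vector_derivative (\<lambda>t. sw (\<gamma> t)) (at t) = sw (vector_derivative \<gamma> (at t))" for t
  proof (rule vector_derivative_at[OF bounded_linear.has_vector_derivative[OF bounded_linear_swap]])
    show "(\<gamma> has_vector_derivative vector_derivative \<gamma> (at t)) (at t)"
      unfolding vector_derivative_works[symmetric] by (rule differentiableI[OF smooth_onD(1)[OF sm UNIV_I]])
  qed
  show "closed_leaf_param (omega (1 - a)) (sw -` K) (\<lambda>t. sw (\<gamma> t))"
    unfolding closed_leaf_param_def vd
  proof (intro conjI allI)
    show "smooth_on UNIV (\<lambda>t. sw (\<gamma> t))"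
      using sm Ck_on_linear_compose[OF bounded_linear_swap open_UNIV] unfolding smooth_on_def by blast
    show "inj_on (\<lambda>t. sw (\<gamma> t)) {0..<2 * pi}"
      using inj unfolding inj_on_def by (metis swap_swap)
    show "range (\<lambda>t. sw (\<gamma> t)) = sw -` K"
    proof (intro equalityI subsetI)
      fix p assume "p \<in> sw -` K"
      then obtain t where "sw p = \<gamma> t" using ran by blast
      then have "p = sw (\<gamma> t)" by (metis swap_swap)
      then show "p \<in> range (\<lambda>t. sw (\<gamma> t))" by blast
    qed (use ran in auto)
    show "positive_leaf_vector (omega (1 - a)) (sw (\<gamma> t)) (sw (vector_derivative \<gamma> (at t)))" for t
      by (rule positive_leaf_vector_swap[OF pos])
  qed (simp add: per)
qed

lemma eq_on_swap:
  assumes "A \<inter> W = {q \<in> S3 \<inter> W. P q}"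
  shows "sw -` A \<inter> sw -` W = {q \<in> S3 \<inter> sw -` W. P (sw q)}"
proof (rule set_eqI)
  fix q
  have "sw q \<in> A \<inter> W \<longleftrightarrow> sw q \<in> {q \<in> S3 \<inter> W. P q}" using assms by simp
  then show "q \<in> sw -` A \<inter> sw -` W \<longleftrightarrow> q \<in> {q \<in> S3 \<inter> sw -` W. P (sw q)}"
    by (simp only: vimage_eq Int_iff mem_Collect_eq S3_swap)
qed

lemma seifert_surface_swap:
  assumes "seifert_surface K \<Sigma>"
  shows "seifert_surface (sw -` K) (sw -` \<Sigma>)"
proof -
  have \<Sigma>: "\<Sigma> \<subseteq> S3" "compact \<Sigma>" "connected \<Sigma>" "K \<subseteq> \<Sigma>" using assms unfolding seifert_surface_def by simp_all
  have int: "\<forall>p\<in>\<Sigma> - K. \<exists>W (h :: C2 \<Rightarrow> real). open W \<and> p \<in> W \<and> smooth_on W h \<and>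
        \<Sigma> \<inter> W = {q \<in> S3 \<inter> W. h q = 0} \<and> (\<exists>v\<in>tangent_S3 p. D h p v \<noteq> 0)"
    using assms unfolding seifert_surface_def by (elim conjE)
  have img: "sw -` A = sw ` A" for A :: "C2 set"
  proof (intro equalityI subsetI)
    fix p assume "p \<in> sw -` A"
    then have "sw p \<in> A" "p = sw (sw p)" by simp_all
    then show "p \<in> sw ` A" by blast
  qed auto
  show ?thesis
    unfolding seifert_surface_def
  proof (intro conjI ballI)
    show "sw -` \<Sigma> \<subseteq> S3"
    proof
      fix p assume "p \<in> sw -` \<Sigma>"
      then have "sw p \<in> S3" using \<Sigma>(1) by (simp add: subset_iff del: split_paired_All)
      then show "p \<in> S3" by (simp only: S3_swap)
    qed
    show "compact (sw -` \<Sigma>)" unfolding img by (intro compact_continuous_image \<Sigma>(2) linear_continuous_on bounded_linear_swap)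
    show "connected (sw -` \<Sigma>)" unfolding img by (intro connected_continuous_image \<Sigma>(3) linear_continuous_on bounded_linear_swap)
    show "sw -` K \<subseteq> sw -` \<Sigma>" using \<Sigma>(4) by blast
    show "\<exists>W (h :: C2 \<Rightarrow> real). open W \<and> p \<in> W \<and> smooth_on W h \<and>
        sw -` \<Sigma> \<inter> W = {q \<in> S3 \<inter> W. h q = 0} \<and> (\<exists>v\<in>tangent_S3 p. D h p v \<noteq> 0)"
      if p: "p \<in> sw -` \<Sigma> - sw -` K" for p
    proof -
      have "sw p \<in> \<Sigma> - K" using p by simp
      from bspec[OF int this] obtain W and h :: "C2 \<Rightarrow> real" where h: "open W" "sw p \<in> W" "smooth_on W h"
        "\<Sigma> \<inter> W = {q \<in> S3 \<inter> W. h q = 0}" "\<exists>v\<in>tangent_S3 (sw p). D h (sw p) v \<noteq> 0"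
        by (elim exE conjE) (rule that)
      obtain v where v: "v \<in> tangent_S3 (sw p)" "D h (sw p) v \<noteq> 0" using h(5) by blast
      show ?thesis
      proof (intro exI[of _ "sw -` W"] exI[of _ "\<lambda>x. h (sw x)"] conjI bexI[of _ "sw v"])
        show "sw -` \<Sigma> \<inter> sw -` W = {q \<in> S3 \<inter> sw -` W. h (sw q) = 0}"
          using eq_on_swap[OF h(4)] .
        show "D (\<lambda>x. h (sw x)) p (sw v) \<noteq> 0" unfolding D_swap[OF h(3,2)] using v(2) by simp
        show "sw v \<in> tangent_S3 p" using v(1) tangent_S3_swap(2)[of v p] by simp
        show "open (sw -` W)" by (rule open_swap[OF h(1)])
        show "p \<in> sw -` W" using h(2) by simp
        show "smooth_on (sw -` W) (\<lambda>x. h (sw x))" by (rule smooth_on_swap_comp[OF h(1,3)])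
      qed
    qed
    show "\<exists>W (h :: C2 \<Rightarrow> real) (k :: C2 \<Rightarrow> real). open W \<and> p \<in> W \<and> smooth_on W h \<and> smooth_on W k \<and>
        sw -` \<Sigma> \<inter> W = {q \<in> S3 \<inter> W. h q = 0 \<and> k q \<ge> 0} \<and> sw -` K \<inter> W = {q \<in> S3 \<inter> W. h q = 0 \<and> k q = 0} \<and>
        (\<forall>x y. \<exists>v\<in>tangent_S3 p. D h p v = x \<and> D k p v = y)"
      if p: "p \<in> sw -` K" for p
    proof -
      have "sw p \<in> K" using p by simp
      then obtain W h k where c: "boundary_chart K \<Sigma> (sw p) W h k" by (rule boundary_chart_exists[OF assms])
      then have W: "open W" "sw p \<in> W" "smooth_on W h" "smooth_on W k"
        and \<Sigma>W: "\<Sigma> \<inter> W = {q \<in> S3 \<inter> W. h q = 0 \<and> k q \<ge> 0}"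
        and KW: "K \<inter> W = {q \<in> S3 \<inter> W. h q = 0 \<and> k q = 0}"
        and surj: "\<And>x y. \<exists>v\<in>tangent_S3 (sw p). D h (sw p) v = x \<and> D k (sw p) v = y"
        unfolding boundary_chart_def by simp_all
      show ?thesis
      proof (rule exI[of _ "sw -` W"], rule exI[of _ "\<lambda>x. h (sw x)"], rule exI[of _ "\<lambda>x. k (sw x)"], intro conjI allI)
        show "sw -` \<Sigma> \<inter> sw -` W = {q \<in> S3 \<inter> sw -` W. h (sw q) = 0 \<and> k (sw q) \<ge> 0}"
          using eq_on_swap[OF \<Sigma>W] .
        show "sw -` K \<inter> sw -` W = {q \<in> S3 \<inter> sw -` W. h (sw q) = 0 \<and> k (sw q) = 0}"
          using eq_on_swap[OF KW] .
        fix x y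
        obtain v where v: "v \<in> tangent_S3 (sw p)" "D h (sw p) v = x" "D k (sw p) v = y" using surj by blast
        have "sw v \<in> tangent_S3 p" using v(1) tangent_S3_swap(2)[of v p] by simp
        moreover have "D (\<lambda>x. h (sw x)) p (sw v) = x" "D (\<lambda>x. k (sw x)) p (sw v) = y"
          unfolding D_swap[OF W(3,2)] D_swap[OF W(4,2)] using v(2,3) by simp_all
        ultimately show "\<exists>v\<in>tangent_S3 p. D (\<lambda>x. h (sw x)) p v = x \<and> D (\<lambda>x. k (sw x)) p v = y" by blast
        show "open (sw -` W)" by (rule open_swap[OF W(1)])
        show "p \<in> sw -` W" using W(2) by simp
        show "smooth_on (sw -` W) (\<lambda>x. h (sw x))" "smooth_on (sw -` W) (\<lambda>x. k (sw x))"
          by (rule smooth_on_swap_comp[OF W(1)], rule W)+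
      qed
    qed
    show "\<exists>n. continuous_on (sw -` \<Sigma>) n \<and> (\<forall>p\<in>sw -` \<Sigma>. n p \<noteq> 0 \<and> n p \<in> tangent_S3 p \<and> (\<forall>v\<in>tangent_space (sw -` \<Sigma>) p. inner (n p) v = 0))"
    proof -
      obtain n where n: "continuous_on \<Sigma> n"
        "\<forall>p\<in>\<Sigma>. n p \<noteq> 0 \<and> n p \<in> tangent_S3 p \<and> (\<forall>v\<in>tangent_space \<Sigma> p. inner (n p) v = 0)"
        using assms unfolding seifert_surface_def by blast
      show ?thesis
      proof (intro exI[of _ "\<lambda>p. sw (n (sw p))"] conjI ballI)
        have "continuous_on (sw -` \<Sigma>) (\<lambda>p. n (sw p))"
          by (rule continuous_on_compose2[OF n(1) linear_continuous_on[OF bounded_linear_swap]]) auto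
        then show "continuous_on (sw -` \<Sigma>) (\<lambda>p. sw (n (sw p)))"
          by (rule bounded_linear.continuous_on[OF bounded_linear_swap])
        fix p assume p: "p \<in> sw -` \<Sigma>"
        then have np: "n (sw p) \<noteq> 0" "n (sw p) \<in> tangent_S3 (sw p)" "\<And>v. v \<in> tangent_space \<Sigma> (sw p) \<Longrightarrow> inner (n (sw p)) v = 0"
          using n(2) by simp_all
        show "sw (n (sw p)) \<noteq> 0" using np(1) norm_swap[of "n (sw p)"] by (metis norm_eq_zero)
        show "sw (n (sw p)) \<in> tangent_S3 p" using np(2) tangent_S3_swap(2)[of "n (sw p)" p] by simp
        fix v assume "v \<in> tangent_space (sw -` \<Sigma>) p"
        then have "inner (n (sw p)) (sw v) = 0" by (intro np(3) tangent_space_swap')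
        then show "inner (sw (n (sw p))) v = 0" using inner_swap[of "n (sw p)" "sw v"] by simp
      qed
    qed
  qed
qed

lemma seifert_section_swap:
  assumes c: "closed_leaf_param (omega a) K \<gamma>" and s: "seifert_section \<gamma> \<Sigma> Z"
  shows "seifert_section (\<lambda>t. sw (\<gamma> t)) (sw -` \<Sigma>) (\<lambda>t. sw (Z t))"
  unfolding seifert_section_def closed_leaf_param_swap(2)[OF c]
proof (intro conjI allI)
  have Z: "smooth_on UNIV Z" "\<And>t. Z (t + 2 * pi) = Z t" "\<And>t. Z t \<in> tangent_space \<Sigma> (\<gamma> t)"
    "\<And>t. Z t \<notin> span {vector_derivative \<gamma> (at t)}"
    using s unfolding seifert_section_def by simp_all
  show "smooth_on UNIV (\<lambda>t. sw (Z t))"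
    using Z(1) Ck_on_linear_compose[OF bounded_linear_swap open_UNIV] unfolding smooth_on_def by blast
  show "sw (Z (t + 2 * pi)) = sw (Z t)" for t by (simp add: Z(2))
  show "sw (Z t) \<in> tangent_space (sw -` \<Sigma>) (sw (\<gamma> t))" for t
    using Z(3)[of t] by (intro tangent_space_swap) simp
  show "sw (Z t) \<notin> span {sw (vector_derivative \<gamma> (at t))}" for t
  proof
    assume "sw (Z t) \<in> span {sw (vector_derivative \<gamma> (at t))}"
    then obtain k where "sw (Z t) = k *\<^sub>R sw (vector_derivative \<gamma> (at t))" by (auto simp: span_singleton)
    then have "sw (Z t) = sw (k *\<^sub>R vector_derivative \<gamma> (at t))" by (simp only: linear_scale[OF linear_swap])
    then have "Z t = k *\<^sub>R vector_derivative \<gamma> (at t)" by (metis swap_swap)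
    then have "Z t \<in> span {vector_derivative \<gamma> (at t)}" unfolding span_singleton by (rule range_eqI)
    then show False using Z(4)[of t] by simp
  qed
qed

lemma adapted_chart_swap:
  assumes "adapted_chart (omega a) \<gamma> Z W \<Psi>"
  shows "adapted_chart (omega (1 - a)) (\<lambda>t. sw (\<gamma> t)) (\<lambda>t. sw (Z t)) (sw -` W) (\<lambda>p. \<Psi> (sw p))"
proof -
  have W: "open W" "range \<gamma> \<subseteq> W" "smooth_on W \<Psi>" "inj_on \<Psi> (W \<inter> S3)"
    and imm: "\<forall>p\<in>W \<inter> S3. \<forall>v\<in>tangent_S3 p. D \<Psi> p v = 0 \<longrightarrow> v = 0"
    and op: "openin (top_of_set (sphere 0 1 \<times> UNIV)) (\<Psi> ` (W \<inter> S3))"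
    and \<gamma>: "\<forall>t. \<Psi> (\<gamma> t) = (cis t, 0)" and Z: "\<forall>t. snd (D \<Psi> (\<gamma> t) (Z t)) = 1"
    and sl: "\<forall>p\<in>W \<inter> S3. \<exists>c. c \<noteq> 0 \<and> (\<forall>v\<in>tangent_S3 p. fst (D \<Psi> p v) = 0 \<longrightarrow> snd (D \<Psi> p v) = c * omega a p v)"
    using assms unfolding adapted_chart_def by simp_all
  have in_W: "sw p \<in> W \<inter> S3" if "p \<in> sw -` W \<inter> S3" for p using that S3_swap[of p] by simp
  show ?thesis
    unfolding adapted_chart_def
  proof (intro conjI allI ballI impI)
    show "open (sw -` W)" "smooth_on (sw -` W) (\<lambda>p. \<Psi> (sw p))" using W open_swap smooth_on_swap_comp by blast+
    show "range (\<lambda>t. sw (\<gamma> t)) \<subseteq> sw -` W" using W(2) by auto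
    show "inj_on (\<lambda>p. \<Psi> (sw p)) (sw -` W \<inter> S3)"
    proof (rule inj_onI)
      fix p q assume "p \<in> sw -` W \<inter> S3" "q \<in> sw -` W \<inter> S3" "\<Psi> (sw p) = \<Psi> (sw q)"
      then have "sw p = sw q" using inj_onD[OF W(4)] in_W by blast
      then show "p = q" by (metis swap_swap)
    qed
    show "v = 0" if p: "p \<in> sw -` W \<inter> S3" and v: "v \<in> tangent_S3 p" "D (\<lambda>p. \<Psi> (sw p)) p v = 0" for p v
    proof -
      have "D \<Psi> (sw p) (sw v) = 0" using v(2) D_swap[OF W(3), of p v] in_W[OF p] by simp
      moreover have "sw v \<in> tangent_S3 (sw p)" using v(1) by (simp only: tangent_S3_swap(1))
      ultimately have "sw v = 0" using imm in_W[OF p] by blast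
      then show ?thesis using norm_swap[of v] by simp
    qed
    have "(\<lambda>p. \<Psi> (sw p)) ` (sw -` W \<inter> S3) = \<Psi> ` (W \<inter> S3)"
    proof (intro equalityI subsetI)
      fix y assume "y \<in> \<Psi> ` (W \<inter> S3)"
      then obtain p where p: "p \<in> W \<inter> S3" "y = \<Psi> p" by blast
      then have "y = \<Psi> (sw (sw p))" "sw p \<in> sw -` W \<inter> S3" using S3_swap[of p] by simp_all
      then show "y \<in> (\<lambda>p. \<Psi> (sw p)) ` (sw -` W \<inter> S3)" by blast
    qed (use in_W in blast)
    then show "openin (top_of_set (sphere 0 1 \<times> UNIV)) ((\<lambda>p. \<Psi> (sw p)) ` (sw -` W \<inter> S3))" using op by simp
    show "\<Psi> (sw (sw (\<gamma> t))) = (cis t, 0)" for t using \<gamma> by simp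
    show "snd (D (\<lambda>p. \<Psi> (sw p)) (sw (\<gamma> t)) (sw (Z t))) = 1" for t
    proof -
      have "\<gamma> t \<in> W" using W(2) by blast
      then show ?thesis using Z D_swap[OF W(3), of "sw (\<gamma> t)" "sw (Z t)"] by simp
    qed
    fix p assume p: "p \<in> sw -` W \<inter> S3"
    obtain c where c: "c \<noteq> 0" "\<And>v. v \<in> tangent_S3 (sw p) \<Longrightarrow> fst (D \<Psi> (sw p) v) = 0 \<Longrightarrow> snd (D \<Psi> (sw p) v) = c * omega a (sw p) v"
      using sl in_W[OF p] by blast
    have pW: "sw p \<in> W" using in_W[OF p] by simp
    show "\<exists>c. c \<noteq> 0 \<and> (\<forall>v\<in>tangent_S3 p. fst (D (\<lambda>p. \<Psi> (sw p)) p v) = 0 \<longrightarrow> snd (D (\<lambda>p. \<Psi> (sw p)) p v) = c * omega (1 - a) p v)"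
      unfolding D_swap[OF W(3) pW]
    proof (intro exI[of _ "- c"] conjI ballI impI)
      fix v assume v: "v \<in> tangent_S3 p" "fst (D \<Psi> (sw p) (sw v)) = 0"
      have "sw v \<in> tangent_S3 (sw p)" using v(1) by (simp only: tangent_S3_swap(1))
      then have "snd (D \<Psi> (sw p) (sw v)) = c * omega a (sw p) (sw v)" using c(2) v(2) by blast
      then show "snd (D \<Psi> (sw p) (sw v)) = - c * omega (1 - a) p v"
        using omega_swap[of "a" "sw p" "sw v"] by simp
    qed (use c(1) in simp)
  qed
qed

lemma leaf_holonomy_swap:
  assumes "leaf_holonomy (omega a) W \<Psi> \<phi>"
  shows "leaf_holonomy (omega (1 - a)) (sw -` W) (\<lambda>p. \<Psi> (sw p)) \<phi>"
proof -
  obtain r where r: "r > 0" "\<forall>t\<in>{0..2 * pi}. \<phi> t holomorphic_on ball 0 r"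
    "\<forall>z\<in>ball 0 r. \<phi> 0 z = z \<and>
         (\<exists>c c'. \<forall>t\<in>{0..2 * pi}.
            c t \<in> W \<inter> S3 \<and> \<Psi> (c t) = (cis t, \<phi> t z) \<and>
            (c has_vector_derivative c' t) (at t within {0..2 * pi}) \<and>
            positive_leaf_vector (omega a) (c t) (c' t))"
    using assms unfolding leaf_holonomy_def by blast
  show ?thesis
    unfolding leaf_holonomy_def
  proof (intro exI[of _ r] conjI r(1,2) ballI)
    fix z assume z: "z \<in> ball (0::complex) r"
    show "\<phi> 0 z = z" using r(3) z by blast
    obtain c c' where c: "\<forall>t\<in>{0..2 * pi}.
            c t \<in> W \<inter> S3 \<and> \<Psi> (c t) = (cis t, \<phi> t z) \<and>
            (c has_vector_derivative c' t) (at t within {0..2 * pi}) \<and>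
            positive_leaf_vector (omega a) (c t) (c' t)" using r(3) z by blast
    show "\<exists>c c'. \<forall>t\<in>{0..2 * pi}.
            c t \<in> sw -` W \<inter> S3 \<and> \<Psi> (sw (c t)) = (cis t, \<phi> t z) \<and>
            (c has_vector_derivative c' t) (at t within {0..2 * pi}) \<and>
            positive_leaf_vector (omega (1 - a)) (c t) (c' t)"
    proof (rule exI[of _ "\<lambda>t. sw (c t)"], rule exI[of _ "\<lambda>t. sw (c' t)"], intro ballI conjI)
      fix t assume t: "t \<in> {0..2 * pi}"
      show "sw (c t) \<in> sw -` W \<inter> S3" using c t S3_swap[of "c t"] by simp
      show "\<Psi> (sw (sw (c t))) = (cis t, \<phi> t z)" using c t by simp
      show "((\<lambda>t. sw (c t)) has_vector_derivative sw (c' t)) (at t within {0..2 * pi})"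
        using c t by (intro bounded_linear.has_vector_derivative[OF bounded_linear_swap]) blast
      show "positive_leaf_vector (omega (1 - a)) (sw (c t)) (sw (c' t))"
        using c t by (intro positive_leaf_vector_swap) blast
    qed
  qed
qed

lemma log_monodromy_value_swap:
  assumes "log_monodromy_value (omega a) K \<mu>"
  shows "log_monodromy_value (omega (1 - a)) (sw -` K) \<mu>"
proof -
  obtain \<gamma> \<Sigma> Z W \<Psi> \<phi> L where *: "closed_leaf_param (omega a) K \<gamma>" "seifert_surface K \<Sigma>" "seifert_section \<gamma> \<Sigma> Z"
    "adapted_chart (omega a) \<gamma> Z W \<Psi>" "leaf_holonomy (omega a) W \<Psi> \<phi>"
    "continuous_on {0..2 * pi} L \<and> L 0 = 0 \<and> (\<forall>t\<in>{0..2 * pi}. (\<phi> t has_field_derivative exp (L t)) (at 0)) \<and> \<mu> = L (2 * pi)"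
    using assms unfolding log_monodromy_value_def by blast
  have "closed_leaf_param (omega (1 - a)) (sw -` K) (\<lambda>t. sw (\<gamma> t)) \<and> seifert_surface (sw -` K) (sw -` \<Sigma>) \<and>
    seifert_section (\<lambda>t. sw (\<gamma> t)) (sw -` \<Sigma>) (\<lambda>t. sw (Z t)) \<and>
    adapted_chart (omega (1 - a)) (\<lambda>t. sw (\<gamma> t)) (\<lambda>t. sw (Z t)) (sw -` W) (\<lambda>p. \<Psi> (sw p)) \<and>
    leaf_holonomy (omega (1 - a)) (sw -` W) (\<lambda>p. \<Psi> (sw p)) \<phi> \<and> continuous_on {0..2 * pi} L \<and> L 0 = 0 \<and>
    (\<forall>t\<in>{0..2 * pi}. (\<phi> t has_field_derivative exp (L t)) (at 0)) \<and> \<mu> = L (2 * pi)"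
    using closed_leaf_param_swap(1)[OF *(1)] seifert_surface_swap[OF *(2)] seifert_section_swap[OF *(1,3)]
      adapted_chart_swap[OF *(4)] leaf_holonomy_swap[OF *(5)] *(6) by blast
  then show ?thesis unfolding log_monodromy_value_def by blast
qed

lemma has_log_monodromy_swap:
  assumes "has_log_monodromy (omega a) K \<mu>"
  shows "has_log_monodromy (omega (1 - a)) (sw -` K) \<mu>"
  unfolding has_log_monodromy_def
proof (intro allI iffI)
  fix \<nu>
  show "log_monodromy_value (omega (1 - a)) (sw -` K) \<nu>" if "\<nu> = \<mu>"
    using assms that log_monodromy_value_swap unfolding has_log_monodromy_def by blast
  assume "log_monodromy_value (omega (1 - a)) (sw -` K) \<nu>"
  from log_monodromy_value_swap[OF this]
  have "log_monodromy_value (omega a) K \<nu>" by (simp add: vimage_swap_swap)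
  then show "\<nu> = \<mu>" using assms unfolding has_log_monodromy_def by blast
qed

section \<open>The two Hopf circles\<close>

theorem proposition5p4:
  fixes a :: complex
  assumes "a \<in> (UNIV - \<real>) \<union> complex_of_real ` {0<..<1}"
  shows "has_log_monodromy (omega a) (sphere 0 1 \<times> {0}) (2 * pi * \<i> * (1 - a) / a) \<and>
         has_log_monodromy (omega a) ({0} \<times> sphere 0 1) (2 * pi * \<i> * a / (1 - a))"
proof
  have a: "a \<noteq> 0" "1 - a \<noteq> 0" using assms by auto
  show "has_log_monodromy (omega a) (sphere 0 1 \<times> {0}) (2 * pi * \<i> * (1 - a) / a)"
    by (rule hopf_has_log_monodromy[OF a(1)])
  have "sw -` hopf_circle = {0} \<times> sphere 0 1" by (rule set_eqI) (auto simp: mem_Times_iff)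
  with has_log_monodromy_swap[OF hopf_has_log_monodromy[OF a(2)]]
  show "has_log_monodromy (omega a) ({0} \<times> sphere 0 1) (2 * pi * \<i> * a / (1 - a))" by simp
qed

end
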